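(* Let $\Phi$, $\varphi$, $V$ be as in the standing assumption (see context), and suppose $\varphi\in\mathcal Z_{C_1}(\mathbb R^d)$ for every $C_1\in(0,1)$. Suppose that there exist $\alpha\in(0,2)$ and a function $\ell$ slowly varying at zero such that $\Phi(u)\sim u^{\alpha/2}\ell(u)$ as $u\downarrow0$. Assume that there exist $C_\varphi>0$, $\kappa\in\left(0,\frac d2\right)$ and a decreasing function $\rho:\mathbb R^+\to\mathbb R^+$ with $\varphi(x)=\rho(|x|)$ such that $\rho(r)\sim C_\varphi r^{-2\kappa}$ as $r\to\infty$. Moreover, suppose that for every $C_1\in(0,1)$ the function $L_\varphi$ associated with $\varphi\in\mathcal Z_{C_1}(\mathbb R^d)$ satisfies $$L_\varphi(x)\sim\frac{C_\varphi\,4\kappa(2\kappa+1)d^2}{(1-C_1)^{2\kappa+2}|x|^{2\kappa+2}},\qquad|x|\to\infty.$$ Define for $t\in(0,1)$ and $\eta>0$ $$\begin{aligned}H_-(t;d,\alpha,\kappa,\eta)={}&\frac1{(d-2\kappa)t^{d+\alpha}}+\frac{2\kappa(2\kappa+1)d^2t^{2-\alpha}}{(2-\alpha)(1-t)^{2\kappa+2}}\\&+\left(\frac{2\kappa d+(d+\eta)\alpha}{(d+\eta-2\kappa)\eta}\right)^{\frac{2\kappa}{d+\eta}}\frac{d+\eta-2\kappa}{2d\kappa+(d+\eta)\alpha}\,\frac1{t^{\frac{2d\kappa+(d+\eta)\alpha}{d+\eta}}}-\left(\frac1{\alpha(1+t)^\alpha}+\frac{(1-t)^d}{d(2-t)^{d+\alpha}}\right).\end{aligned}$$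 If $$K_-(d,\alpha,\kappa,\eta):=\min_{t\in(0,1)}H_-(t;d,\alpha,\kappa,\eta)<0,$$ then there exists $R>0$ such that $V(x)<0$ for every $x\in B^c_R(0)$.
   Context: Notation: $\mathbb R^+=[0,\infty)$; $B_r(a)$ is the open ball in $\mathbb R^d$, $B_r^c(a)$ its complement; $D_hf(x)=f(x+h)-2f(x)+f(x-h)$. $f\sim g$ means the ratio tends to $1$. A measurable $\ell:(0,\infty)\to(0,\infty)$ is slowly varying at zero if $\widetilde\ell(t)=\ell(1/t)$ satisfies $\lim_{t\to\infty}\widetilde\ell(ct)/\widetilde\ell(t)=1$ for every $c>0$. $\Phi$ is a complete Bernstein function with Lévy pair $(0,\mu)$: $\Phi(u)=\int_0^\infty(1-e^{-ut})\mu(t)\,dt$ with $\mu:(0,\infty)\to[0,\infty)$ completely monotone and $\int_0^\infty\min(1,t)\mu(t)\,dt<\infty$. The jump kernel is $j(r)=(4\pi)^{-d/2}\int_0^\infty t^{-d/2}e^{-r^2/(4t)}\mu(t)\,dt$, $r>0$. $\Phi(-\Delta)$ is the operator on $L^2(\mathbb R^d)$ with Fourier multiplier $\Phi(|y|^2)$. Standing assumption: $V:\mathbb R^d\to\mathbb R$ is a potential, $H=\Phi(-\Delta)+V$, and $\varphi\in L^2(\mathbb R^d)\cap L^\infty(\mathbb R^d)$, $\varphi>0$, satisfies $H\varphi=0$. The potential is understood through the pointwise expression $V(x)=-\frac{1}{\varphi(x)}\Phi(-\Delta)\varphi(x)=\frac{1}{2\varphi(x)}\int_{\mathbb R^d}D_h\varphi(x)\,j(|h|)\,dh$.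 Space: for $C\in(0,1)$, $\mathcal Z_C(\mathbb R^d)$ is the set of $f\in L^\infty(\mathbb R^d)$ for which there exist $M_f>0$ and $L_f\in L^\infty(B^c_{M_f}(0))$ (both may depend on $C$) such that $|D_hf(x)|\le L_f(x)|h|^2$ for all $x\in B^c_{M_f}(0)$ and $h\in B_{C|x|}(0)$. *)

theory Defs
  imports "HOL-Analysis.Analysis" "HOL-Library.Landau_Symbols"
begin

section \<open>Function spaces\<close>

text \<open>The space $L^\infty(S)$, for real functions and measurable \<open>S\<close>.\<close>

definition ess_bounded_on :: "'a::euclidean_space set \<Rightarrow> ('a \<Rightarrow> real) \<Rightarrow> bool" where
  "ess_bounded_on S f \<longleftrightarrow>
     f \<in> borel_measurable (lebesgue_on S) \<and> (\<exists>K. AE x in lebesgue_on S. \<bar>f x\<bar> \<le> K)"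

text \<open>The space $L^2(\mathbb R^d)$.\<close>

definition square_integrable :: "('a::euclidean_space \<Rightarrow> 'b::real_normed_vector) \<Rightarrow> bool" where
  "square_integrable f \<longleftrightarrow>
     f \<in> borel_measurable lebesgue \<and> integrable lebesgue (\<lambda>x. (norm (f x))\<^sup>2)"

definition second_diff :: "'a::real_vector \<Rightarrow> ('a \<Rightarrow> real) \<Rightarrow> 'a \<Rightarrow> real" where
  "second_diff h f x = f (x + h) - 2 * f x + f (x - h)"

text \<open>
  \<open>space_Z C\<close> is the space $\mathcal Z_C(\mathbb R^d)$. The threshold \<open>M\<close> and the function \<open>L\<close> in
  its definition are not unique; \<open>Z_bound C f M L\<close> says that \<open>M\<close> and \<open>L\<close> are an admissible
  choice for \<open>f\<close>.
\<close>

definition Z_bound ::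
    "real \<Rightarrow> ('a::euclidean_space \<Rightarrow> real) \<Rightarrow> real \<Rightarrow> ('a \<Rightarrow> real) \<Rightarrow> bool" where
  "Z_bound C f M L \<longleftrightarrow>
     M > 0 \<and> ess_bounded_on (- ball 0 M) L \<and>
     (\<forall>x \<in> - ball 0 M. \<forall>h \<in> ball 0 (C * norm x). \<bar>second_diff h f x\<bar> \<le> L x * (norm h)\<^sup>2)"

definition space_Z :: "real \<Rightarrow> ('a::euclidean_space \<Rightarrow> real) set" where
  "space_Z C = {f. ess_bounded_on UNIV f \<and> (\<exists>M L. Z_bound C f M L)}"


section \<open>Bernstein functions and the jump kernel\<close>

text \<open>Functions on $(0,\infty)$ are total functions whose values on $(-\infty,0]$ are ignored.\<close>

definition slowly_varying_at_zero :: "(real \<Rightarrow> real) \<Rightarrow> bool" where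
  "slowly_varying_at_zero l \<longleftrightarrow>
     l \<in> borel_measurable (lebesgue_on {0<..}) \<and> (\<forall>t>0. l t > 0) \<and>
     (\<forall>c>0. ((\<lambda>t. l (1 / (c * t)) / l (1 / t)) \<longlongrightarrow> 1) at_top)"

definition completely_monotone :: "(real \<Rightarrow> real) \<Rightarrow> bool" where
  "completely_monotone \<mu> \<longleftrightarrow>
     (\<forall>n. \<forall>t>0. (deriv ^^ n) \<mu> field_differentiable (at t) \<and> (- 1) ^ n * (deriv ^^ n) \<mu> t \<ge> 0)"

text \<open>\<open>\<Phi>\<close> is the complete Bernstein function with Levy pair $(0,\mu)$.\<close>

definition complete_bernstein_pair :: "(real \<Rightarrow> real) \<Rightarrow> (real \<Rightarrow> real) \<Rightarrow> bool" where
  "complete_bernstein_pair \<Phi> \<mu> \<longleftrightarrow>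
     completely_monotone \<mu> \<and>
     set_integrable lborel {0<..} (\<lambda>t. min 1 t * \<mu> t) \<and>
     (\<forall>u>0. \<Phi> u = (LBINT t:{0<..}. (1 - exp (- u * t)) * \<mu> t))"

definition jump_kernel :: "nat \<Rightarrow> (real \<Rightarrow> real) \<Rightarrow> real \<Rightarrow> real" where
  "jump_kernel d \<mu> r =
     (4 * pi) powr (- real d / 2) *
     (LBINT t:{0<..}. t powr (- real d / 2) * exp (- (r\<^sup>2) / (4 * t)) * \<mu> t)"


section \<open>The operator $\Phi(-\Delta)$ and zero-energy solutions\<close>

text \<open>
  \<open>F\<close> is the (unitary) Fourier transform of \<open>f\<close> on $L^2(\mathbb R^d)$, that is, the $L^2$-limit as
  $R\to\infty$ of the classical Fourier transforms of the truncations of \<open>f\<close> to $B_R(0)$.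
\<close>

definition fourier_L2 ::
    "('a::euclidean_space \<Rightarrow> complex) \<Rightarrow> ('a \<Rightarrow> complex) \<Rightarrow> bool" where
  "fourier_L2 f F \<longleftrightarrow>
     square_integrable f \<and> square_integrable F \<and>
     ((\<lambda>R. \<integral>\<^sup>+ y. ennreal ((norm (F y - complex_of_real ((2 * pi) powr (- real DIM('a) / 2)) *
          (LINT x:ball 0 R|lebesgue. exp (- \<i> * complex_of_real (x \<bullet> y)) * f x)))\<^sup>2) \<partial>lebesgue)
      \<longlongrightarrow> 0) at_top"

text \<open>\<open>f\<close> is in the $L^2$-domain of $\Phi(-\Delta)$, and $\Phi(-\Delta) f = g$.\<close>

definition Phi_Laplacian ::
    "(real \<Rightarrow> real) \<Rightarrow> ('a::euclidean_space \<Rightarrow> complex) \<Rightarrow> ('a \<Rightarrow> complex) \<Rightarrow> bool" where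
  "Phi_Laplacian \<Phi> f g \<longleftrightarrow>
     (\<exists>F G. fourier_L2 f F \<and> fourier_L2 g G \<and>
        (AE y in lebesgue. G y = complex_of_real (\<Phi> ((norm y)\<^sup>2)) * F y))"

text \<open>$H\varphi = 0$ in $L^2(\mathbb R^d)$ for $H = \Phi(-\Delta) + V$.\<close>

definition zero_energy_solution ::
    "(real \<Rightarrow> real) \<Rightarrow> ('a::euclidean_space \<Rightarrow> real) \<Rightarrow> ('a \<Rightarrow> real) \<Rightarrow> bool" where
  "zero_energy_solution \<Phi> V \<phi> \<longleftrightarrow>
     (\<exists>g. Phi_Laplacian \<Phi> (\<lambda>x. complex_of_real (\<phi> x)) g \<and>
        (AE x in lebesgue. g x + complex_of_real (V x * \<phi> x) = 0))"

text \<open>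
  $V(x) = \frac{1}{2\varphi(x)} \int D_h\varphi(x)\, j(|h|)\, dh$, required at exactly those points
  \<open>x\<close> where the integral converges absolutely: the Bochner integral of a non-integrable function
  is 0 by convention, which must not be read as information about \<open>V\<close>.
\<close>

definition pointwise_potential ::
    "(real \<Rightarrow> real) \<Rightarrow> ('a::euclidean_space \<Rightarrow> real) \<Rightarrow> ('a \<Rightarrow> real) \<Rightarrow> bool" where
  "pointwise_potential \<mu> V \<phi> \<longleftrightarrow>
     (\<forall>x. integrable lebesgue (\<lambda>h. second_diff h \<phi> x * jump_kernel DIM('a) \<mu> (norm h)) \<longrightarrow>
        V x = 1 / (2 * \<phi> x) *
          (LINT h|lebesgue. second_diff h \<phi> x * jump_kernel DIM('a) \<mu> (norm h)))"


section \<open>The functions $H_-$ and $K_-$\<close>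

definition H_minus :: "real \<Rightarrow> nat \<Rightarrow> real \<Rightarrow> real \<Rightarrow> real \<Rightarrow> real" where
  "H_minus t d \<alpha> \<kappa> \<eta> =
     1 / ((d - 2 * \<kappa>) * t powr (d + \<alpha>))
     + 2 * \<kappa> * (2 * \<kappa> + 1) * (real d)\<^sup>2 * t powr (2 - \<alpha>) / ((2 - \<alpha>) * (1 - t) powr (2 * \<kappa> + 2))
     + ((2 * \<kappa> * d + (d + \<eta>) * \<alpha>) / ((d + \<eta> - 2 * \<kappa>) * \<eta>)) powr (2 * \<kappa> / (d + \<eta>))
       * ((d + \<eta> - 2 * \<kappa>) / (2 * real d * \<kappa> + (d + \<eta>) * \<alpha>))
       * (1 / t powr ((2 * real d * \<kappa> + (d + \<eta>) * \<alpha>) / (d + \<eta>)))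
     - (1 / (\<alpha> * (1 + t) powr \<alpha>) + (1 - t) ^ d / (d * (2 - t) powr (d + \<alpha>)))"

text \<open>The least value on $(0,1)$; \<open>H_minus_attains_min\<close> below shows that it is attained.\<close>

definition K_minus :: "nat \<Rightarrow> real \<Rightarrow> real \<Rightarrow> real \<Rightarrow> real" where
  "K_minus d \<alpha> \<kappa> \<eta> = (LEAST m. m \<in> (\<lambda>t. H_minus t d \<alpha> \<kappa> \<eta>) ` {0<..<1})"

lemma coercive_attains_min:
  fixes f :: "real \<Rightarrow> real"
  assumes cont: "continuous_on {0<..<1} f"
    and 0: "filterlim f at_top (at_right 0)" and 1: "filterlim f at_top (at_left 1)"
  shows "\<exists>s\<in>{0<..<1}. \<forall>t\<in>{0<..<1}. f s \<le> f t"
proof -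
  obtain a where a: "a > 0" "\<And>t. 0 < t \<Longrightarrow> t < a \<Longrightarrow> f (1/2) \<le> f t"
    using 0 unfolding filterlim_at_top eventually_at_right_field by blast
  obtain b where b: "b < 1" "\<And>t. b < t \<Longrightarrow> t < 1 \<Longrightarrow> f (1/2) \<le> f t"
    using 1 unfolding filterlim_at_top eventually_at_left_field by blast
  define I where "I = {min a (1/2) .. max b (1/2)}"
  have I: "I \<subseteq> {0<..<1}" "1/2 \<in> I" "compact I"
    using a b by (auto simp: I_def)
  obtain s where s: "s \<in> I" "\<And>t. t \<in> I \<Longrightarrow> f s \<le> f t"
    using continuous_attains_inf[of I f] I continuous_on_subset[OF cont I(1)] by blast
  have "f s \<le> f t" if t: "t \<in> {0<..<1}" for t
  proof (cases "t \<in> I")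
    case True
    then show ?thesis using s by blast
  next
    case False
    then have "t < a \<or> b < t" using t by (auto simp: I_def)
    then have "f (1/2) \<le> f t" using a b t by auto
    then show ?thesis using s(2)[OF I(2)] by linarith
  qed
  then show ?thesis using s(1) I(1) by blast
qed

lemma H_minus_attains_min:
  fixes d :: nat and \<alpha> \<kappa> \<eta> :: real
  assumes "0 < d" "0 < \<alpha>" "\<alpha> < 2" "0 < \<kappa>" "\<kappa> < d / 2" "0 < \<eta>"
  shows "\<exists>s\<in>{0<..<1}. K_minus d \<alpha> \<kappa> \<eta> = H_minus s d \<alpha> \<kappa> \<eta> \<and>
           (\<forall>t\<in>{0<..<1}. H_minus s d \<alpha> \<kappa> \<eta> \<le> H_minus t d \<alpha> \<kappa> \<eta>)"
proof -
  let ?H = "\<lambda>t. H_minus t d \<alpha> \<kappa> \<eta>"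
  define A where "A = (\<lambda>t::real. 1 / ((d - 2 * \<kappa>) * t powr (d + \<alpha>)))"
  define B where "B = (\<lambda>t::real.
    2 * \<kappa> * (2 * \<kappa> + 1) * (real d)\<^sup>2 * t powr (2 - \<alpha>) / ((2 - \<alpha>) * (1 - t) powr (2 * \<kappa> + 2)))"
  define c where "c = 1 / \<alpha> + 1 / d"
  have pos: "real d - 2 * \<kappa> > 0" "real d + \<eta> - 2 * \<kappa> > 0" "2 - \<alpha> > 0" "real d + \<alpha> > 0"
    "2 * \<kappa> + 2 > 0"
    using assms by linarith+
  have lower: "A t - c \<le> ?H t" "B t - c \<le> ?H t" if t: "t \<in> {0<..<1}" for t
  proof -
    have nn: "A t \<ge> 0" "B t \<ge> 0"
      using t pos assms by (auto simp: A_def B_def)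
    have third: "((2 * \<kappa> * d + (d + \<eta>) * \<alpha>) / ((d + \<eta> - 2 * \<kappa>) * \<eta>)) powr (2 * \<kappa> / (d + \<eta>))
       * ((d + \<eta> - 2 * \<kappa>) / (2 * real d * \<kappa> + (d + \<eta>) * \<alpha>))
       * (1 / t powr ((2 * real d * \<kappa> + (d + \<eta>) * \<alpha>) / (d + \<eta>))) \<ge> 0"
      using t pos assms by (intro mult_nonneg_nonneg divide_nonneg_nonneg) auto
    have "1 \<le> (1 + t) powr \<alpha>" "1 \<le> (2 - t) powr (d + \<alpha>)"
      using t assms by (auto intro!: ge_one_powr_ge_zero)
    moreover have "(1 - t) ^ d \<le> 1"
      using t by (intro power_le_one) auto
    ultimately have "1 / (\<alpha> * (1 + t) powr \<alpha>) \<le> 1 / \<alpha>"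
      "(1 - t) ^ d / (d * (2 - t) powr (d + \<alpha>)) \<le> 1 / d"
      using assms t by (auto intro!: frac_le)
    then show "A t - c \<le> ?H t" "B t - c \<le> ?H t"
      using nn third unfolding H_minus_def A_def B_def c_def by linarith+
  qed
  have "continuous_on {0<..<1} ?H"
    unfolding H_minus_def using pos assms by (intro continuous_intros) auto
  moreover have "filterlim ?H at_top (at_right 0)"
  proof -
    have "((\<lambda>t::real. (d - 2 * \<kappa>) * t powr (d + \<alpha>)) \<longlongrightarrow> 0) (at_right 0)"
      using pos by (auto intro!: tendsto_eq_intros tendsto_zero_powrI simp: eventually_at_right_field)
    moreover have "eventually (\<lambda>t::real. 0 < (d - 2 * \<kappa>) * t powr (d + \<alpha>)) (at_right 0)"
      using pos by (auto simp: eventually_at_right_field intro: exI[of _ 1])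
    ultimately have "filterlim A at_top (at_right 0)"
      unfolding A_def by (intro filterlim_inverse_at_top[unfolded inverse_eq_divide])
    then have "filterlim (\<lambda>t. - c + A t) at_top (at_right 0)"
      by (intro filterlim_tendsto_add_at_top[OF tendsto_const])
    then show ?thesis
    proof (rule filterlim_at_top_mono)
      show "eventually (\<lambda>t. - c + A t \<le> ?H t) (at_right 0)"
        using lower(1) by (auto simp: eventually_at_right_field algebra_simps intro!: exI[of _ 1])
    qed
  qed
  moreover have "filterlim ?H at_top (at_left 1)"
  proof -
    define k where "k = 2 * \<kappa> * (2 * \<kappa> + 1) * (real d)\<^sup>2"
    have k: "k > 0" using assms by (simp add: k_def)
    have "((\<lambda>t::real. (2 - \<alpha>) * (1 - t) powr (2 * \<kappa> + 2)) \<longlongrightarrow> 0) (at_left 1)"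
    proof -
      have "((\<lambda>t::real. (1 - t) powr (2 * \<kappa> + 2)) \<longlongrightarrow> 0) (at_left 1)"
        by (rule tendsto_zero_powrI[where b = "2 * \<kappa> + 2"])
           (use pos in \<open>auto intro!: tendsto_eq_intros exI[of _ 0] simp: eventually_at_left_field\<close>)
      then show ?thesis by (auto intro: tendsto_mult_right_zero)
    qed
    moreover have "eventually (\<lambda>t::real. 0 < (2 - \<alpha>) * (1 - t) powr (2 * \<kappa> + 2)) (at_left 1)"
      using pos by (auto simp: eventually_at_left_field intro: exI[of _ 0])
    ultimately have "filterlim (\<lambda>t::real. inverse ((2 - \<alpha>) * (1 - t) powr (2 * \<kappa> + 2)))
        at_top (at_left 1)"
      by (rule filterlim_inverse_at_top)
    moreover have "((\<lambda>t::real. k * t powr (2 - \<alpha>)) \<longlongrightarrow> k) (at_left 1)"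
      by (auto intro!: tendsto_eq_intros)
    ultimately have "filterlim (\<lambda>t. (k * t powr (2 - \<alpha>)) *
        inverse ((2 - \<alpha>) * (1 - t) powr (2 * \<kappa> + 2))) at_top (at_left 1)"
      using k by (intro filterlim_tendsto_pos_mult_at_top[where c = k]) auto
    then have "filterlim B at_top (at_left 1)"
      unfolding B_def k_def by (simp add: divide_inverse mult_ac)
    then have "filterlim (\<lambda>t. - c + B t) at_top (at_left 1)"
      by (intro filterlim_tendsto_add_at_top[OF tendsto_const])
    then show ?thesis
    proof (rule filterlim_at_top_mono)
      show "eventually (\<lambda>t. - c + B t \<le> ?H t) (at_left 1)"
        using lower(2) by (auto simp: eventually_at_left_field algebra_simps intro!: exI[of _ 0])
    qed
  qed
  ultimately obtain s where s: "s \<in> {0<..<1}" "\<And>t. t \<in> {0<..<1} \<Longrightarrow> ?H s \<le> ?H t"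
    using coercive_attains_min[of ?H] by blast
  have "K_minus d \<alpha> \<kappa> \<eta> = ?H s"
    unfolding K_minus_def by (rule Least_equality) (use s in auto)
  then show ?thesis using s by blast
qed

end

theory Submission
  imports Defs
begin

text \<open>
  Put $r = |x|$, $e = x/r$ and $a = \alpha/2$. The substitution $h = ry$ turns
  $\int D_h\varphi(x)\,j(|h|)\,dh$ into a positive multiple of
  $\int D_{ry}\varphi(x)\,J_r(|y|)\,dy$, where $J_r$ arises by subordinating the heat kernel to the
  rescaled Levy density $\nu_r(t) = r^2\mu(r^2t)/\Phi(r^{-2})$. As $r\to\infty$ one has
  $J_r(s)\to K s^{-d-\alpha}$ and $\rho(rs)/\rho(r)\to s^{-2\kappa}$, so that everything reduces to an
  integral of powers of $|y|$ and $|y\pm e|$. It turns out that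
  $\limsup \frac1{\rho(r)}\int D_{ry}\varphi(x)\,J_r(|y|)\,dy \le 2K\omega\,H_-(t)$ for every $t\in(0,1)$, where
  $\omega$ is the area of the unit sphere; for the minimiser $t$ the right-hand side is
  negative.

  \<^bold>\<open>The kernel.\<close> Regular variation of $\Phi$ says that
  $\int(1-e^{-ut})\nu_r(t)\,dt = \Phi(u/r^2)/\Phi(1/r^2)\to u^a$ for each $u>0$. The finite measures
  $(1-e^{-t})\nu_r(t)\,dt$ therefore have convergent integrals against all powers of $e^{-t}$, hence, by
  the Weierstrass theorem, against all continuous functions of $e^{-t}$; since the $\nu_r$ are
  decreasing, this improves to the pointwise limit $\nu_r(t)\to c\,t^{-1-a}$
  (\<open>density_tendsto\<close>). In the other limits that involve the kernel the majorants are multiples of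
  $(1-e^{-t})\nu_r(t)$ or of $\min(1,|y|^2)J_r(|y|)$. These vary with $r$, but they
  converge together with their integrals, and this is enough for dominated convergence
  (\<open>dominated_by_convergent_integrals\<close>).

  \<^bold>\<open>The bound.\<close> Split the integral at $|y|=t$. Inside, the bound by $L_\varphi(x)|h|^2$ produces the
  second term of $H_-$. Outside, $D_{ry}\varphi(x) = \rho(r|y+e|)+\rho(r|y-e|)-2\rho(r)$. The last summand
  contributes, up to the common factor $2K\omega$, $-t^{-\alpha}/\alpha$, which is at most the negative part of $H_-$
  (\<open>tail_mass_ge\<close>). Each of the other two is split according to $|z|<1$ or $|z|\ge1$ with
  $z=y\pm e$ (\<open>shifted_bound_le\<close>). For $|z|<1$ the kernel is at most $J_r(t)$, which leaves the integral of
  the profile over the unit ball and gives the first term of $H_-$. For $|z|\ge1$ Hoelder's inequality with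
  exponents $\frac{d+\eta}{2\kappa}$ and $\frac{d+\eta}{d+\eta-2\kappa}$ decouples profile and kernel; the
  product of the two norms is the third term of $H_-$ (\<open>Hoelder_constant_eq\<close>).
\<close>

section \<open>Radial integrals, scalings and translations\<close>

definition sphere_area :: "'a::euclidean_space itself \<Rightarrow> real" where
  "sphere_area _ = real DIM('a) * unit_ball_vol DIM('a)"

lemma sphere_area_pos: "sphere_area TYPE('a::euclidean_space) > 0"
  by (simp add: sphere_area_def unit_ball_vol_pos)

text \<open>
  The two measures agree on all half-lines $(-\infty,a]$ because the ball of radius $a$ has
  volume proportional to $a^d$. This reduces radial integrals to one-dimensional ones.
\<close>

lemma distr_norm_lborel:
  "distr (lborel :: 'a::euclidean_space measure) borel norm =
     density lborel (\<lambda>s. ennreal (indicator {0<..} s * (sphere_area TYPE('a) * s ^ (DIM('a) - 1))))"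
    (is "?M = density lborel ?D")
proof (rule measure_eqI_generator_eq[where E = "range (\<lambda>a::real. {..a})" and \<Omega> = UNIV
      and A = "\<lambda>n. {..real n}"])
  let ?d = "DIM('a)" and ?w = "sphere_area TYPE('a)"
  have D [measurable]: "?D \<in> borel_measurable borel" by measurable
  have cball: "norm -` {..a} = (cball 0 a :: 'a set)" for a by auto
  have M: "emeasure ?M {..a} = (if a < 0 then 0 else ennreal (unit_ball_vol ?d * a ^ ?d))" for a
    by (auto simp: emeasure_distr cball emeasure_cball)
  have N: "emeasure (density lborel ?D) {..a} =
      (if a < 0 then 0 else ennreal (unit_ball_vol ?d * a ^ ?d))" for a
  proof -
    have e: "emeasure (density lborel ?D) {..a} = (\<integral>\<^sup>+ s. ?D s * indicator {..a} s \<partial>lborel)"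
      by (subst emeasure_density) auto
    show ?thesis
    proof (cases "a < 0")
      case True
      then have "(\<integral>\<^sup>+ s. ?D s * indicator {..a} s \<partial>lborel) = (\<integral>\<^sup>+ s. 0 \<partial>(lborel::real measure))"
        by (intro nn_integral_cong) (auto split: split_indicator)
      then show ?thesis using True e by simp
    next
      case False
      have "AE s::real in lborel. s \<noteq> 0"
        by (rule AE_lborel_singleton)
      then have "(\<integral>\<^sup>+ s. ?D s * indicator {..a} s \<partial>lborel) =
          (\<integral>\<^sup>+ s. ennreal (?w * s ^ (?d - 1)) * indicator {0..a} s \<partial>lborel)"
        by (intro nn_integral_cong_AE, eventually_elim) (auto split: split_indicator)
      also have "\<dots> = ennreal (unit_ball_vol ?d * a ^ ?d - unit_ball_vol ?d * 0 ^ ?d)"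
      proof (rule nn_integral_FTC_Icc)
        show "((\<lambda>s. unit_ball_vol ?d * s ^ ?d) has_real_derivative ?w * s ^ (?d - 1)) (at s)"
          for s :: real
          unfolding sphere_area_def by (auto intro!: derivative_eq_intros)
        show "0 \<le> ?w * s ^ (?d - 1)" if "s \<in> {0..a}" for s
          using that sphere_area_pos[where 'a='a] by simp
      qed (use False in auto)
      finally show ?thesis using False e by simp
    qed
  qed
  show "emeasure ?M X = emeasure (density lborel ?D) X" if "X \<in> range (\<lambda>a::real. {..a})" for X
    using that M N by auto
  show "emeasure ?M {..real n} \<noteq> \<infinity>" for n using M by auto
  show "Int_stable (range (\<lambda>a::real. {..a}))"
    by (auto simp: Int_stable_def)
  show "sets ?M = sigma_sets UNIV (range (\<lambda>a::real. {..a}))"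
    using arg_cong[OF borel_eq_atMost[where 'a=real], of sets] by simp
  show "sets (density lborel ?D) = sigma_sets UNIV (range (\<lambda>a::real. {..a}))"
    using arg_cong[OF borel_eq_atMost[where 'a=real], of sets] by simp
  show "(\<Union>n. {..real n}) = UNIV" using real_arch_simple by auto
qed auto

lemma nn_integral_radial:
  fixes g :: "real \<Rightarrow> real"
  assumes [measurable]: "g \<in> borel_measurable borel"
  shows "(\<integral>\<^sup>+ y. ennreal (g (norm (y::'a::euclidean_space))) \<partial>lborel) =
    (\<integral>\<^sup>+ s. ennreal (indicator {0<..} s * (sphere_area TYPE('a) * s ^ (DIM('a) - 1))) * ennreal (g s) \<partial>lborel)"
proof -
  have "(\<integral>\<^sup>+ y. ennreal (g (norm (y::'a))) \<partial>lborel) =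
      (\<integral>\<^sup>+ s. ennreal (g s) \<partial>distr (lborel :: 'a measure) borel norm)"
    by (subst nn_integral_distr) auto
  also have "\<dots> = (\<integral>\<^sup>+ s. ennreal (indicator {0<..} s * (sphere_area TYPE('a) * s ^ (DIM('a) - 1)))
      * ennreal (g s) \<partial>lborel)"
    unfolding distr_norm_lborel by (subst nn_integral_density) auto
  finally show ?thesis .
qed

lemma has_bochner_integral_norm_powr:
  fixes S :: "real set" and b I :: real
  assumes [measurable]: "S \<in> sets borel" and S: "S \<subseteq> {0..}"
    and I: "((\<lambda>s. s powr (real DIM('a) - 1 - b)) has_integral I) S"
  shows "has_bochner_integral lborel
    (\<lambda>y::'a::euclidean_space. indicator S (norm y) * norm y powr (- b)) (sphere_area TYPE('a) * I)"
proof -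
  let ?w = "sphere_area TYPE('a)" and ?e = "real DIM('a) - 1 - b"
  have I0: "I \<ge> 0"
    by (rule has_integral_nonneg[OF I]) auto
  have "(\<integral>\<^sup>+ y. ennreal (indicator S (norm (y::'a)) * norm y powr (- b)) \<partial>lborel) =
    (\<integral>\<^sup>+ s. ennreal (indicator {0<..} s * (?w * s ^ (DIM('a) - 1))) *
        ennreal (indicator S s * s powr (- b)) \<partial>lborel)"
    by (rule nn_integral_radial) auto
  also have "\<dots> = (\<integral>\<^sup>+ s. ennreal ?w * ennreal (indicator S s * s powr ?e) \<partial>lborel)"
  proof (rule nn_integral_cong)
    fix s :: real
    have "s ^ (DIM('a) - 1) * s powr (- b) = s powr ?e" if "s > 0"
    proof -
      have "real (DIM('a) - 1) = real DIM('a) - 1" using DIM_positive[where 'a='a] by linarith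
      then show ?thesis using that
        by (simp add: powr_realpow[symmetric] powr_add[symmetric])
    qed
    then show "ennreal (indicator {0<..} s * (?w * s ^ (DIM('a) - 1))) *
        ennreal (indicator S s * s powr (- b)) = ennreal ?w * ennreal (indicator S s * s powr ?e)"
      using S sphere_area_pos[where 'a='a]
      by (cases "s > 0"; cases "s = 0") (auto simp: ennreal_mult[symmetric] mult.assoc split: split_indicator)
  qed
  also have "\<dots> = ennreal ?w * (\<integral>\<^sup>+ s. ennreal (indicator S s * s powr ?e) \<partial>lborel)"
    by (rule nn_integral_cmult) measurable
  also have "(\<integral>\<^sup>+ s. ennreal (indicator S s * s powr ?e) \<partial>lborel) = ennreal I"
    using nn_integral_has_integral_lebesgue[OF _ I] by simp
  finally show ?thesis
    using I0 sphere_area_pos[where 'a='a]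
    by (intro has_bochner_integral_nn_integral) (auto simp: ennreal_mult[symmetric])
qed

lemma has_bochner_integral_norm_powr_inside:
  assumes "b < real DIM('a)" "t > 0"
  shows "has_bochner_integral lborel
    (\<lambda>y::'a::euclidean_space. indicator {..<t} (norm y) * norm y powr (- b))
    (sphere_area TYPE('a) * (t powr (real DIM('a) - b) / (real DIM('a) - b)))"
proof -
  have "((\<lambda>s. s powr (real DIM('a) - 1 - b)) has_integral
      (t powr (real DIM('a) - b) / (real DIM('a) - b))) {0..t}"
    using has_integral_powr_from_0[of "real DIM('a) - 1 - b" t] assms by simp
  then have "((\<lambda>s. s powr (real DIM('a) - 1 - b)) has_integral
      (t powr (real DIM('a) - b) / (real DIM('a) - b))) {0..<t}"
    by (subst has_integral_spike_set_eq[where T = "{0..t}"])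
       (auto intro!: negligible_subset[OF negligible_sing[of t]])
  note has_bochner_integral_norm_powr[OF _ _ this]
  moreover have "{0..<t} \<subseteq> {0..}" by auto
  moreover have "indicator {0..<t} (norm y) = (indicator {..<t} (norm y) :: real)" for y :: 'a
    by (simp add: indicator_def)
  ultimately show ?thesis by simp
qed

lemma has_bochner_integral_norm_powr_outside:
  assumes "b > real DIM('a)" "t > 0"
  shows "has_bochner_integral lborel
    (\<lambda>y::'a::euclidean_space. indicator {t..} (norm y) * norm y powr (- b))
    (sphere_area TYPE('a) * (t powr (real DIM('a) - b) / (b - real DIM('a))))"
proof -
  have "((\<lambda>s. s powr (real DIM('a) - 1 - b)) has_integral
      (t powr (real DIM('a) - b) / (b - real DIM('a)))) {t..}"
    using has_integral_powr_to_inf[of "real DIM('a) - 1 - b" t] assms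
    by (simp add: minus_divide_right)
  from has_bochner_integral_norm_powr[OF _ _ this] assms show ?thesis by simp
qed

lemma lborel_integral_scale:
  fixes f :: "'a::euclidean_space \<Rightarrow> real"
  assumes "c > 0" and [measurable]: "f \<in> borel_measurable borel"
  shows "integrable lborel f \<longleftrightarrow> integrable lborel (\<lambda>y. f (c *\<^sub>R y))"
    and "integral\<^sup>L lborel f = c ^ DIM('a) * (\<integral>y. f (c *\<^sub>R y) \<partial>lborel)"
proof -
  have lb: "(lborel :: 'a measure) = density (distr lborel borel (\<lambda>x. c *\<^sub>R x)) (\<lambda>_. ennreal (c ^ DIM('a)))"
    using lborel_affine[of c "0::'a"] assms by simp
  have "integrable lborel f \<longleftrightarrow> integrable (distr lborel borel (\<lambda>x. c *\<^sub>R x)) (\<lambda>x. c ^ DIM('a) *\<^sub>R f x)"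
    by (subst lb, subst integrable_density) (use assms in auto)
  also have "\<dots> \<longleftrightarrow> integrable lborel (\<lambda>y. c ^ DIM('a) *\<^sub>R f (c *\<^sub>R y))"
    by (subst integrable_distr_eq) auto
  finally show "integrable lborel f \<longleftrightarrow> integrable lborel (\<lambda>y. f (c *\<^sub>R y))"
    using assms(1) by simp
  have "integral\<^sup>L lborel f = integral\<^sup>L (distr lborel borel (\<lambda>x. c *\<^sub>R x)) (\<lambda>x. c ^ DIM('a) *\<^sub>R f x)"
    by (subst lb, subst integral_density) (use assms in auto)
  also have "\<dots> = (\<integral>y. c ^ DIM('a) *\<^sub>R f (c *\<^sub>R y) \<partial>lborel)"
    by (subst integral_distr) auto
  finally show "integral\<^sup>L lborel f = c ^ DIM('a) * (\<integral>y. f (c *\<^sub>R y) \<partial>lborel)" by simp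
qed

lemma lborel_integral_translate:
  fixes g :: "'a::euclidean_space \<Rightarrow> real"
  assumes "integrable lborel g"
  shows "integrable lborel (\<lambda>y. g (y - e))" "(\<integral>y. g (y - e) \<partial>lborel) = integral\<^sup>L lborel g"
proof -
  have lb: "distr lborel borel (\<lambda>y. y - e) = (lborel :: 'a measure)"
    using lborel_distr_plus[of "- e"] by (simp cong: distr_cong)
  have [measurable]: "g \<in> borel_measurable borel" using borel_measurable_integrable[OF assms] by simp
  show "integrable lborel (\<lambda>y. g (y - e))"
    using integrable_distr_eq[of "\<lambda>y. y - e" lborel borel g] assms lb by simp
  show "(\<integral>y. g (y - e) \<partial>lborel) = integral\<^sup>L lborel g"
    using integral_distr[of "\<lambda>y. y - e" lborel borel g] lb by simp
qed

section \<open>Limits of integrals with convergent majorants\<close>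

text \<open>
  Dominated convergence with a majorant that depends on $r$ (Pratt's lemma). Truncating $f_r$ at
  the limit \<open>g0\<close> of the majorants brings it into the scope of the ordinary theorem, and the truncation
  error is at most $g_r-\min(g_r,g_0)$, whose integral tends to $0$.
\<close>

lemma dominated_by_convergent_integrals:
  fixes f g :: "real \<Rightarrow> 'b \<Rightarrow> real"
  assumes [measurable]: "\<And>r. f r \<in> borel_measurable M" "f0 \<in> borel_measurable M"
    and g: "\<And>r. integrable M (g r)" and g0: "integrable M g0"
    and gnn: "\<And>r x. g r x \<ge> 0"
    and flim: "\<And>x. ((\<lambda>r. f r x) \<longlongrightarrow> f0 x) at_top"
    and glim: "\<And>x. ((\<lambda>r. g r x) \<longlongrightarrow> g0 x) at_top"
    and gint: "((\<lambda>r. integral\<^sup>L M (g r)) \<longlongrightarrow> integral\<^sup>L M g0) at_top"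
    and dom: "\<forall>\<^sub>F r in at_top. \<forall>x. \<bar>f r x\<bar> \<le> g r x"
  shows "((\<lambda>r. integral\<^sup>L M (f r)) \<longlongrightarrow> integral\<^sup>L M f0) at_top"
proof -
  note [measurable] = borel_measurable_integrable[OF g] borel_measurable_integrable[OF g0]
  have g0nn: "g0 x \<ge> 0" for x
    by (rule tendsto_lowerbound[OF glim[of x]]) (auto simp: gnn)
  have f0g0: "\<bar>f0 x\<bar> \<le> g0 x" for x
  proof (rule tendsto_le[OF _ glim[of x] tendsto_rabs[OF flim[of x]]])
    show "\<forall>\<^sub>F r in at_top. \<bar>f r x\<bar> \<le> g r x" using dom by eventually_elim auto
  qed auto
  define T where "T r x = max (- g0 x) (min (g0 x) (f r x))" for r x
  define m where "m r x = min (g r x) (g0 x)" for r x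
  have Tm [measurable]: "T r \<in> borel_measurable M" "m r \<in> borel_measurable M" for r
    unfolding T_def m_def by measurable
  have m_int: "integrable M (m r)" for r
    by (rule Bochner_Integration.integrable_bound[OF g0]) (auto simp: m_def gnn g0nn)
  have T_le: "\<bar>T r x\<bar> \<le> g0 x" for r x
    using g0nn[of x] by (auto simp: T_def)
  have T_int: "integrable M (T r)" for r
    by (rule Bochner_Integration.integrable_bound[OF g0]) (use T_le g0nn in \<open>auto simp: abs_of_nonneg\<close>)
  have m_lim: "((\<lambda>r. integral\<^sup>L M (m r)) \<longlongrightarrow> integral\<^sup>L M g0) at_top"
  proof (rule integral_dominated_convergence_at_top[where w = g0])
    have "((\<lambda>r. m r x) \<longlongrightarrow> min (g0 x) (g0 x)) at_top" for x
      unfolding m_def by (intro tendsto_min glim tendsto_const)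
    then show "AE x in M. ((\<lambda>r. m r x) \<longlongrightarrow> g0 x) at_top" by simp
    show "\<forall>\<^sub>F r in at_top. AE x in M. norm (m r x) \<le> g0 x"
      by (auto simp: m_def gnn g0nn)
  qed (auto simp: g0)
  have T_lim: "((\<lambda>r. integral\<^sup>L M (T r)) \<longlongrightarrow> integral\<^sup>L M f0) at_top"
  proof (rule integral_dominated_convergence_at_top[where w = g0])
    have "((\<lambda>r. T r x) \<longlongrightarrow> max (- g0 x) (min (g0 x) (f0 x))) at_top" for x
      unfolding T_def by (intro tendsto_intros flim)
    moreover have "max (- g0 x) (min (g0 x) (f0 x)) = f0 x" for x
      using f0g0[of x] by auto
    ultimately show "AE x in M. ((\<lambda>r. T r x) \<longlongrightarrow> f0 x) at_top" by auto
    show "\<forall>\<^sub>F r in at_top. AE x in M. norm (T r x) \<le> g0 x"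
      using T_le by auto
  qed (auto simp: g0)
  have "((\<lambda>r. integral\<^sup>L M (g r) - integral\<^sup>L M (m r)) \<longlongrightarrow> integral\<^sup>L M g0 - integral\<^sup>L M g0) at_top"
    by (intro tendsto_diff gint m_lim)
  then have gm: "((\<lambda>r. integral\<^sup>L M (g r) - integral\<^sup>L M (m r)) \<longlongrightarrow> 0) at_top" by simp
  have "((\<lambda>r. integral\<^sup>L M (f r) - integral\<^sup>L M (T r)) \<longlongrightarrow> 0) at_top"
  proof (rule Lim_null_comparison[OF _ gm])
    show "\<forall>\<^sub>F r in at_top. norm (integral\<^sup>L M (f r) - integral\<^sup>L M (T r))
        \<le> integral\<^sup>L M (g r) - integral\<^sup>L M (m r)"
      using dom
    proof eventually_elim
      case (elim r)
      have f_int: "integrable M (f r)"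
        by (rule Bochner_Integration.integrable_bound[OF g[of r]])
           (use elim gnn in \<open>auto intro: order_trans\<close>)
      have "\<bar>f r x - T r x\<bar> \<le> g r x - m r x" for x
        using elim[rule_format, of x] g0nn[of x] unfolding T_def m_def by (auto simp: min_def max_def abs_if split: if_splits)
      then have "\<bar>\<integral>x. f r x - T r x \<partial>M\<bar> \<le> (\<integral>x. g r x - m r x \<partial>M)"
        by (intro order_trans[OF integral_abs_bound] integral_mono)
           (auto intro!: f_int T_int g m_int Bochner_Integration.integrable_diff integrable_abs)
      then show ?case by (simp add: f_int T_int g m_int)
    qed
  qed
  from tendsto_add[OF this T_lim] show ?thesis by simp
qed

lemma integral_pos_of_pos_on_interval:
  fixes f :: "real \<Rightarrow> real"
  assumes "integrable lborel f" "\<And>x. f x \<ge> 0" "p < q" "\<And>x. p < x \<Longrightarrow> x < q \<Longrightarrow> f x > 0"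
  shows "integral\<^sup>L lborel f > 0"
proof (rule ccontr)
  assume "\<not> ?thesis"
  moreover have "integral\<^sup>L lborel f \<ge> 0" by (rule Bochner_Integration.integral_nonneg) (auto simp: assms)
  ultimately have "AE x in lborel. f x = 0"
    using integral_nonneg_eq_0_iff_AE[OF assms(1)] assms(2) by auto
  then have "AE x in lborel. x \<notin> {p<..<q}"
    by eventually_elim (use assms(4) in fastforce)
  then have "emeasure lborel {p<..<q} = 0"
    by (subst (asm) AE_iff_measurable[where N = "{p<..<q}"]) auto
  then show False using \<open>p < q\<close> by simp
qed

section \<open>Levy densities and a Tauberian theorem\<close>

text \<open>
  The weight $1-e^{-t}$ is comparable to $\min(1,t)$, so this is the usual integrability
  condition; the exponential form is the one whose integral is the value at $1$ of the Laplace
  exponent.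
\<close>

definition levy_density :: "(real \<Rightarrow> real) \<Rightarrow> bool" where
  "levy_density h \<longleftrightarrow> h \<in> borel_measurable borel \<and> (\<forall>t\<le>0. h t = 0) \<and> (\<forall>t. h t \<ge> 0) \<and>
     integrable lborel (\<lambda>t. (1 - exp (- t)) * h t)"

lemma levy_densityD:
  assumes "levy_density h"
  shows "h \<in> borel_measurable borel" "t \<le> 0 \<Longrightarrow> h t = 0" "h t \<ge> 0"
    "integrable lborel (\<lambda>t. (1 - exp (- t)) * h t)"
  using assms by (auto simp: levy_density_def)

lemma levy_density_integrable:
  fixes f :: "real \<Rightarrow> real"
  assumes h: "levy_density h" and [measurable]: "f \<in> borel_measurable borel"
    and B: "\<And>t. t > 0 \<Longrightarrow> \<bar>f t\<bar> \<le> B * (1 - exp (- t))"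
  shows "integrable lborel (\<lambda>t. f t * h t)"
proof (rule Bochner_Integration.integrable_bound)
  note [measurable] = levy_densityD(1)[OF h]
  show "integrable lborel (\<lambda>t. B * ((1 - exp (- t)) * h t))" using levy_densityD[OF h] by simp
  have "norm (f t * h t) \<le> norm (B * ((1 - exp (- t)) * h t))" for t
  proof (cases "t > 0")
    case True
    then have "\<bar>f t\<bar> * h t \<le> B * (1 - exp (- t)) * h t"
      using B levy_densityD(3)[OF h] by (intro mult_right_mono) auto
    then have "\<bar>f t * h t\<bar> \<le> B * ((1 - exp (- t)) * h t)"
      using levy_densityD(3)[OF h, of t] by (simp add: abs_mult mult.assoc)
    then show ?thesis using abs_ge_self order_trans unfolding real_norm_def by blast
  qed (simp add: levy_densityD[OF h])
  then show "AE t in lborel. norm (f t * h t) \<le> norm (B * ((1 - exp (- t)) * h t))" by simp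
  show "(\<lambda>t. f t * h t) \<in> borel_measurable lborel" by measurable
qed

lemma levy_density_weighted_integrable:
  fixes f :: "real \<Rightarrow> real"
  assumes h: "levy_density h" and [measurable]: "f \<in> borel_measurable borel"
    and B: "\<And>t. t > 0 \<Longrightarrow> \<bar>f t\<bar> \<le> B"
  shows "integrable lborel (\<lambda>t. f t * ((1 - exp (- t)) * h t))"
proof -
  have "integrable lborel (\<lambda>t. f t * (1 - exp (- t)) * h t)"
  proof (rule levy_density_integrable[OF h])
    show "\<bar>f t * (1 - exp (- t))\<bar> \<le> B * (1 - exp (- t))" if "t > 0" for t
      using B[OF that] that by (simp add: abs_mult mult_right_mono)
  qed measurable
  then show ?thesis by (simp only: mult.assoc)
qed

text \<open>
  The Levy density of the $a$-stable subordinator. The denominator, which equals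
  $\Gamma(1-a)/a$, normalises it so that its Laplace exponent is exactly $u^a$.
\<close>

definition stable_density :: "real \<Rightarrow> real \<Rightarrow> real" where
  "stable_density a t = indicator {0<..} t * t powr (- 1 - a) /
     (\<integral>s. (1 - exp (- s)) * (indicator {0<..} s * s powr (- 1 - a)) \<partial>lborel)"

lemma min_1_le_one_minus_exp:
  assumes "t \<ge> (0::real)"
  shows "min 1 t \<le> 2 * (1 - exp (- t))"
proof -
  have "exp (- t) \<le> inverse (1 + t)"
    unfolding exp_minus using exp_ge_add_one_self[of t] assms by (intro le_imp_inverse_le) auto
  then have "1 - exp (- t) \<ge> t / (1 + t)"
    using assms by (simp add: field_simps)
  moreover have "2 * (t / (1 + t)) \<ge> min 1 t"
  proof (cases "t \<le> 1")
    case True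
    have "t / 2 \<le> t / (1 + t)" using True assms by (intro divide_left_mono) auto
    then show ?thesis using True by (auto simp: mult.commute)
  next
    case False
    then show ?thesis by (simp add: field_simps)
  qed
  ultimately show ?thesis
    by (meson mult_left_mono order_trans zero_le_numeral)
qed

lemma integrable_stable_base:
  fixes a :: real
  assumes "0 < a" "a < 1"
  shows "integrable lborel (\<lambda>t. (1 - exp (- t)) * (indicator {0<..} t * t powr (- 1 - a)))"
proof -
  have "integrable lborel (\<lambda>y::real. indicator {..<1} (norm y) * norm y powr (- a))"
    using has_bochner_integral_norm_powr_inside[of a 1, where 'a=real] assms
    by (auto intro: integrable.intros)
  moreover have "integrable lborel (\<lambda>y::real. indicator {1..} (norm y) * norm y powr (- (1 + a)))"
    using has_bochner_integral_norm_powr_outside[of "1 + a" 1, where 'a=real] assms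
    by (auto intro: integrable.intros)
  ultimately have "integrable lborel (\<lambda>y::real. indicator {..<1} (norm y) * norm y powr (- a)
      + indicator {1..} (norm y) * norm y powr (- (1 + a)))"
    by (rule Bochner_Integration.integrable_add)
  then show ?thesis
  proof (rule Bochner_Integration.integrable_bound)
    have "norm ((1 - exp (- t)) * (indicator {0<..} t * t powr (- 1 - a))) \<le>
        norm (indicator {..<1} (norm t) * norm t powr (- a)
          + indicator {1..} (norm t) * norm t powr (- (1 + a)))" for t :: real
    proof (cases "t > 0")
      case True
      have 1: "1 - exp (- t) \<le> t" using exp_ge_add_one_self[of "-t"] by linarith
      have 2: "t * t powr (- 1 - a) = t powr (- a)"
        using True powr_mult_base[of t "- 1 - a"] by simp
      show ?thesis
      proof (cases "t < 1")
        case True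
        then show ?thesis using \<open>t > 0\<close> mult_right_mono[OF 1, of "t powr (- 1 - a)"] 2
          by (simp add: abs_mult)
      next
        case False
        then show ?thesis using \<open>t > 0\<close> mult_right_mono[of "1 - exp (-t)" 1 "t powr (- 1 - a)"]
          by (simp add: abs_mult)
      qed
    qed simp
    then show "AE t in lborel. norm ((1 - exp (- t)) * (indicator {0<..} t * t powr (- 1 - a))) \<le>
        norm (indicator {..<1} (norm t) * norm t powr (- a)
          + indicator {1..} (norm t) * norm t powr (- (1 + a)))" by simp
  qed measurable
qed

lemma stable_const_pos:
  assumes "0 < a" "a < 1"
  shows "(\<integral>s. (1 - exp (- s)) * (indicator {0<..} s * s powr (- 1 - a)) \<partial>lborel) > (0::real)"
  by (rule integral_pos_of_pos_on_interval[OF integrable_stable_base[OF assms], of 0 1])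
     (auto simp: indicator_def)

text \<open>
  The substitution $t\mapsto ut$ reduces every $u$ to the case $u=1$, which holds by normalisation.
\<close>

lemma has_bochner_integral_stable_density:
  assumes "0 < a" "a < 1" "u > 0"
  shows "has_bochner_integral lborel (\<lambda>t. (1 - exp (- u * t)) * stable_density a t) (u powr a)"
proof -
  define f where "f t = (1 - exp (- t)) * (indicator {0<..} t * t powr (- 1 - a))" for t :: real
  have f: "integrable lborel f" unfolding f_def using integrable_stable_base[OF assms(1,2)] .
  have I: "integral\<^sup>L lborel f > 0" unfolding f_def using stable_const_pos[OF assms(1,2)] .
  have eq: "(1 - exp (- u * t)) * stable_density a t =
      u powr (1 + a) / integral\<^sup>L lborel f * f (0 + u * t)" for t
  proof (cases "t > 0")
    case True
    have "u powr (1 + a) * u powr (- 1 - a) = 1" using assms by (simp add: powr_add[symmetric])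
    then have "u powr (1 + a) * (u * t) powr (- 1 - a) = t powr (- 1 - a)"
      using True assms by (simp add: powr_mult mult.assoc[symmetric])
    moreover have "stable_density a t = t powr (- 1 - a) / integral\<^sup>L lborel f"
      using True by (simp add: stable_density_def f_def[abs_def])
    moreover have "f (0 + u * t) = (1 - exp (- u * t)) * (u * t) powr (- 1 - a)"
      using True assms by (simp add: f_def)
    ultimately show ?thesis by (simp add: mult.left_commute)
  next
    case False
    then have "\<not> u * t > 0" using assms by (simp add: zero_less_mult_iff)
    then show ?thesis using False by (simp add: stable_density_def f_def)
  qed
  have "integrable lborel (\<lambda>t. f (0 + u * t))"
    by (rule lborel_integrable_real_affine[OF f]) (use assms in auto)
  moreover have "integral\<^sup>L lborel f = \<bar>u\<bar> *\<^sub>R (\<integral>t. f (0 + u * t) \<partial>lborel)"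
    by (rule lborel_integral_real_affine) (use assms in auto)
  moreover have "u powr (1 + a) = u * u powr a" using assms by (simp add: powr_add)
  ultimately show ?thesis
    unfolding eq using assms I by (auto simp: has_bochner_integral_iff field_simps)
qed

lemma stable_density_measurable [measurable]: "stable_density a \<in> borel_measurable borel"
  unfolding stable_density_def by measurable

lemma stable_density_nonneg: "0 < a \<Longrightarrow> a < 1 \<Longrightarrow> stable_density a t \<ge> 0"
  unfolding stable_density_def using stable_const_pos[of a] by (simp add: indicator_def)

lemma stable_density_antimono:
  assumes "0 < a" "a < 1" "0 < s" "s \<le> t"
  shows "stable_density a t \<le> stable_density a s"
  unfolding stable_density_def using stable_const_pos[of a] assms
  by (simp add: divide_right_mono powr_mono2')

lemma isCont_stable_density:
  assumes "0 < a" "a < 1" "0 < t"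
  shows "isCont (stable_density a) t"
proof -
  define c where "c = (\<integral>s. (1 - exp (- s)) * (indicator {0<..} s * s powr (- 1 - a)) \<partial>lborel)"
  have "isCont (\<lambda>t::real. t powr (- 1 - a) / c) t"
    using stable_const_pos[OF assms(1,2)] assms
    by (intro continuous_intros) (auto simp: c_def)
  moreover have "\<forall>\<^sub>F s in nhds t. s \<in> {0<..}"
    using assms by (intro eventually_nhds_in_open) auto
  then have "\<forall>\<^sub>F s in nhds t. stable_density a s = s powr (- 1 - a) / c"
    by eventually_elim (simp add: stable_density_def c_def)
  ultimately show ?thesis
    by (subst isCont_cong)
qed

text \<open>
  As a function of $t$, \<open>hat p q (exp (- t))\<close> is a bump supported on $[p,q]$. It is written in the
  variable $e^{-t}$ because that is the variable in which polynomials are dense.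
\<close>

definition hat :: "real \<Rightarrow> real \<Rightarrow> real \<Rightarrow> real" where
  "hat p q x = max 0 ((x - exp (- q)) * (exp (- p) - x))"

definition hat_mass :: "real \<Rightarrow> real \<Rightarrow> real" where
  "hat_mass p q = (\<integral>t. hat p q (exp (- t)) * (1 - exp (- t)) \<partial>lborel)"

lemma hat_outside: "0 < p \<Longrightarrow> p < q \<Longrightarrow> t \<notin> {p..q} \<Longrightarrow> hat p q (exp (- t)) = 0"
  using mult_nonneg_nonpos[of "exp (- t) - exp (- q)" "exp (- p) - exp (- t)"]
    mult_nonpos_nonneg[of "exp (- t) - exp (- q)" "exp (- p) - exp (- t)"]
  by (auto simp: hat_def max_def)

lemma hat_integrable:
  assumes "0 < p" "p < q"
  shows "integrable lborel (\<lambda>t. hat p q (exp (- t)) * (1 - exp (- t)))"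
proof -
  have "integrable lborel (\<lambda>t. indicator {p..q} t *\<^sub>R (hat p q (exp (- t)) * (1 - exp (- t))))"
    unfolding hat_def by (intro borel_integrable_compact continuous_intros) auto
  also have "(\<lambda>t. indicator {p..q} t *\<^sub>R (hat p q (exp (- t)) * (1 - exp (- t)))) =
      (\<lambda>t. hat p q (exp (- t)) * (1 - exp (- t)))"
    using hat_outside[OF assms] by (fastforce simp: indicator_def)
  finally show ?thesis .
qed

lemma hat_mass_pos:
  assumes "0 < p" "p < q"
  shows "hat_mass p q > 0"
  unfolding hat_mass_def
proof (rule integral_pos_of_pos_on_interval[OF hat_integrable[OF assms] _ assms(2)])
  show "0 \<le> hat p q (exp (- t)) * (1 - exp (- t))" for t
    using hat_outside[OF assms, of t] assms
    by (cases "t \<in> {p..q}") (auto simp: hat_def)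
  show "0 < hat p q (exp (- t)) * (1 - exp (- t))" if "p < t" "t < q" for t
    using that assms by (auto simp: hat_def max_def mult_le_0_iff zero_less_mult_iff not_le)
qed

text \<open>
  On the support of the bump a decreasing \<open>h\<close> lies between its values at the end points. This is how
  integrals against test functions control point values.
\<close>

lemma hat_integral_bounds:
  assumes "0 < p" "p < q" and h: "levy_density h"
    and mono: "\<And>s t. 0 < s \<Longrightarrow> s \<le> t \<Longrightarrow> h t \<le> h s"
  shows "h q * hat_mass p q \<le> (\<integral>t. hat p q (exp (- t)) * ((1 - exp (- t)) * h t) \<partial>lborel)"
    and "(\<integral>t. hat p q (exp (- t)) * ((1 - exp (- t)) * h t) \<partial>lborel) \<le> h p * hat_mass p q"
proof -
  note [measurable] = levy_densityD(1)[OF h]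
  have [measurable]: "(\<lambda>t. hat p q (exp (- t))) \<in> borel_measurable borel"
    unfolding hat_def by measurable
  have int: "integrable lborel (\<lambda>t. hat p q (exp (- t)) * ((1 - exp (- t)) * h t))"
  proof (rule levy_density_weighted_integrable[OF h])
    show "\<bar>hat p q (exp (- t))\<bar> \<le> 1" if "t > 0" for t
    proof -
      have "exp (- q) < 1" "exp (- p) < 1" "exp (- t) < 1" using assms that by auto
      then have "(exp (- t) - exp (- q)) * (exp (- p) - exp (- t)) \<le> 1"
        using mult_le_one[of "\<bar>exp (- t) - exp (- q)\<bar>" "\<bar>exp (- p) - exp (- t)\<bar>"]
          abs_ge_self[of "(exp (- t) - exp (- q)) * (exp (- p) - exp (- t))"]
          exp_gt_zero[of "-q"] exp_gt_zero[of "-p"] exp_gt_zero[of "-t"]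
        unfolding abs_mult by linarith
      then show ?thesis by (auto simp: hat_def)
    qed
  qed measurable
  have pt: "h q * (hat p q (exp (- t)) * (1 - exp (- t))) \<le> hat p q (exp (- t)) * ((1 - exp (- t)) * h t)"
    "hat p q (exp (- t)) * ((1 - exp (- t)) * h t) \<le> h p * (hat p q (exp (- t)) * (1 - exp (- t)))" for t
  proof -
    have "h q * (hat p q (exp (- t)) * (1 - exp (- t))) \<le> h t * (hat p q (exp (- t)) * (1 - exp (- t))) \<and>
       h t * (hat p q (exp (- t)) * (1 - exp (- t))) \<le> h p * (hat p q (exp (- t)) * (1 - exp (- t)))"
    proof (cases "t \<in> {p..q}")
      case True
      then have "hat p q (exp (- t)) * (1 - exp (- t)) \<ge> 0" using assms by (auto simp: hat_def)
      then show ?thesis using True assms by (auto intro!: mult_right_mono mono)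
    qed (use hat_outside assms in auto)
    then show "h q * (hat p q (exp (- t)) * (1 - exp (- t))) \<le> hat p q (exp (- t)) * ((1 - exp (- t)) * h t)"
      "hat p q (exp (- t)) * ((1 - exp (- t)) * h t) \<le> h p * (hat p q (exp (- t)) * (1 - exp (- t)))"
      by (auto simp: mult_ac)
  qed
  have "(\<integral>t. h q * (hat p q (exp (- t)) * (1 - exp (- t))) \<partial>lborel)
      \<le> (\<integral>t. hat p q (exp (- t)) * ((1 - exp (- t)) * h t) \<partial>lborel)"
    by (intro integral_mono pt int integrable_mult_right hat_integrable assms)
  then show "h q * hat_mass p q \<le> (\<integral>t. hat p q (exp (- t)) * ((1 - exp (- t)) * h t) \<partial>lborel)"
    by (simp add: hat_mass_def)
  have "(\<integral>t. hat p q (exp (- t)) * ((1 - exp (- t)) * h t) \<partial>lborel)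
     \<le> (\<integral>t. h p * (hat p q (exp (- t)) * (1 - exp (- t))) \<partial>lborel)"
    by (intro integral_mono pt int integrable_mult_right hat_integrable assms)
  then show "(\<integral>t. hat p q (exp (- t)) * ((1 - exp (- t)) * h t) \<partial>lborel) \<le> h p * hat_mass p q"
    by (simp add: hat_mass_def)
qed

text \<open>
  Decreasing Levy densities whose Laplace exponents converge pointwise to that of the stable
  subordinator.
\<close>

locale levy_density_family =
  fixes nu :: "real \<Rightarrow> real \<Rightarrow> real" and a :: real
  assumes a: "0 < a" "a < 1"
    and nu_measurable [measurable]: "\<And>r. nu r \<in> borel_measurable borel"
    and nu_zero: "\<And>r t. t \<le> 0 \<Longrightarrow> nu r t = 0"
    and nu_nonneg: "\<And>r t. nu r t \<ge> 0"
    and nu_antimono: "\<And>r s t. 0 < s \<Longrightarrow> s \<le> t \<Longrightarrow> nu r t \<le> nu r s"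
    and nu_integrable: "\<And>r u. u > 0 \<Longrightarrow> integrable lborel (\<lambda>t. (1 - exp (- u * t)) * nu r t)"
    and nu_exponent_tendsto: "\<And>u. u > 0 \<Longrightarrow>
      ((\<lambda>r. \<integral>t. (1 - exp (- u * t)) * nu r t \<partial>lborel) \<longlongrightarrow> u powr a) at_top"
begin

lemma stable_zero: "t \<le> 0 \<Longrightarrow> stable_density a t = 0"
  by (simp add: stable_density_def)

lemmas stable_nonneg = stable_density_nonneg[OF a]

lemma nu_weight_integrable: "integrable lborel (\<lambda>t. (1 - exp (- t)) * nu r t)"
  using nu_integrable[of 1 r] by simp

lemma stable_weight: "has_bochner_integral lborel (\<lambda>t. (1 - exp (- t)) * stable_density a t) 1"
  using has_bochner_integral_stable_density[OF a, of 1] by simp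

lemma nu_mass_tendsto: "((\<lambda>r. \<integral>t. (1 - exp (- t)) * nu r t \<partial>lborel) \<longlongrightarrow> 1) at_top"
  using nu_exponent_tendsto[of 1] by simp

lemma levy_density_nu: "levy_density (nu r)"
  using nu_zero nu_nonneg nu_weight_integrable by (auto simp: levy_density_def)

lemma levy_density_stable: "levy_density (stable_density a)"
  using stable_zero stable_nonneg stable_weight by (auto simp: levy_density_def has_bochner_integral_iff)

text \<open>
  The identity $e^{-nt}(1-e^{-t}) = (1-e^{-(n+1)t})-(1-e^{-nt})$ expresses the moments by two
  values of the Laplace exponent.
\<close>

lemma moment_tendsto:
  "((\<lambda>r. \<integral>t. exp (- t) ^ n * ((1 - exp (- t)) * nu r t) \<partial>lborel) \<longlongrightarrow>
     (\<integral>t. exp (- t) ^ n * ((1 - exp (- t)) * stable_density a t) \<partial>lborel)) at_top"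
proof -
  have diff: "(\<integral>t. exp (- t) ^ n * ((1 - exp (- t)) * h t) \<partial>lborel) =
      (\<integral>t. (1 - exp (- real (n + 1) * t)) * h t \<partial>lborel) - (\<integral>t. (1 - exp (- real n * t)) * h t \<partial>lborel)"
    if "\<And>u. u > 0 \<Longrightarrow> integrable lborel (\<lambda>t. (1 - exp (- u * t)) * h t)" for h :: "real \<Rightarrow> real"
  proof -
    have e: "exp (- t) ^ n * ((1 - exp (- t)) * h t) =
        (1 - exp (- real (n + 1) * t)) * h t - (1 - exp (- real n * t)) * h t" for t :: real
      by (simp add: exp_of_nat_mult[symmetric] algebra_simps exp_add[symmetric])
    have "integrable lborel (\<lambda>t. (1 - exp (- real (n + 1) * t)) * h t)"
      "integrable lborel (\<lambda>t. (1 - exp (- real n * t)) * h t)"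
      using that[of "real (n + 1)"] that[of "real n"] by (simp, cases "n = 0") simp_all
    then show ?thesis unfolding e by (rule Bochner_Integration.integral_diff)
  qed
  have "((\<lambda>r. (\<integral>t. (1 - exp (- real (n + 1) * t)) * nu r t \<partial>lborel)
      - (\<integral>t. (1 - exp (- real n * t)) * nu r t \<partial>lborel)) \<longlongrightarrow> real (n + 1) powr a - real n powr a) at_top"
  proof (intro tendsto_diff)
    show "((\<lambda>r. \<integral>t. (1 - exp (- real n * t)) * nu r t \<partial>lborel) \<longlongrightarrow> real n powr a) at_top"
      using nu_exponent_tendsto[of "real n"] by (cases "n = 0") simp_all
  qed (rule nu_exponent_tendsto, simp)
  moreover have "(\<integral>t. exp (- t) ^ n * ((1 - exp (- t)) * stable_density a t) \<partial>lborel) =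
      real (n + 1) powr a - real n powr a"
  proof -
    have int: "integrable lborel (\<lambda>t. (1 - exp (- u * t)) * stable_density a t)"
      and eq: "(\<integral>t. (1 - exp (- u * t)) * stable_density a t \<partial>lborel) = u powr a" if "u > 0" for u
      using has_bochner_integral_stable_density[OF a that] by (simp_all add: has_bochner_integral_iff)
    have "(\<integral>t. (1 - exp (- real n * t)) * stable_density a t \<partial>lborel) = real n powr a"
      using eq[of "real n"] by (cases "n = 0") simp_all
    moreover have "(\<integral>t. (1 - exp (- real (n + 1) * t)) * stable_density a t \<partial>lborel) = real (n + 1) powr a"
      by (rule eq) simp
    ultimately show ?thesis using diff[OF int] by simp
  qed
  ultimately show ?thesis
    using diff[OF nu_integrable] by simp
qed

text \<open>
  Karamata's argument: polynomials in $e^{-t}$ are covered by the moments, and the error of a uniform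
  approximation on $[0,1]$ is multiplied only by the total masses, which stay bounded.
\<close>

lemma test_function_tendsto:
  fixes f :: "real \<Rightarrow> real"
  assumes f: "continuous_on UNIV f"
  shows "((\<lambda>r. \<integral>t. f (exp (- t)) * ((1 - exp (- t)) * nu r t) \<partial>lborel) \<longlongrightarrow>
     (\<integral>t. f (exp (- t)) * ((1 - exp (- t)) * stable_density a t) \<partial>lborel)) at_top"
    (is "((\<lambda>r. ?L f (nu r)) \<longlongrightarrow> _) at_top")
proof (rule tendstoI)
  fix e :: real assume "e > 0"
  \<comment> \<open>The total errors are at most $2e'$ for \<open>nu r\<close>, whose mass is eventually below $2$, $e'$ for the
      limit of mass $1$, and $e'$ for the polynomial: together less than $5e'$.\<close>
  define e' where "e' = e / 5"
  have e': "e' > 0" using \<open>e > 0\<close> by (simp add: e'_def)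
  have f01: "continuous_on {0..1} f" using f continuous_on_subset by blast
  obtain p where p: "real_polynomial_function p" "\<And>x. x \<in> {0..1} \<Longrightarrow> \<bar>f x - p x\<bar> < e'"
    using Stone_Weierstrass_real_polynomial_function[OF _ f01 e'] by auto
  obtain c n where pc: "p = (\<lambda>x. \<Sum>i\<le>n. c i * x ^ i)"
    using p(1) real_polynomial_function_iff_sum by blast
  have contp: "continuous_on UNIV p" unfolding pc by (intro continuous_intros)
  have meas: "(\<lambda>t. g (exp (- t))) \<in> borel_measurable borel" if "continuous_on UNIV g" for g :: "real \<Rightarrow> real"
    by (intro borel_measurable_continuous_onI continuous_on_compose2[OF that] continuous_intros) auto
  have bdd: "\<exists>B. \<forall>t>0. \<bar>g (exp (- t))\<bar> \<le> B" if "continuous_on UNIV g" for g :: "real \<Rightarrow> real"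
  proof -
    have "compact (g ` {0..1})"
      using that by (intro compact_continuous_image) (auto intro: continuous_on_subset)
    then obtain B where "\<And>x. x \<in> {0..1} \<Longrightarrow> norm (g x) \<le> B"
      using compact_imp_bounded bounded_iff by (metis imageI)
    then show ?thesis by (intro exI[of _ B]) auto
  qed
  have int: "integrable lborel (\<lambda>t. g (exp (- t)) * ((1 - exp (- t)) * h t))"
    if "continuous_on UNIV g" "levy_density h" for g h :: "real \<Rightarrow> real"
    using bdd[OF that(1)] levy_density_weighted_integrable[OF that(2) meas[OF that(1)]] by blast
  have close: "\<bar>?L f h - ?L p h\<bar> \<le> e' * (\<integral>t. (1 - exp (- t)) * h t \<partial>lborel)"
    if h: "levy_density h" for h :: "real \<Rightarrow> real"
  proof -
    have i: "integrable lborel (\<lambda>t. f (exp (- t)) * ((1 - exp (- t)) * h t))"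
      "integrable lborel (\<lambda>t. p (exp (- t)) * ((1 - exp (- t)) * h t))"
      using int[OF f h] int[OF contp h] by auto
    have "\<bar>?L f h - ?L p h\<bar> = \<bar>\<integral>t. f (exp (- t)) * ((1 - exp (- t)) * h t)
        - p (exp (- t)) * ((1 - exp (- t)) * h t) \<partial>lborel\<bar>"
      by (simp add: i)
    also have "\<dots> \<le> (\<integral>t. \<bar>f (exp (- t)) * ((1 - exp (- t)) * h t)
        - p (exp (- t)) * ((1 - exp (- t)) * h t)\<bar> \<partial>lborel)"
      by (rule integral_abs_bound)
    also have "\<dots> \<le> (\<integral>t. e' * ((1 - exp (- t)) * h t) \<partial>lborel)"
    proof (rule integral_mono)
      fix t :: real
      show "\<bar>f (exp (- t)) * ((1 - exp (- t)) * h t) - p (exp (- t)) * ((1 - exp (- t)) * h t)\<bar>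
          \<le> e' * ((1 - exp (- t)) * h t)"
      proof (cases "t > 0")
        case True
        have "\<bar>f (exp (- t)) - p (exp (- t))\<bar> \<le> e'" using p(2)[of "exp (- t)"] True by simp
        then have "\<bar>f (exp (- t)) - p (exp (- t))\<bar> * ((1 - exp (- t)) * h t) \<le> e' * ((1 - exp (- t)) * h t)"
          using True levy_densityD(3)[OF h, of t] by (intro mult_right_mono) auto
        moreover have "\<bar>(1 - exp (- t)) * h t\<bar> = (1 - exp (- t)) * h t" using True levy_densityD(3)[OF h, of t] by simp
        ultimately show ?thesis by (metis abs_mult left_diff_distrib)
      qed (simp add: levy_densityD(2)[OF h])
    qed (use i levy_densityD(4)[OF h] in auto)
    finally show ?thesis by simp
  qed
  have p_lim: "((\<lambda>r. ?L p (nu r)) \<longlongrightarrow> ?L p (stable_density a)) at_top"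
  proof -
    have "?L p h = (\<Sum>i\<le>n. c i * (\<integral>t. exp (- t) ^ i * ((1 - exp (- t)) * h t) \<partial>lborel))"
      if h: "levy_density h" for h :: "real \<Rightarrow> real"
    proof -
      have "integrable lborel (\<lambda>t. exp (- t) ^ i * ((1 - exp (- t)) * h t))" for i
        by (rule int[OF _ h, of "\<lambda>x. x ^ i"]) (intro continuous_intros)
      then show ?thesis unfolding pc by (simp add: sum_distrib_right mult.assoc)
    qed
    note e = this
    show ?thesis
      by (subst (1 2) e)
         (auto intro!: tendsto_intros moment_tendsto levy_density_nu levy_density_stable)
  qed
  have "\<forall>\<^sub>F r in at_top. \<bar>?L p (nu r) - ?L p (stable_density a)\<bar> < e'"
    using p_lim e' by (auto simp: tendsto_iff dist_real_def)
  moreover have "\<forall>\<^sub>F r in at_top. (\<integral>t. (1 - exp (- t)) * nu r t \<partial>lborel) < 2"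
    using order_tendstoD(2)[OF nu_mass_tendsto, of 2] by simp
  ultimately show "\<forall>\<^sub>F r in at_top. dist (?L f (nu r)) (?L f (stable_density a)) < e"
  proof eventually_elim
    case (elim r)
    have 1: "\<bar>?L f (nu r) - ?L p (nu r)\<bar> \<le> e' * (\<integral>t. (1 - exp (- t)) * nu r t \<partial>lborel)"
      by (rule close[OF levy_density_nu])
    have 2: "\<bar>?L f (stable_density a) - ?L p (stable_density a)\<bar> \<le> e'"
      using close[OF levy_density_stable] stable_weight by (simp add: has_bochner_integral_iff)
    have "e' * (\<integral>t. (1 - exp (- t)) * nu r t \<partial>lborel) \<le> e' * 2"
      using elim e' by (intro mult_left_mono) auto
    then show ?case using elim(1) 1 2 unfolding dist_real_def e'_def by linarith
  qed
qed

text \<open>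
  Testing against a bump on $[t,q]$ bounds \<open>nu r t\<close> from below by almost the value of the limit
  at $q$, and a bump on $[p,t]$ bounds it from above by almost the value at $p$. Continuity of the limit
  lets $p$ and $q$ tend to $t$.
\<close>

lemma density_tendsto: "((\<lambda>r. nu r t) \<longlongrightarrow> stable_density a t) at_top"
proof (cases "t > 0")
  case t: True
  let ?L = "\<lambda>p q h. \<integral>t. hat p q (exp (- t)) * ((1 - exp (- t)) * h t) \<partial>lborel"
  have lim: "((\<lambda>r. ?L p q (nu r)) \<longlongrightarrow> ?L p q (stable_density a)) at_top" for p q
    by (rule test_function_tendsto) (auto simp: hat_def intro!: continuous_intros)
  have nu: "nu r q * hat_mass p q \<le> ?L p q (nu r)" "?L p q (nu r) \<le> nu r p * hat_mass p q"
    if "0 < p" "p < q" for r p q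
    by (rule hat_integral_bounds[OF that levy_density_nu nu_antimono]; assumption)+
  have st: "stable_density a q * hat_mass p q \<le> ?L p q (stable_density a)"
    "?L p q (stable_density a) \<le> stable_density a p * hat_mass p q" if "0 < p" "p < q" for p q
    by (rule hat_integral_bounds[OF that levy_density_stable stable_density_antimono[OF a]]; assumption)+
  have cont: "(stable_density a \<longlongrightarrow> stable_density a t) (at t)"
    using isCont_stable_density[OF a t] by (simp add: isCont_def)
  show ?thesis
  proof (rule order_tendstoI)
    fix y assume "y < stable_density a t"
    then have "\<forall>\<^sub>F s in at t. y < stable_density a s" by (rule order_tendstoD(1)[OF cont])
    then have "\<forall>\<^sub>F s in at_right t. y < stable_density a s" by (simp add: eventually_at_split)
    moreover have "\<forall>\<^sub>F s in at_right t. t < s" by (rule eventually_at_right_less)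
    ultimately have "\<forall>\<^sub>F s in at_right t. y < stable_density a s \<and> t < s" by (rule eventually_conj)
    then obtain q where q: "y < stable_density a q" "t < q"
      using eventually_happens[of _ "at_right t"] by auto
    have "y * hat_mass t q < ?L t q (stable_density a)"
      using st(1)[OF t q(2)] q hat_mass_pos[OF t q(2)] by (meson less_le_trans mult_strict_right_mono)
    then have "\<forall>\<^sub>F r in at_top. y * hat_mass t q < ?L t q (nu r)"
      by (rule order_tendstoD(1)[OF lim])
    then show "\<forall>\<^sub>F r in at_top. y < nu r t"
    proof eventually_elim
      case (elim r)
      then have "y * hat_mass t q < nu r t * hat_mass t q" using nu(2)[OF t q(2), of r] by linarith
      then show ?case using hat_mass_pos[OF t q(2)] by simp
    qed
  next
    fix y assume "stable_density a t < y"
    then have "\<forall>\<^sub>F s in at t. stable_density a s < y" by (rule order_tendstoD(2)[OF cont])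
    then have "\<forall>\<^sub>F s in at_left t. stable_density a s < y" by (simp add: eventually_at_split)
    moreover have "\<forall>\<^sub>F s in at_left t. 0 < s \<and> s < t"
      using eventually_at_left_real[OF t] by eventually_elim auto
    ultimately have "\<forall>\<^sub>F s in at_left t. stable_density a s < y \<and> 0 < s \<and> s < t" by (rule eventually_conj)
    then obtain p where p: "stable_density a p < y" "0 < p" "p < t"
      using eventually_happens[of _ "at_left t"] by auto
    have "?L p t (stable_density a) < y * hat_mass p t"
      using st(2)[OF p(2,3)] p hat_mass_pos[OF p(2,3)] by (meson le_less_trans mult_strict_right_mono)
    then have "\<forall>\<^sub>F r in at_top. ?L p t (nu r) < y * hat_mass p t"
      by (rule order_tendstoD(2)[OF lim])
    then show "\<forall>\<^sub>F r in at_top. nu r t < y"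
    proof eventually_elim
      case (elim r)
      then have "nu r t * hat_mass p t < y * hat_mass p t" using nu(1)[OF p(2,3), of r] by linarith
      then show ?case using hat_mass_pos[OF p(2,3)] by simp
    qed
  qed
qed (simp add: nu_zero stable_zero)

end

section \<open>Subordinated heat kernels\<close>

text \<open>
  The heat kernel in dimension $d$ at time $t$ and distance $s$, without the factor
  $(4\pi)^{-d/2}$.
\<close>

definition heat_profile :: "nat \<Rightarrow> real \<Rightarrow> real \<Rightarrow> real" where
  "heat_profile d s t = indicator {0<..} t * (t powr (- real d / 2) * exp (- (s\<^sup>2) / (4 * t)))"

definition subordinate :: "nat \<Rightarrow> (real \<Rightarrow> real) \<Rightarrow> real \<Rightarrow> real" where
  "subordinate d h s = (\<integral>t. heat_profile d s t * h t \<partial>lborel)"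

lemma power_over_fact_le_exp:
  fixes x :: real
  assumes "x \<ge> 0"
  shows "x ^ n / fact n \<le> exp x"
proof -
  have "(\<Sum>k\<in>{n}. x ^ k /\<^sub>R fact k) \<le> (\<Sum>k. x ^ k /\<^sub>R fact k)"
    by (rule sum_le_suminf) (use assms summable_exp_generic[of x] in auto)
  then show ?thesis by (simp add: exp_def divide_inverse mult.commute)
qed

lemma exp_minus_le_power:
  fixes x :: real
  assumes "x > 0"
  shows "exp (- x) \<le> fact n * (1 / x) ^ n"
proof -
  have "inverse (exp x) \<le> inverse (x ^ n / fact n)"
    using power_over_fact_le_exp[of x n] assms by (intro le_imp_inverse_le) auto
  then show ?thesis by (simp add: exp_minus power_divide field_simps)
qed

lemma heat_profile_nonneg: "heat_profile d s t \<ge> 0"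
  by (simp add: heat_profile_def)

lemma heat_profile_measurable [measurable]:
  "(\<lambda>x. heat_profile d (f x) (g x)) \<in> borel_measurable M"
  if [measurable]: "f \<in> borel_measurable M" "g \<in> borel_measurable M"
  unfolding heat_profile_def by measurable

lemma heat_profile_antimono:
  assumes "0 \<le> s" "s \<le> s'"
  shows "heat_profile d s' t \<le> heat_profile d s t"
  using assms by (auto simp: heat_profile_def indicator_def divide_right_mono intro!: mult_left_mono)

text \<open>
  For small $t$ the Gaussian factor beats every power of $t$, for large $t$ the factor $t^{-d/2}$
  is bounded.
\<close>

lemma heat_profile_le:
  assumes "d > 0" "s > 0"
  shows "\<exists>C\<ge>0. \<forall>t>0. heat_profile d s t \<le> C * (1 - exp (- t))"
proof -
  define n where "n = d + 1"
  define C where "C = max 1 (fact n * (4 / s\<^sup>2) ^ n)"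
  have "heat_profile d s t \<le> (2 * C) * (1 - exp (- t))" if t: "t > 0" for t
  proof -
    have "heat_profile d s t \<le> C * min 1 t"
    proof (cases "t \<le> 1")
      case True
      have "exp (- (s\<^sup>2) / (4 * t)) \<le> fact n * (1 / (s\<^sup>2 / (4 * t))) ^ n"
        using exp_minus_le_power[of "s\<^sup>2 / (4 * t)" n] assms t by simp
      also have "\<dots> = (fact n * (4 / s\<^sup>2) ^ n) * t ^ n"
        by (simp add: power_mult_distrib power_divide)
      also have "\<dots> \<le> C * t ^ n"
        using t by (intro mult_right_mono) (auto simp: C_def)
      finally have "heat_profile d s t \<le> t powr (- real d / 2) * (C * t ^ n)"
        using t by (simp add: heat_profile_def mult_left_mono)
      also have "\<dots> = C * t powr (real n - real d / 2)"
        using t by (simp add: powr_realpow[symmetric] powr_add[symmetric])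
      also have "\<dots> \<le> C * t powr 1"
        using t True by (intro mult_left_mono powr_mono') (auto simp: n_def C_def)
      finally show ?thesis using True t by simp
    next
      case False
      have "heat_profile d s t \<le> t powr (- real d / 2) * 1"
        unfolding heat_profile_def using t by (auto intro!: mult_left_mono)
      also have "\<dots> \<le> 1" using False powr_mono[of "- real d / 2" 0 t] by simp
      also have "\<dots> \<le> C * min 1 t" using False by (simp add: C_def)
      finally show ?thesis .
    qed
    also have "\<dots> \<le> C * (2 * (1 - exp (- t)))"
      using min_1_le_one_minus_exp[of t] t by (intro mult_left_mono) (auto simp: C_def)
    finally show ?thesis by (simp add: mult_ac)
  qed
  then show ?thesis by (intro exI[of _ "2 * C"]) (auto simp: C_def)
qed

lemma heat_profile_integrable:
  assumes "levy_density h" "d > 0" "s > 0"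
  shows "integrable lborel (\<lambda>t. heat_profile d s t * h t)"
proof -
  obtain C where "\<forall>t>0. heat_profile d s t \<le> C * (1 - exp (- t))"
    using heat_profile_le[OF assms(2,3)] by blast
  then show ?thesis
    by (intro levy_density_integrable[OF assms(1), where B = C]) (auto simp: heat_profile_nonneg)
qed

lemma subordinate_nonneg: "levy_density h \<Longrightarrow> subordinate d h s \<ge> 0"
  unfolding subordinate_def
  by (intro Bochner_Integration.integral_nonneg mult_nonneg_nonneg heat_profile_nonneg levy_densityD(3))

lemma subordinate_antimono:
  assumes "levy_density h" "d > 0" "0 < s" "s \<le> s'"
  shows "subordinate d h s' \<le> subordinate d h s"
  unfolding subordinate_def using assms
  by (intro integral_mono heat_profile_integrable mult_right_mono heat_profile_antimono levy_densityD(3)[OF assms(1)]) auto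

lemma subordinate_measurable:
  assumes "levy_density h"
  shows "subordinate d h \<in> borel_measurable borel"
proof -
  note [measurable] = levy_densityD(1)[OF assms]
  show ?thesis unfolding subordinate_def by measurable
qed

text \<open>
  Outside the unit ball the Gaussian factor is bounded by a multiple of $|z|^{-2d-4}$.
\<close>

lemma integrable_max_gaussian:
  "integrable lborel (\<lambda>z::'a::euclidean_space. max 1 ((norm z)\<^sup>2) * exp (- ((norm z)\<^sup>2) / 4))"
proof -
  define n where "n = DIM('a) + 2"
  define C :: real where "C = fact n * 4 ^ n"
  have "integrable lborel (\<lambda>y::'a. indicator {1..} (norm y) * norm y powr (- (real DIM('a) + 1)))"
    using has_bochner_integral_norm_powr_outside[of "real DIM('a) + 1" 1, where 'a='a]
    by (auto intro: integrable.intros)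
  moreover have "integrable lborel (indicator (ball 0 1) :: 'a \<Rightarrow> real)"
    by (intro integrable_real_indicator) (auto simp: emeasure_ball)
  ultimately have "integrable lborel (\<lambda>y::'a. indicator (ball 0 1) y
      + C * (indicator {1..} (norm y) * norm y powr (- (real DIM('a) + 1))))"
    by (intro Bochner_Integration.integrable_add integrable_mult_right)
  then show ?thesis
  proof (rule Bochner_Integration.integrable_bound)
    have "norm (max 1 ((norm z)\<^sup>2) * exp (- ((norm z)\<^sup>2) / 4)) \<le>
      norm (indicator (ball 0 1) z + C * (indicator {1..} (norm z) * norm z powr (- (real DIM('a) + 1))))"
      for z :: 'a
    proof (cases "norm z < 1")
      case True
      then have "(norm z)\<^sup>2 \<le> 1" by (simp add: power_le_one)
      then show ?thesis using True by (simp add: max_def)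
    next
      case False
      then have z: "norm z \<ge> 1" by simp
      then have z2: "(norm z)\<^sup>2 \<ge> 1" by simp
      have "z \<noteq> 0" using z by auto
      have "exp (- ((norm z)\<^sup>2 / 4)) \<le> fact n * (1 / ((norm z)\<^sup>2 / 4)) ^ n"
        using z2 by (intro exp_minus_le_power) linarith
      also have "\<dots> = C * (1 / (norm z) ^ (2 * n))"
        by (simp add: C_def power_divide power_mult)
      finally have "(norm z)\<^sup>2 * exp (- ((norm z)\<^sup>2 / 4)) \<le> (norm z)\<^sup>2 * (C * (1 / (norm z) ^ (2 * n)))"
        by (intro mult_left_mono) auto
      also have "\<dots> = C * norm z powr (2 - 2 * real n)"
      proof -
        have "(norm z)\<^sup>2 = norm z powr 2" "norm z ^ (2 * n) = norm z powr (2 * real n)"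
          using z \<open>z \<noteq> 0\<close> powr_realpow[of "norm z" 2] powr_realpow[of "norm z" "2 * n"] by auto
        then show ?thesis by (simp add: powr_diff)
      qed
      also have "\<dots> \<le> C * norm z powr (- (real DIM('a) + 1))"
        using z by (intro mult_left_mono powr_mono) (auto simp: n_def C_def)
      finally have "(norm z)\<^sup>2 * exp (- ((norm z)\<^sup>2 / 4)) \<le> C * norm z powr (- (real DIM('a) + 1))" .
      moreover have "C \<ge> 0" by (simp add: C_def)
      ultimately show ?thesis using z z2 by (simp add: max_def abs_mult)
    qed
    then show "AE z in lborel. norm (max 1 ((norm (z::'a))\<^sup>2) * exp (- ((norm z)\<^sup>2) / 4)) \<le>
      norm (indicator (ball 0 1) z + C * (indicator {1..} (norm z) * norm z powr (- (real DIM('a) + 1))))"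
      by simp
  qed measurable
qed

definition heat_moment :: "'a::euclidean_space itself \<Rightarrow> real \<Rightarrow> real" where
  "heat_moment _ t = (\<integral>y. min 1 ((norm (y::'a))\<^sup>2) * heat_profile DIM('a) (norm y) t \<partial>lborel)"

text \<open>
  The substitution $y=\sqrt t\,z$ makes the Gaussian independent of $t$, and
  $\min(1,t|z|^2)\le\min(1,t)\max(1,|z|^2)$.
\<close>

lemma heat_moment_bound:
  assumes t: "t > 0"
  shows "integrable lborel (\<lambda>y::'a::euclidean_space. min 1 ((norm y)\<^sup>2) * heat_profile DIM('a) (norm y) t)"
    and "heat_moment TYPE('a) t \<le>
      2 * (\<integral>z. max 1 ((norm (z::'a))\<^sup>2) * exp (- ((norm z)\<^sup>2) / 4) \<partial>lborel) * (1 - exp (- t))"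
proof -
  let ?d = "DIM('a)" and ?G = "\<lambda>z::'a. max 1 ((norm z)\<^sup>2) * exp (- ((norm z)\<^sup>2) / 4)"
  let ?F = "\<lambda>y::'a. min 1 ((norm y)\<^sup>2) * heat_profile ?d (norm y) t"
  define k where "k = t powr (- real ?d / 2) * min 1 t"
  have k: "k \<ge> 0" using t by (simp add: k_def)
  have F: "?F (sqrt t *\<^sub>R z) \<le> k * ?G z" "?F (sqrt t *\<^sub>R z) \<ge> 0" for z
  proof -
    have "?F (sqrt t *\<^sub>R z) = t powr (- real ?d / 2) * (min 1 (t * (norm z)\<^sup>2) * exp (- ((norm z)\<^sup>2) / 4))"
      using t by (simp add: heat_profile_def power_mult_distrib)
    also have "\<dots> \<le> t powr (- real ?d / 2) * ((min 1 t * max 1 ((norm z)\<^sup>2)) * exp (- ((norm z)\<^sup>2) / 4))"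
    proof (intro mult_left_mono mult_right_mono)
      show "min 1 (t * (norm z)\<^sup>2) \<le> min 1 t * max 1 ((norm z)\<^sup>2)"
      proof (cases "t \<le> 1")
        case True
        have "t * (norm z)\<^sup>2 \<le> t * max 1 ((norm z)\<^sup>2)" using t by (intro mult_left_mono) auto
        then show ?thesis using True by (simp add: min_def)
      qed auto
    qed auto
    finally show "?F (sqrt t *\<^sub>R z) \<le> k * ?G z" by (simp add: k_def mult_ac)
    show "?F (sqrt t *\<^sub>R z) \<ge> 0" by (simp add: heat_profile_nonneg)
  qed
  have Gi: "integrable lborel (\<lambda>z. k * ?G z)"
    using integrable_max_gaussian[where 'a='a] by simp
  have Fi: "integrable lborel (\<lambda>z. ?F (sqrt t *\<^sub>R z))"
    by (rule Bochner_Integration.integrable_bound[OF Gi])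
       (use F k in \<open>auto simp: abs_of_nonneg simp del: norm_scaleR\<close>)
  then show "integrable lborel ?F"
    using lborel_integral_scale(1)[of "sqrt t" ?F] t by simp
  have "heat_moment TYPE('a) t = sqrt t ^ ?d * (\<integral>z. ?F (sqrt t *\<^sub>R z) \<partial>lborel)"
    unfolding heat_moment_def using t by (intro lborel_integral_scale(2)) auto
  also have "\<dots> \<le> sqrt t ^ ?d * (\<integral>z. k * ?G z \<partial>lborel)"
    using t by (intro mult_left_mono integral_mono Fi Gi F) auto
  also have "sqrt t ^ ?d = t powr (real ?d / 2)"
    using t by (simp add: powr_half_sqrt[symmetric] powr_powr powr_realpow[symmetric])
  also have "t powr (real ?d / 2) * (\<integral>z. k * ?G z \<partial>lborel) =
      (t powr (real ?d / 2) * t powr (- real ?d / 2)) * (min 1 t * (\<integral>z. ?G z \<partial>lborel))"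
    by (simp add: k_def)
  also have "t powr (real ?d / 2) * t powr (- real ?d / 2) = 1"
    using t by (simp add: powr_add[symmetric])
  also have "1 * (min 1 t * (\<integral>z. ?G z \<partial>lborel)) \<le> (2 * (1 - exp (- t))) * (\<integral>z. ?G z \<partial>lborel)"
    using min_1_le_one_minus_exp[of t] t
    by (simp only: mult_1) (intro mult_right_mono Bochner_Integration.integral_nonneg; simp)
  finally show "heat_moment TYPE('a) t \<le> 2 * (\<integral>z. ?G z \<partial>lborel) * (1 - exp (- t))"
    by (simp only: mult_ac)
qed

lemma heat_moment_nonneg: "heat_moment TYPE('a::euclidean_space) t \<ge> 0"
  unfolding heat_moment_def by (intro Bochner_Integration.integral_nonneg) (simp add: heat_profile_nonneg)

lemma heat_moment_measurable [measurable]: "heat_moment TYPE('a::euclidean_space) \<in> borel_measurable borel"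
  unfolding heat_moment_def by measurable

lemma heat_moment_integrable:
  assumes "levy_density h"
  shows "integrable lborel (\<lambda>t. heat_moment TYPE('a::euclidean_space) t * h t)"
  by (rule levy_density_integrable[OF assms heat_moment_measurable])
     (subst abs_of_nonneg[OF heat_moment_nonneg], rule heat_moment_bound(2))

text \<open>
  Tonelli's theorem transfers the weight $1-e^{-t}$ for Levy densities to the weight
  $\min(1,|y|^2)$ for the kernels built from them.
\<close>

lemma subordinate_moment:
  assumes h: "levy_density h"
  shows "has_bochner_integral lborel
    (\<lambda>y::'a::euclidean_space. min 1 ((norm y)\<^sup>2) * subordinate DIM('a) h (norm y))
    (\<integral>t. heat_moment TYPE('a) t * h t \<partial>lborel)"
proof (rule has_bochner_integral_nn_integral)
  note [measurable] = levy_densityD(1)[OF h] subordinate_measurable[OF h]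
  let ?d = "DIM('a)" and ?v = "\<lambda>y::'a. min 1 ((norm y)\<^sup>2)"
  have "(\<integral>\<^sup>+ y. ennreal (?v y * subordinate ?d h (norm y)) \<partial>lborel) =
      (\<integral>\<^sup>+ y. (\<integral>\<^sup>+ t. ennreal (?v y * heat_profile ?d (norm y) t * h t) \<partial>lborel) \<partial>lborel)"
  proof (rule nn_integral_cong)
    fix y :: 'a
    show "ennreal (?v y * subordinate ?d h (norm y)) =
        (\<integral>\<^sup>+ t. ennreal (?v y * heat_profile ?d (norm y) t * h t) \<partial>lborel)"
    proof (cases "y = 0")
      case False
      then have "integrable lborel (\<lambda>t. ?v y * (heat_profile ?d (norm y) t * h t))"
        by (intro integrable_mult_right heat_profile_integrable[OF h]) auto
      then have "(\<integral>\<^sup>+ t. ennreal (?v y * (heat_profile ?d (norm y) t * h t)) \<partial>lborel) =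
          ennreal (\<integral>t. ?v y * (heat_profile ?d (norm y) t * h t) \<partial>lborel)"
        by (rule nn_integral_eq_integral) (auto simp: heat_profile_nonneg levy_densityD(3)[OF h])
      then show ?thesis by (simp add: subordinate_def mult.assoc)
    qed simp
  qed
  also have "\<dots> = (\<integral>\<^sup>+ t. (\<integral>\<^sup>+ y. ennreal (?v y * heat_profile ?d (norm y) t * h t) \<partial>lborel) \<partial>lborel)"
    by (rule lborel_pair.Fubini') measurable
  also have "\<dots> = (\<integral>\<^sup>+ t. ennreal (heat_moment TYPE('a) t * h t) \<partial>lborel)"
  proof (rule nn_integral_cong)
    fix t :: real
    show "(\<integral>\<^sup>+ y. ennreal (?v y * heat_profile ?d (norm y) t * h t) \<partial>lborel) =
        ennreal (heat_moment TYPE('a) t * h t)"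
    proof (cases "t > 0")
      case True
      have "(\<integral>\<^sup>+ y. ennreal (?v y * heat_profile ?d (norm y) t * h t) \<partial>lborel) =
          ennreal (\<integral>y. ?v y * heat_profile ?d (norm y) t * h t \<partial>lborel)"
        by (intro nn_integral_eq_integral integrable_mult_left heat_moment_bound True)
           (auto simp: heat_profile_nonneg levy_densityD(3)[OF h])
      then show ?thesis by (simp add: heat_moment_def)
    qed (simp add: levy_densityD(2)[OF h])
  qed
  also have "\<dots> = ennreal (\<integral>t. heat_moment TYPE('a) t * h t \<partial>lborel)"
    by (intro nn_integral_eq_integral heat_moment_integrable h)
       (auto simp: heat_moment_nonneg levy_densityD(3)[OF h])
  finally show "(\<integral>\<^sup>+ y. ennreal (?v y * subordinate ?d h (norm y)) \<partial>lborel) =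
      ennreal (\<integral>t. heat_moment TYPE('a) t * h t \<partial>lborel)" .
  show "0 \<le> (\<integral>t. heat_moment TYPE('a) t * h t \<partial>lborel)"
    by (intro Bochner_Integration.integral_nonneg)
       (simp add: heat_moment_nonneg levy_densityD(3)[OF h])
  show "(\<lambda>y::'a. min 1 ((norm y)\<^sup>2) * subordinate DIM('a) h (norm y)) \<in> borel_measurable lborel"
    by measurable
qed (use h in \<open>auto simp: subordinate_nonneg intro!: AE_I2\<close>)

context levy_density_family
begin

lemma subordinate_nu_measurable [measurable]: "subordinate d (nu r) \<in> borel_measurable borel"
  by (rule subordinate_measurable[OF levy_density_nu])

lemma subordinate_stable_measurable [measurable]:
  "subordinate d (stable_density a) \<in> borel_measurable borel"
  by (rule subordinate_measurable[OF levy_density_stable])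

text \<open>
  Scaling: replace $t$ by $s^2t$ in the defining integral.
\<close>

lemma subordinate_stable:
  assumes "s > 0" "d > 0"
  shows "subordinate d (stable_density a) s = subordinate d (stable_density a) 1 * s powr (- (real d + 2 * a))"
proof -
  define c where "c = (\<integral>s. (1 - exp (- s)) * (indicator {0<..} s * s powr (- 1 - a)) \<partial>lborel)"
  have st: "stable_density a t = indicator {0<..} t * t powr (- 1 - a) / c" for t
    unfolding stable_density_def c_def ..
  have sq: "(s\<^sup>2) powr b = s powr (2 * b)" for b
  proof -
    have "s\<^sup>2 = s powr 2" using assms by simp
    then show ?thesis by (simp add: powr_powr)
  qed
  have "subordinate d (stable_density a) s =
      \<bar>s\<^sup>2\<bar> *\<^sub>R (\<integral>t. heat_profile d s (0 + s\<^sup>2 * t) * stable_density a (0 + s\<^sup>2 * t) \<partial>lborel)"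
    unfolding subordinate_def by (rule lborel_integral_real_affine) (use assms in auto)
  also have "(\<lambda>t. heat_profile d s (0 + s\<^sup>2 * t) * stable_density a (0 + s\<^sup>2 * t)) =
      (\<lambda>t. s powr (- (real d + 2 + 2 * a)) * (heat_profile d 1 t * stable_density a t))"
  proof
    fix t
    have "s powr (2 * (- real d / 2)) * s powr (2 * (- 1 - a)) = s powr (- (real d + 2 + 2 * a))"
      by (simp add: powr_add[symmetric] algebra_simps)
    then show "heat_profile d s (0 + s\<^sup>2 * t) * stable_density a (0 + s\<^sup>2 * t) =
        s powr (- (real d + 2 + 2 * a)) * (heat_profile d 1 t * stable_density a t)"
      using assms by (simp add: heat_profile_def st powr_mult sq indicator_def zero_less_mult_iff)
  qed
  also have "\<bar>s\<^sup>2\<bar> *\<^sub>R (\<integral>t. s powr (- (real d + 2 + 2 * a)) * (heat_profile d 1 t * stable_density a t) \<partial>lborel)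
      = (s powr 2 * s powr (- (real d + 2 + 2 * a))) * subordinate d (stable_density a) 1"
    using assms by (simp add: subordinate_def)
  also have "s powr 2 * s powr (- (real d + 2 + 2 * a)) = s powr (- (real d + 2 * a))"
    by (simp add: powr_add[symmetric])
  finally show ?thesis by (simp add: mult.commute)
qed

lemma subordinate_stable_pos:
  assumes "d > 0"
  shows "subordinate d (stable_density a) 1 > 0"
  unfolding subordinate_def
proof (rule integral_pos_of_pos_on_interval[of _ 0 1])
  show "integrable lborel (\<lambda>t. heat_profile d 1 t * stable_density a t)"
    by (rule heat_profile_integrable[OF levy_density_stable]) (use assms in auto)
  show "0 \<le> heat_profile d 1 t * stable_density a t" for t
    by (simp add: heat_profile_nonneg stable_nonneg)
  show "0 < heat_profile d 1 t * stable_density a t" if "0 < t" for t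
    using that stable_const_pos[OF a] by (simp add: heat_profile_def stable_density_def)
qed simp

text \<open>
  The majorants $B(1-e^{-t})\nu_r(t)$ converge pointwise by \<open>density_tendsto\<close>, and their integrals
  converge by the hypothesis on the Laplace exponents at $u=1$.
\<close>

lemma nu_integral_tendsto:
  assumes [measurable]: "f \<in> borel_measurable borel"
    and B: "B \<ge> 0" "\<And>t. t > 0 \<Longrightarrow> \<bar>f t\<bar> \<le> B * (1 - exp (- t))"
  shows "((\<lambda>r. \<integral>t. f t * nu r t \<partial>lborel) \<longlongrightarrow> (\<integral>t. f t * stable_density a t \<partial>lborel)) at_top"
proof (rule dominated_by_convergent_integrals
    [where g = "\<lambda>r t. B * ((1 - exp (- t)) * nu r t)" and ?g0.0 = "\<lambda>t. B * ((1 - exp (- t)) * stable_density a t)"])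
  show "integrable lborel (\<lambda>t. B * ((1 - exp (- t)) * nu r t))" for r
    using nu_weight_integrable by simp
  show "integrable lborel (\<lambda>t. B * ((1 - exp (- t)) * stable_density a t))"
    using stable_weight by (simp add: has_bochner_integral_iff)
  show "0 \<le> B * ((1 - exp (- t)) * nu r t)" for r t
    using B(1) nu_nonneg[of r t] nu_zero[of t r] by (cases "t > 0") auto
  show "((\<lambda>r. f t * nu r t) \<longlongrightarrow> f t * stable_density a t) at_top"
    "((\<lambda>r. B * ((1 - exp (- t)) * nu r t)) \<longlongrightarrow> B * ((1 - exp (- t)) * stable_density a t)) at_top" for t
    by (intro tendsto_intros density_tendsto)+
  show "((\<lambda>r. \<integral>t. B * ((1 - exp (- t)) * nu r t) \<partial>lborel) \<longlongrightarrow>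
      (\<integral>t. B * ((1 - exp (- t)) * stable_density a t) \<partial>lborel)) at_top"
    using tendsto_mult[OF tendsto_const nu_mass_tendsto, of B] stable_weight
    by (simp add: has_bochner_integral_iff)
  have "\<bar>f t * nu r t\<bar> \<le> B * ((1 - exp (- t)) * nu r t)" for r t
    using mult_right_mono[OF B(2) nu_nonneg, of t r t] nu_zero[of t r] nu_nonneg[of r t]
    by (cases "t > 0") (auto simp: abs_mult mult.assoc)
  then show "\<forall>\<^sub>F r in at_top. \<forall>t. \<bar>f t * nu r t\<bar> \<le> B * ((1 - exp (- t)) * nu r t)" by simp
qed measurable

lemma subordinate_tendsto:
  assumes "d > 0" "s > 0"
  shows "((\<lambda>r. subordinate d (nu r) s) \<longlongrightarrow> subordinate d (stable_density a) s) at_top"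
proof -
  obtain C where "C \<ge> 0" "\<forall>t>0. heat_profile d s t \<le> C * (1 - exp (- t))"
    using heat_profile_le[OF assms] by blast
  then show ?thesis unfolding subordinate_def
    by (intro nu_integral_tendsto[of _ C]) (auto simp: heat_profile_nonneg)
qed

lemma subordinate_moment_tendsto:
  "((\<lambda>r. \<integral>y. min 1 ((norm (y::'b::euclidean_space))\<^sup>2) * subordinate DIM('b) (nu r) (norm y) \<partial>lborel) \<longlongrightarrow>
    (\<integral>y. min 1 ((norm (y::'b))\<^sup>2) * subordinate DIM('b) (stable_density a) (norm y) \<partial>lborel)) at_top"
proof -
  have "((\<lambda>r. \<integral>t. heat_moment TYPE('b) t * nu r t \<partial>lborel) \<longlongrightarrow>
      (\<integral>t. heat_moment TYPE('b) t * stable_density a t \<partial>lborel)) at_top"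
    using heat_moment_bound(2)[where 'a='b] heat_moment_nonneg[where 'a='b]
    by (intro nu_integral_tendsto[where B = "2 * (\<integral>z. max 1 ((norm (z::'b))\<^sup>2) * exp (- ((norm z)\<^sup>2) / 4) \<partial>lborel)"])
       (auto intro!: Bochner_Integration.integral_nonneg)
  then show ?thesis
    using subordinate_moment[OF levy_density_nu, where 'a='b]
      subordinate_moment[OF levy_density_stable, where 'a='b]
    by (simp add: has_bochner_integral_iff)
qed

text \<open>
  The counterpart in space of the limits for integrals against \<open>nu r\<close>, with majorants
  $B\min(1,|y|^2)J_r(|y|)$. The weight vanishes at $y=0$, where the kernel need not converge.
\<close>

lemma subordinate_integral_tendsto:
  fixes f :: "real \<Rightarrow> 'b::euclidean_space \<Rightarrow> real"
  assumes [measurable]: "\<And>r. f r \<in> borel_measurable borel" "f0 \<in> borel_measurable borel"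
    and B: "B \<ge> 0"
    and dom: "\<forall>\<^sub>F r in at_top. \<forall>y. \<bar>f r y\<bar> \<le> B * (min 1 ((norm y)\<^sup>2) * subordinate DIM('b) (nu r) (norm y))"
    and lim: "\<And>y. ((\<lambda>r. f r y) \<longlongrightarrow> f0 y) at_top"
  shows "((\<lambda>r. \<integral>y. f r y \<partial>lborel) \<longlongrightarrow> (\<integral>y. f0 y \<partial>lborel)) at_top"
proof (rule dominated_by_convergent_integrals[where
      g = "\<lambda>r y. B * (min 1 ((norm y)\<^sup>2) * subordinate DIM('b) (nu r) (norm y))" and
      ?g0.0 = "\<lambda>y. B * (min 1 ((norm y)\<^sup>2) * subordinate DIM('b) (stable_density a) (norm y))"])
  show "integrable lborel (\<lambda>y::'b. B * (min 1 ((norm y)\<^sup>2) * subordinate DIM('b) (nu r) (norm y)))" for r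
    using subordinate_moment[OF levy_density_nu, where 'a='b] by (simp add: has_bochner_integral_iff)
  show "integrable lborel (\<lambda>y::'b. B * (min 1 ((norm y)\<^sup>2) * subordinate DIM('b) (stable_density a) (norm y)))"
    using subordinate_moment[OF levy_density_stable, where 'a='b] by (simp add: has_bochner_integral_iff)
  show "0 \<le> B * (min 1 ((norm y)\<^sup>2) * subordinate DIM('b) (nu r) (norm y))" for r and y :: 'b
    using B by (simp add: subordinate_nonneg levy_density_nu)
  show "((\<lambda>r. B * (min 1 ((norm y)\<^sup>2) * subordinate DIM('b) (nu r) (norm y))) \<longlongrightarrow>
      B * (min 1 ((norm y)\<^sup>2) * subordinate DIM('b) (stable_density a) (norm y))) at_top" for y :: 'b
    by (cases "y = 0") (auto intro!: tendsto_mult_left subordinate_tendsto)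
  show "((\<lambda>r. \<integral>y. B * (min 1 ((norm (y::'b))\<^sup>2) * subordinate DIM('b) (nu r) (norm y)) \<partial>lborel) \<longlongrightarrow>
      (\<integral>y. B * (min 1 ((norm (y::'b))\<^sup>2) * subordinate DIM('b) (stable_density a) (norm y)) \<partial>lborel)) at_top"
    using tendsto_mult[OF tendsto_const subordinate_moment_tendsto[where 'b='b], of B] by simp
qed (use dom lim in auto)

end

section \<open>Limits of integrals of the rescaled kernel\<close>

context levy_density_family
begin

lemma stable_subordinate_scaled:
  assumes "y \<noteq> (0 :: 'b::euclidean_space)"
  shows "subordinate DIM('b) (stable_density a) (norm y) =
    subordinate DIM('b) (stable_density a) 1 * norm y powr (- (real DIM('b) + 2 * a))"
  using assms by (intro subordinate_stable) auto

lemma inner_second_moment_integrable: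
  assumes "0 < t" "t < 1"
  shows "integrable lborel (\<lambda>y::'b::euclidean_space.
    indicator {..<t} (norm y) * ((norm y)\<^sup>2 * subordinate DIM('b) (nu r) (norm y)))"
proof (rule Bochner_Integration.integrable_bound)
  show "integrable lborel (\<lambda>y::'b. min 1 ((norm y)\<^sup>2) * subordinate DIM('b) (nu r) (norm y))"
    using subordinate_moment[OF levy_density_nu, where 'a='b] by (simp add: has_bochner_integral_iff)
  have "(norm y)\<^sup>2 \<le> 1" if "norm y < t" for y :: 'b using that assms by (intro power_le_one) auto
  then show "AE y::'b in lborel. norm (indicator {..<t} (norm y) * ((norm y)\<^sup>2 * subordinate DIM('b) (nu r) (norm y)))
      \<le> norm (min 1 ((norm y)\<^sup>2) * subordinate DIM('b) (nu r) (norm y))"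
    by (auto simp: indicator_def abs_mult intro!: mult_right_mono)
qed measurable

lemma inner_second_moment_tendsto:
  assumes t: "0 < t" "t < 1"
  shows "((\<lambda>r. \<integral>y. indicator {..<t} (norm (y::'b::euclidean_space)) *
      ((norm y)\<^sup>2 * subordinate DIM('b) (nu r) (norm y)) \<partial>lborel) \<longlongrightarrow>
    subordinate DIM('b) (stable_density a) 1 * (sphere_area TYPE('b) * (t powr (2 - 2 * a) / (2 - 2 * a)))) at_top"
proof -
  let ?d = "DIM('b)" and ?K = "subordinate DIM('b) (stable_density a) 1"
  have "((\<lambda>r. \<integral>y. indicator {..<t} (norm (y::'b)) * ((norm y)\<^sup>2 * subordinate ?d (nu r) (norm y)) \<partial>lborel) \<longlongrightarrow>
    (\<integral>y. indicator {..<t} (norm (y::'b)) * ((norm y)\<^sup>2 * subordinate ?d (stable_density a) (norm y)) \<partial>lborel)) at_top"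
  proof (rule subordinate_integral_tendsto[where B = 1])
    have "(norm y)\<^sup>2 \<le> 1" if "norm y < t" for y :: 'b using that t by (intro power_le_one) auto
    then show "\<forall>\<^sub>F r in at_top. \<forall>y::'b. \<bar>indicator {..<t} (norm y) * ((norm y)\<^sup>2 * subordinate ?d (nu r) (norm y))\<bar>
        \<le> 1 * (min 1 ((norm y)\<^sup>2) * subordinate ?d (nu r) (norm y))"
      by (auto simp: indicator_def abs_mult subordinate_nonneg levy_density_nu intro!: always_eventually)
    show "((\<lambda>r. indicator {..<t} (norm y) * ((norm y)\<^sup>2 * subordinate ?d (nu r) (norm y))) \<longlongrightarrow>
        indicator {..<t} (norm y) * ((norm y)\<^sup>2 * subordinate ?d (stable_density a) (norm y))) at_top" for y :: 'b
      by (cases "y = 0") (auto intro!: tendsto_intros subordinate_tendsto)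
  qed auto
  also have "(\<lambda>y::'b. indicator {..<t} (norm y) * ((norm y)\<^sup>2 * subordinate ?d (stable_density a) (norm y))) =
      (\<lambda>y. ?K * (indicator {..<t} (norm y) * norm y powr (- (real ?d + 2 * a - 2))))"
  proof
    fix y :: 'b
    show "indicator {..<t} (norm y) * ((norm y)\<^sup>2 * subordinate ?d (stable_density a) (norm y)) =
        ?K * (indicator {..<t} (norm y) * norm y powr (- (real ?d + 2 * a - 2)))"
    proof (cases "y = 0")
      case False
      then have "(norm y)\<^sup>2 * norm y powr (- (real ?d + 2 * a)) = norm y powr (- (real ?d + 2 * a - 2))"
        using powr_realpow[of "norm y" 2] powr_add[of "norm y" 2 "- (real ?d + 2 * a)"] by (simp add: algebra_simps)
      then show ?thesis unfolding stable_subordinate_scaled[OF False] by (metis mult.left_commute)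
    qed simp
  qed
  also have "(\<integral>y. ?K * (indicator {..<t} (norm (y::'b)) * norm y powr (- (real ?d + 2 * a - 2))) \<partial>lborel) =
      ?K * (sphere_area TYPE('b) * (t powr (2 - 2 * a) / (2 - 2 * a)))"
    using has_bochner_integral_norm_powr_inside[of "real ?d + 2 * a - 2" t, where 'a='b] t a
    by (simp add: has_bochner_integral_iff)
  finally show ?thesis .
qed

lemma outer_bound:
  assumes "0 < t" "t < 1" "t \<le> norm (y::'b::euclidean_space)"
  shows "subordinate DIM('b) (nu r) (norm y) \<le>
    (1 / t\<^sup>2) * (min 1 ((norm y)\<^sup>2) * subordinate DIM('b) (nu r) (norm y))"
proof -
  have "t\<^sup>2 \<le> min 1 ((norm y)\<^sup>2)" using assms by (auto simp: power_le_one power_mono)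
  then have "t\<^sup>2 * subordinate DIM('b) (nu r) (norm y) \<le> min 1 ((norm y)\<^sup>2) * subordinate DIM('b) (nu r) (norm y)"
    by (intro mult_right_mono subordinate_nonneg levy_density_nu)
  then show ?thesis using assms by (simp add: field_simps)
qed

text \<open>
  One factor of the kernel is kept to be compared with the integrable weight, the remaining power
  is bounded by monotonicity.
\<close>

lemma outer_powr_bound:
  assumes t: "0 < t" "t < 1" and p: "p \<ge> 1"
  shows "\<bar>indicator {t..} (norm (y::'b::euclidean_space)) * subordinate DIM('b) (nu r) (norm y) powr p\<bar> \<le>
    (subordinate DIM('b) (nu r) t powr (p - 1) / t\<^sup>2) * (min 1 ((norm y)\<^sup>2) * subordinate DIM('b) (nu r) (norm y))"
proof (cases "norm y \<ge> t")
  case True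
  let ?J = "subordinate DIM('b) (nu r)"
  have J: "?J (norm y) \<ge> 0" by (simp add: subordinate_nonneg levy_density_nu)
  have "?J (norm y) powr p = ?J (norm y) powr (p - 1) * ?J (norm y)"
    using J powr_mult_base[of "?J (norm y)" "p - 1"] by (cases "?J (norm y) = 0") (auto simp: mult.commute)
  also have "\<dots> \<le> ?J t powr (p - 1) * ((1 / t\<^sup>2) * (min 1 ((norm y)\<^sup>2) * ?J (norm y)))"
    using J t p True
    by (intro mult_mono powr_mono2 subordinate_antimono levy_density_nu outer_bound) auto
  finally show ?thesis using True by simp
next
  case False
  then show ?thesis by (simp add: subordinate_nonneg levy_density_nu)
qed

lemma outer_powr_integrable:
  assumes t: "0 < t" "t < 1" and p: "p \<ge> 1"
  shows "integrable lborel (\<lambda>y::'b::euclidean_space.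
    indicator {t..} (norm y) * subordinate DIM('b) (nu r) (norm y) powr p)"
proof (rule Bochner_Integration.integrable_bound)
  show "integrable lborel (\<lambda>y::'b. (subordinate DIM('b) (nu r) t powr (p - 1) / t\<^sup>2) *
      (min 1 ((norm y)\<^sup>2) * subordinate DIM('b) (nu r) (norm y)))"
    using subordinate_moment[OF levy_density_nu, where 'a='b] by (simp add: has_bochner_integral_iff)
  show "AE y::'b in lborel. norm (indicator {t..} (norm y) * subordinate DIM('b) (nu r) (norm y) powr p) \<le>
     norm ((subordinate DIM('b) (nu r) t powr (p - 1) / t\<^sup>2) *
      (min 1 ((norm y)\<^sup>2) * subordinate DIM('b) (nu r) (norm y)))"
    using order_trans[OF outer_powr_bound[OF assms] abs_ge_self] by (intro AE_I2) simp
qed measurable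

lemma outer_powr_tendsto:
  assumes t: "0 < t" "t < 1" and p: "p \<ge> 1"
  defines "b \<equiv> real DIM('b) + 2 * a"
  shows "((\<lambda>r. \<integral>y. indicator {t..} (norm (y::'b::euclidean_space)) *
      subordinate DIM('b) (nu r) (norm y) powr p \<partial>lborel) \<longlongrightarrow>
    subordinate DIM('b) (stable_density a) 1 powr p *
      (sphere_area TYPE('b) * (t powr (real DIM('b) - b * p) / (b * p - real DIM('b))))) at_top"
proof -
  let ?d = "DIM('b)" and ?K = "subordinate DIM('b) (stable_density a) 1"
  define D where "D = subordinate ?d (stable_density a) t + 1"
  have D: "D > 0" unfolding D_def by (intro add_nonneg_pos subordinate_nonneg levy_density_stable) auto
  have "real ?d * 1 < b * p"
    using a p by (intro mult_less_le_imp_less) (auto simp: b_def)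
  then have bp: "real ?d < b * p" by simp
  have "((\<lambda>r. \<integral>y. indicator {t..} (norm (y::'b)) * subordinate ?d (nu r) (norm y) powr p \<partial>lborel) \<longlongrightarrow>
    (\<integral>y. indicator {t..} (norm (y::'b)) * subordinate ?d (stable_density a) (norm y) powr p \<partial>lborel)) at_top"
  proof (rule subordinate_integral_tendsto[where B = "D powr (p - 1) / t\<^sup>2"])
    have "\<forall>\<^sub>F r in at_top. subordinate ?d (nu r) t < D"
      using order_tendstoD(2)[OF subordinate_tendsto[of ?d t], of D] t by (simp add: D_def)
    then show "\<forall>\<^sub>F r in at_top. \<forall>y::'b. \<bar>indicator {t..} (norm y) * subordinate ?d (nu r) (norm y) powr p\<bar>
        \<le> D powr (p - 1) / t\<^sup>2 * (min 1 ((norm y)\<^sup>2) * subordinate ?d (nu r) (norm y))"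
    proof eventually_elim
      case (elim r)
      have "subordinate ?d (nu r) t powr (p - 1) / t\<^sup>2 \<le> D powr (p - 1) / t\<^sup>2"
        using elim p by (intro divide_right_mono powr_mono2 subordinate_nonneg levy_density_nu) auto
      then show ?case
        by (intro allI order_trans[OF outer_powr_bound[OF t p]] mult_right_mono)
           (auto simp: subordinate_nonneg levy_density_nu)
    qed
    show "((\<lambda>r. indicator {t..} (norm y) * subordinate ?d (nu r) (norm y) powr p) \<longlongrightarrow>
        indicator {t..} (norm y) * subordinate ?d (stable_density a) (norm y) powr p) at_top" for y :: 'b
    proof (cases "y = 0")
      case False
      have "subordinate ?d (stable_density a) (norm y) \<noteq> 0"
        using False subordinate_stable_pos[of ?d] by (simp add: stable_subordinate_scaled)
      then show ?thesis using False by (auto intro!: tendsto_intros subordinate_tendsto)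
    qed (use t in simp)
  qed (use D in auto)
  also have "(\<lambda>y::'b. indicator {t..} (norm y) * subordinate ?d (stable_density a) (norm y) powr p) =
      (\<lambda>y. ?K powr p * (indicator {t..} (norm y) * norm y powr (- (b * p))))"
  proof
    fix y :: 'b
    show "indicator {t..} (norm y) * subordinate ?d (stable_density a) (norm y) powr p =
        ?K powr p * (indicator {t..} (norm y) * norm y powr (- (b * p)))"
    proof (cases "y = 0")
      case False
      then show ?thesis unfolding stable_subordinate_scaled[OF False] b_def[symmetric]
        using subordinate_stable_pos[of ?d] by (simp add: powr_mult powr_powr)
    qed (use t in simp)
  qed
  also have "(\<integral>y. ?K powr p * (indicator {t..} (norm (y::'b)) * norm y powr (- (b * p))) \<partial>lborel) =
      ?K powr p * (sphere_area TYPE('b) * (t powr (real DIM('b) - b * p) / (b * p - real DIM('b))))"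
    using has_bochner_integral_norm_powr_outside[of "b * p" t, where 'a='b] t bp
    by (simp add: has_bochner_integral_iff)
  finally show ?thesis .
qed

end

section \<open>Profiles with power decay\<close>

locale power_decay_profile =
  fixes \<rho> :: "real \<Rightarrow> real" and \<kappa> c :: real
  assumes rho_antimono: "antimono \<rho>" and rho_pos: "\<And>s. \<rho> s > 0"
    and kappa: "\<kappa> > 0" and c: "c > 0"
    and rho_asymp: "((\<lambda>s. \<rho> s / (c * s powr (- 2 * \<kappa>))) \<longlongrightarrow> 1) at_top"
begin

lemma rho_measurable [measurable]: "\<rho> \<in> borel_measurable borel"
proof -
  have "mono (\<lambda>s. - \<rho> s)" using rho_antimono by (auto simp: mono_def antimono_def)
  then have "(\<lambda>s. - (- \<rho> s)) \<in> borel_measurable borel"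
    by (intro borel_measurable_uminus borel_measurable_mono)
  then show ?thesis by simp
qed

lemma rho_le_power: "\<exists>B>0. \<forall>s>0. \<rho> s \<le> B * s powr (- 2 * \<kappa>)"
proof -
  have "\<forall>\<^sub>F s in at_top. \<rho> s / (c * s powr (- 2 * \<kappa>)) < 2"
    using order_tendstoD(2)[OF rho_asymp, of 2] by simp
  then obtain S where S: "\<And>s. s \<ge> S \<Longrightarrow> \<rho> s / (c * s powr (- 2 * \<kappa>)) < 2"
    by (auto simp: eventually_at_top_linorder)
  define S' where "S' = max S 1"
  define B where "B = max (2 * c) (\<rho> 0 * S' powr (2 * \<kappa>))"
  have "\<rho> s \<le> B * s powr (- 2 * \<kappa>)" if s: "s > 0" for s
  proof (cases "s \<ge> S'")
    case True
    then have "\<rho> s \<le> 2 * c * s powr (- 2 * \<kappa>)"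
      using S[of s] s c by (simp add: S'_def field_simps)
    also have "\<dots> \<le> B * s powr (- 2 * \<kappa>)" by (intro mult_right_mono) (auto simp: B_def)
    finally show ?thesis .
  next
    case False
    have "\<rho> s \<le> \<rho> 0" using rho_antimono s by (auto simp: antimono_def)
    also have "\<dots> = \<rho> 0 * (s powr (2 * \<kappa>) * s powr (- 2 * \<kappa>))"
      using s by (simp add: powr_add[symmetric])
    also have "\<dots> \<le> \<rho> 0 * (S' powr (2 * \<kappa>) * s powr (- 2 * \<kappa>))"
      using s False kappa rho_pos[of 0] by (intro mult_left_mono mult_right_mono powr_mono2) auto
    also have "\<dots> \<le> B * s powr (- 2 * \<kappa>)" unfolding mult.assoc[symmetric]
      by (intro mult_right_mono) (auto simp: B_def)
    finally show ?thesis .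
  qed
  moreover have "B > 0" using c by (simp add: B_def)
  ultimately show ?thesis by blast
qed

lemma ratio_tendsto:
  assumes "s > 0"
  shows "((\<lambda>r. \<rho> (r * s) / \<rho> r) \<longlongrightarrow> s powr (- 2 * \<kappa>)) at_top"
proof -
  have "filterlim (\<lambda>r. r * s) at_top at_top"
    by (rule filterlim_at_top_mult_tendsto_pos[OF tendsto_const assms filterlim_ident])
  from filterlim_compose[OF rho_asymp this]
  have "((\<lambda>r. \<rho> (r * s) / (c * (r * s) powr (- 2 * \<kappa>)) / (\<rho> r / (c * r powr (- 2 * \<kappa>)))
      * s powr (- 2 * \<kappa>)) \<longlongrightarrow> 1 / 1 * s powr (- 2 * \<kappa>)) at_top"
    by (intro tendsto_mult tendsto_divide rho_asymp tendsto_const) auto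
  then have "((\<lambda>r. \<rho> (r * s) / (c * (r * s) powr (- 2 * \<kappa>)) / (\<rho> r / (c * r powr (- 2 * \<kappa>)))
      * s powr (- 2 * \<kappa>)) \<longlongrightarrow> s powr (- 2 * \<kappa>)) at_top" by simp
  then show ?thesis
  proof (rule Lim_transform_eventually)
    show "\<forall>\<^sub>F r in at_top. \<rho> (r * s) / (c * (r * s) powr (- 2 * \<kappa>)) / (\<rho> r / (c * r powr (- 2 * \<kappa>)))
      * s powr (- 2 * \<kappa>) = \<rho> (r * s) / \<rho> r"
      using eventually_gt_at_top[of 0]
    proof eventually_elim
      case (elim r)
      then show ?case using assms c rho_pos[of r] by (simp add: powr_mult field_simps)
    qed
  qed
qed

text \<open>
  The profile is bounded near the origin, so the upper bound by a multiple of $s^{-2\kappa}$ holds for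
  all $s>0$, and not only where the asymptotics apply. This gives a majorant of $\rho(rs)/\rho(r)$
  that is independent of $r$.
\<close>

lemma ratio_le_power: "\<exists>B>0. \<forall>\<^sub>F r in at_top. \<forall>s>0. \<rho> (r * s) / \<rho> r \<le> B * s powr (- 2 * \<kappa>)"
proof -
  obtain B where B: "B > 0" "\<And>s. s > 0 \<Longrightarrow> \<rho> s \<le> B * s powr (- 2 * \<kappa>)"
    using rho_le_power by blast
  have "\<forall>\<^sub>F r in at_top. \<rho> r / (c * r powr (- 2 * \<kappa>)) > 1 / 2"
    using order_tendstoD(1)[OF rho_asymp, of "1/2"] by simp
  moreover have "\<forall>\<^sub>F r::real in at_top. r > 0" by (rule eventually_gt_at_top)
  ultimately have "\<forall>\<^sub>F r in at_top. \<forall>s>0. \<rho> (r * s) / \<rho> r \<le> (2 * B / c) * s powr (- 2 * \<kappa>)"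
  proof eventually_elim
    case (elim r)
    then have lo: "c / 2 * r powr (- 2 * \<kappa>) \<le> \<rho> r" using c by (simp add: field_simps)
    show ?case
    proof (intro allI impI)
      fix s :: real assume s: "s > 0"
      have "\<rho> (r * s) / \<rho> r \<le> (B * (r * s) powr (- 2 * \<kappa>)) / (c / 2 * r powr (- 2 * \<kappa>))"
        using B s elim lo c rho_pos[of "r * s"] by (intro frac_le) auto
      also have "\<dots> = (2 * B / c) * s powr (- 2 * \<kappa>)"
        using s elim c by (simp add: powr_mult field_simps)
      finally show "\<rho> (r * s) / \<rho> r \<le> (2 * B / c) * s powr (- 2 * \<kappa>)" .
    qed
  qed
  then show ?thesis using B c by (intro exI[of _ "2 * B / c"]) auto
qed

lemma ratio_integral_tendsto:
  fixes S :: "real set" and p I :: real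
  assumes [measurable]: "S \<in> sets borel" and p: "p > 0"
    and I: "has_bochner_integral lborel
      (\<lambda>z::'b::euclidean_space. indicator S (norm z) * norm z powr (- (2 * \<kappa> * p))) I"
  shows "((\<lambda>r. \<integral>z. indicator S (norm (z::'b)) * (\<rho> (r * norm z) / \<rho> r) powr p \<partial>lborel) \<longlongrightarrow> I) at_top"
    and "\<forall>\<^sub>F r in at_top. integrable lborel (\<lambda>z::'b. indicator S (norm z) * (\<rho> (r * norm z) / \<rho> r) powr p)"
proof -
  obtain B where B: "B > 0"
    and Br: "\<forall>\<^sub>F r in at_top. \<forall>s>0. \<rho> (r * s) / \<rho> r \<le> B * s powr (- 2 * \<kappa>)"
    using ratio_le_power by blast
  let ?w = "\<lambda>z::'b. B powr p * (indicator S (norm z) * norm z powr (- (2 * \<kappa> * p)))"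
  have w: "integrable lborel ?w" using I by (simp add: has_bochner_integral_iff)
  have AE0: "AE z::'b in lborel. z \<noteq> 0" by (rule AE_lborel_singleton)
  have bound: "\<forall>\<^sub>F r in at_top. AE z in lborel.
      norm (indicator S (norm (z::'b)) * (\<rho> (r * norm z) / \<rho> r) powr p) \<le> ?w z"
    using Br
  proof eventually_elim
    case (elim r)
    show ?case using AE0
    proof eventually_elim
      case (elim z)
      have "(\<rho> (r * norm z) / \<rho> r) powr p \<le> (B * norm z powr (- 2 * \<kappa>)) powr p"
        using p elim \<open>\<forall>s>0. \<rho> (r * s) / \<rho> r \<le> B * s powr (- 2 * \<kappa>)\<close> rho_pos[of r] rho_pos[of "r * norm z"]
        by (intro powr_mono2) auto
      also have "\<dots> = B powr p * norm z powr (- (2 * \<kappa> * p))"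
        using B by (simp add: powr_mult powr_powr)
      finally show ?case by (auto simp: indicator_def)
    qed
  qed
  have "((\<lambda>r. \<integral>z. indicator S (norm (z::'b)) * (\<rho> (r * norm z) / \<rho> r) powr p \<partial>lborel) \<longlongrightarrow>
     (\<integral>z. indicator S (norm (z::'b)) * norm z powr (- (2 * \<kappa> * p)) \<partial>lborel)) at_top"
  proof (rule integral_dominated_convergence_at_top[OF _ _ w _ bound])
    show "AE z::'b in lborel. ((\<lambda>r. indicator S (norm z) * (\<rho> (r * norm z) / \<rho> r) powr p) \<longlongrightarrow>
        indicator S (norm z) * norm z powr (- (2 * \<kappa> * p))) at_top"
      using AE0
    proof eventually_elim
      case (elim z)
      then have "((\<lambda>r. indicator S (norm z) * (\<rho> (r * norm z) / \<rho> r) powr p) \<longlongrightarrow>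
        indicator S (norm z) * (norm z powr (- 2 * \<kappa>)) powr p) at_top"
        by (intro tendsto_intros ratio_tendsto) auto
      then show ?case by (simp add: powr_powr)
    qed
  qed measurable
  then show "((\<lambda>r. \<integral>z. indicator S (norm (z::'b)) * (\<rho> (r * norm z) / \<rho> r) powr p \<partial>lborel) \<longlongrightarrow> I) at_top"
    using I by (simp add: has_bochner_integral_iff)
  show "\<forall>\<^sub>F r in at_top. integrable lborel (\<lambda>z::'b. indicator S (norm z) * (\<rho> (r * norm z) / \<rho> r) powr p)"
    using bound
  proof eventually_elim
    case (elim r)
    then have "AE z in lborel. norm (indicator S (norm (z::'b)) * (\<rho> (r * norm z) / \<rho> r) powr p) \<le> norm (?w z)"
      by eventually_elim (metis abs_ge_self order_trans real_norm_def)
    then show ?case by (intro Bochner_Integration.integrable_bound[OF w]) auto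
  qed
qed

end

section \<open>Levy densities of complete Bernstein functions\<close>

text \<open>
  Time scales like the square of space, so $t\mapsto r^2t$ accompanies $h = ry$. The factor
  $1/\Phi(r^{-2})$ gives the Laplace exponent the value $1$ at $u=1$. At $r=0$ the density is zero, whatever
  the value of \<open>\<Phi>\<close> at $1/0=0$.
\<close>

definition rescaled_density :: "(real \<Rightarrow> real) \<Rightarrow> (real \<Rightarrow> real) \<Rightarrow> real \<Rightarrow> real \<Rightarrow> real" where
  "rescaled_density \<Phi> \<mu> r t =
     r\<^sup>2 / \<Phi> (1 / r\<^sup>2) * (indicator {0<..} (r\<^sup>2 * t) * \<mu> (r\<^sup>2 * t))"

lemma completely_monotone_nonneg: "completely_monotone \<mu> \<Longrightarrow> t > 0 \<Longrightarrow> \<mu> t \<ge> 0"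
  unfolding completely_monotone_def by (drule spec[of _ 0]) auto

lemma completely_monotone_antimono:
  assumes "completely_monotone \<mu>" "0 < s" "s \<le> t"
  shows "\<mu> t \<le> \<mu> s"
proof (rule DERIV_nonpos_imp_nonincreasing[OF assms(3)])
  fix x assume x: "s \<le> x" "x \<le> t"
  then have "\<mu> field_differentiable (at x)" "deriv \<mu> x \<le> 0"
    using assms(1)[unfolded completely_monotone_def, rule_format, of x 0]
      assms(1)[unfolded completely_monotone_def, rule_format, of x 1] assms(2) by auto
  then show "\<exists>y. (\<mu> has_real_derivative y) (at x) \<and> y \<le> 0"
    using DERIV_deriv_iff_field_differentiable by blast
qed

lemma completely_monotone_measurable:
  assumes "completely_monotone \<mu>"
  shows "(\<lambda>t. indicator {0<..} t * \<mu> t) \<in> borel_measurable borel"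
proof -
  have "continuous_on {0<..} \<mu>"
  proof (rule continuous_at_imp_continuous_on, rule ballI)
    fix t :: real assume "t \<in> {0<..}"
    then have "\<mu> field_differentiable (at t)"
      using assms(1)[unfolded completely_monotone_def, rule_format, of t 0] by auto
    then show "isCont \<mu> t" by (rule field_differentiable_imp_continuous_at)
  qed
  from borel_measurable_continuous_on_indicator[OF _ this] show ?thesis by simp
qed

lemma bernstein_integrable:
  assumes "complete_bernstein_pair \<Phi> \<mu>" "u > 0"
  shows "integrable lborel (\<lambda>t. (1 - exp (- u * t)) * (indicator {0<..} t * \<mu> t))"
proof (rule Bochner_Integration.integrable_bound)
  have cm: "completely_monotone \<mu>"
    and "set_integrable lborel {0<..} (\<lambda>t. min 1 t * \<mu> t)"
    using assms by (auto simp: complete_bernstein_pair_def)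
  then show "integrable lborel (\<lambda>t. max 1 u * (indicator {0<..} t *\<^sub>R (min 1 t * \<mu> t)))"
    by (simp add: set_integrable_def)
  have "norm ((1 - exp (- u * t)) * (indicator {0<..} t * \<mu> t)) \<le>
      norm (max 1 u * (indicator {0<..} t *\<^sub>R (min 1 t * \<mu> t)))" for t
  proof (cases "t > 0")
    case True
    have "1 - exp (- u * t) \<le> u * t" using exp_ge_add_one_self[of "- u * t"] by simp
    moreover have "u * t \<le> max 1 u * t" using True by (intro mult_right_mono) auto
    moreover have "1 - exp (- u * t) \<le> max 1 u"
      using exp_gt_zero[of "- u * t"] max.cobounded1[of 1 u] by linarith
    ultimately have "1 - exp (- u * t) \<le> max 1 u * min 1 t"
      unfolding min_def by (simp split: if_split) 
    then have "(1 - exp (- u * t)) * \<mu> t \<le> max 1 u * min 1 t * \<mu> t"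
      using completely_monotone_nonneg[OF cm True] by (intro mult_right_mono)
    moreover have "0 \<le> (1 - exp (- u * t)) * \<mu> t"
      using completely_monotone_nonneg[OF cm True] True assms(2) by simp
    ultimately show ?thesis using True by (simp add: mult.assoc)
  qed simp
  then show "AE t in lborel. norm ((1 - exp (- u * t)) * (indicator {0<..} t * \<mu> t)) \<le>
      norm (max 1 u * (indicator {0<..} t *\<^sub>R (min 1 t * \<mu> t)))" by simp
  note [measurable] = completely_monotone_measurable[OF cm]
  show "(\<lambda>t. (1 - exp (- u * t)) * (indicator {0<..} t * \<mu> t)) \<in> borel_measurable lborel"
    by measurable
qed

lemma bernstein_eq:
  assumes "complete_bernstein_pair \<Phi> \<mu>" "u > 0"
  shows "\<Phi> u = (\<integral>t. (1 - exp (- u * t)) * (indicator {0<..} t * \<mu> t) \<partial>lborel)"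
  using assms by (simp add: complete_bernstein_pair_def set_lebesgue_integral_def mult_ac)

lemma bernstein_nonneg:
  assumes "complete_bernstein_pair \<Phi> \<mu>" "u > 0"
  shows "\<Phi> u \<ge> 0"
  unfolding bernstein_eq[OF assms]
proof (intro Bochner_Integration.integral_nonneg)
  have "completely_monotone \<mu>" using assms by (auto simp: complete_bernstein_pair_def)
  then show "0 \<le> (1 - exp (- u * t)) * (indicator {0<..} t * \<mu> t)" for t
    using completely_monotone_nonneg[of \<mu> t] assms(2) by (cases "t > 0") auto
qed

text \<open>
  The Laplace exponent of the rescaled density is $\Phi(u/r^2)/\Phi(1/r^2)$.
\<close>

lemma levy_density_family_rescaled:
  assumes B: "complete_bernstein_pair \<Phi> \<mu>" and a: "0 < a" "a < 1"
    and lim: "\<And>u. u > 0 \<Longrightarrow> ((\<lambda>r. \<Phi> (u / r\<^sup>2) / \<Phi> (1 / r\<^sup>2)) \<longlongrightarrow> u powr a) at_top"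
  shows "levy_density_family (rescaled_density \<Phi> \<mu>) a"
proof
  have cm: "completely_monotone \<mu>" using B by (auto simp: complete_bernstein_pair_def)
  note [measurable] = completely_monotone_measurable[OF cm]
  define m where "m t = indicator {0<..} t * \<mu> t" for t
  have [measurable]: "m \<in> borel_measurable borel" unfolding m_def by measurable
  have nu: "rescaled_density \<Phi> \<mu> r t = r\<^sup>2 / \<Phi> (1 / r\<^sup>2) * m (0 + r\<^sup>2 * t)" for r t
    by (simp add: rescaled_density_def m_def)
  have \<Phi>: "\<Phi> (1 / r\<^sup>2) \<ge> 0" if "r \<noteq> 0" for r using that bernstein_nonneg[OF B] by simp
  have coeff: "r\<^sup>2 / \<Phi> (1 / r\<^sup>2) \<ge> 0" for r
    using \<Phi>[of r] by (cases "r = 0") auto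
  have m: "m t \<ge> 0" "t \<le> 0 \<Longrightarrow> m t = 0" for t
    using completely_monotone_nonneg[OF cm, of t] by (auto simp: m_def indicator_def)
  show "rescaled_density \<Phi> \<mu> r \<in> borel_measurable borel" for r
    unfolding nu[abs_def] by measurable
  show "rescaled_density \<Phi> \<mu> r t = 0" if "t \<le> 0" for r t
    using that unfolding nu by (subst m(2)) (auto simp: mult_nonneg_nonpos)
  show "rescaled_density \<Phi> \<mu> r t \<ge> 0" for r t
    unfolding nu by (intro mult_nonneg_nonneg coeff m)
  show "rescaled_density \<Phi> \<mu> r t \<le> rescaled_density \<Phi> \<mu> r s" if "0 < s" "s \<le> t" for r s t
  proof (cases "r = 0")
    case False
    then have "m (0 + r\<^sup>2 * t) \<le> m (0 + r\<^sup>2 * s)"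
      using that by (auto simp: m_def intro!: completely_monotone_antimono[OF cm] mult_left_mono)
    then show ?thesis unfolding nu by (intro mult_left_mono coeff)
  qed (simp add: rescaled_density_def)
  have scaled: "integrable lborel (\<lambda>t. (1 - exp (- u * t)) * rescaled_density \<Phi> \<mu> r t)"
    "(\<integral>t. (1 - exp (- u * t)) * rescaled_density \<Phi> \<mu> r t \<partial>lborel) = \<Phi> (u / r\<^sup>2) / \<Phi> (1 / r\<^sup>2)"
    if u: "u > 0" and r: "r \<noteq> 0" for u r
  proof -
    let ?g = "\<lambda>s. (1 - exp (- (u / r\<^sup>2) * s)) * m s"
    have "u / r\<^sup>2 > 0" using u r by simp
    then have g: "integrable lborel ?g" "integral\<^sup>L lborel ?g = \<Phi> (u / r\<^sup>2)"
      unfolding m_def by (auto simp only: bernstein_integrable[OF B] bernstein_eq[OF B])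
    have e: "(1 - exp (- u * t)) * rescaled_density \<Phi> \<mu> r t = (r\<^sup>2 / \<Phi> (1 / r\<^sup>2)) * ?g (0 + r\<^sup>2 * t)" for t
      unfolding nu using r by (simp add: mult_ac)
    have i: "integrable lborel (\<lambda>t. ?g (0 + r\<^sup>2 * t))"
      by (rule lborel_integrable_real_affine[OF g(1)]) (use r in auto)
    have "integral\<^sup>L lborel ?g = \<bar>r\<^sup>2\<bar> *\<^sub>R (\<integral>t. ?g (0 + r\<^sup>2 * t) \<partial>lborel)"
      by (rule lborel_integral_real_affine) (use r in auto)
    then have v: "(\<integral>t. ?g (0 + r\<^sup>2 * t) \<partial>lborel) = \<Phi> (u / r\<^sup>2) / r\<^sup>2"
      unfolding g(2) using r by simp
    show "integrable lborel (\<lambda>t. (1 - exp (- u * t)) * rescaled_density \<Phi> \<mu> r t)"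
      unfolding e using i by (rule integrable_mult_right)
    show "(\<integral>t. (1 - exp (- u * t)) * rescaled_density \<Phi> \<mu> r t \<partial>lborel) = \<Phi> (u / r\<^sup>2) / \<Phi> (1 / r\<^sup>2)"
      unfolding e integral_mult_right_zero v using r by simp
  qed
  show "integrable lborel (\<lambda>t. (1 - exp (- u * t)) * rescaled_density \<Phi> \<mu> r t)" if "u > 0" for u r
    using scaled(1)[OF that, of r] by (cases "r = 0") (auto simp: rescaled_density_def)
  show "((\<lambda>r. \<integral>t. (1 - exp (- u * t)) * rescaled_density \<Phi> \<mu> r t \<partial>lborel) \<longlongrightarrow> u powr a) at_top"
    if "u > 0" for u
  proof (rule Lim_transform_eventually[OF lim[OF that]])
    show "\<forall>\<^sub>F r in at_top. \<Phi> (u / r\<^sup>2) / \<Phi> (1 / r\<^sup>2) =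
        (\<integral>t. (1 - exp (- u * t)) * rescaled_density \<Phi> \<mu> r t \<partial>lborel)"
      using eventually_gt_at_top[of 0] by eventually_elim (use scaled(2)[OF that] in auto)
  qed
qed (use a in auto)

lemma jump_kernel_scaled:
  assumes B: "complete_bernstein_pair \<Phi> \<mu>" and r: "r > 0" and \<Phi>: "\<Phi> (1 / r\<^sup>2) > 0"
  shows "jump_kernel d \<mu> (r * s) =
    (4 * pi) powr (- real d / 2) * \<Phi> (1 / r\<^sup>2) * r powr (- real d) * subordinate d (rescaled_density \<Phi> \<mu> r) s"
proof -
  have cm: "completely_monotone \<mu>" using B by (auto simp: complete_bernstein_pair_def)
  note [measurable] = completely_monotone_measurable[OF cm]
  let ?m = "\<lambda>t. indicator {0<..} t * \<mu> t"
  let ?f = "\<lambda>t. t powr (- real d / 2) * exp (- ((r * s)\<^sup>2) / (4 * t)) * ?m t"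
  have [measurable]: "?f \<in> borel_measurable borel" by measurable
  have "(LBINT t:{0<..}. t powr (- real d / 2) * exp (- ((r * s)\<^sup>2) / (4 * t)) * \<mu> t) = (\<integral>t. ?f t \<partial>lborel)"
    unfolding set_lebesgue_integral_def by (intro Bochner_Integration.integral_cong) (auto simp: mult_ac)
  also have "\<dots> = \<bar>r\<^sup>2\<bar> *\<^sub>R (\<integral>t. ?f (0 + r\<^sup>2 * t) \<partial>lborel)"
    by (rule lborel_integral_real_affine) (use r in auto)
  also have "\<dots> = (\<integral>t. r\<^sup>2 * ?f (r\<^sup>2 * t) \<partial>lborel)"
    by simp
  also have "(\<lambda>t. r\<^sup>2 * ?f (r\<^sup>2 * t)) =
      (\<lambda>t. \<Phi> (1 / r\<^sup>2) * r powr (- real d) * (heat_profile d s t * rescaled_density \<Phi> \<mu> r t))"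
  proof
    fix t
    have sq: "(r\<^sup>2) powr b = r powr (2 * b)" for b
    proof -
      have "r\<^sup>2 = r powr 2" using r by simp
      then show ?thesis by (simp add: powr_powr)
    qed
    have "(r * s)\<^sup>2 / (4 * (r\<^sup>2 * t)) = s\<^sup>2 / (4 * t)"
      using r by (simp add: power_mult_distrib)
    then show "r\<^sup>2 * ?f (r\<^sup>2 * t) =
      \<Phi> (1 / r\<^sup>2) * r powr (- real d) * (heat_profile d s t * rescaled_density \<Phi> \<mu> r t)"
      using r \<Phi> by (simp add: heat_profile_def rescaled_density_def powr_mult sq indicator_def zero_less_mult_iff)
  qed
  finally show ?thesis
    by (simp add: jump_kernel_def subordinate_def)
qed

text \<open>
  Write $\Phi(v) = F(v)\,v^a\,l(v)$ with $F(v)\to1$. In the quotient the powers leave $u^a$, and the quotient of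
  the slowly varying factors tends to $1$.
\<close>

lemma exponent_ratio_tendsto:
  assumes l: "slowly_varying_at_zero l"
    and \<Phi>: "\<Phi> \<sim>[at_right 0] (\<lambda>u. u powr a * l u)" and u: "u > 0"
  shows "((\<lambda>r. \<Phi> (u / r\<^sup>2) / \<Phi> (1 / r\<^sup>2)) \<longlongrightarrow> u powr a) at_top"
    and "\<forall>\<^sub>F r in at_top. \<Phi> (1 / r\<^sup>2) > 0"
proof -
  define F where "F v = \<Phi> v / (v powr a * l v)" for v
  have lpos: "l v > 0" if "v > 0" for v using l that by (simp add: slowly_varying_at_zero_def)
  have F: "(F \<longlongrightarrow> 1) (at_right 0)"
    unfolding F_def
  proof (rule asymp_equivD_strong[OF \<Phi>])
    show "\<forall>\<^sub>F v in at_right 0. \<Phi> v \<noteq> 0 \<or> v powr a * l v \<noteq> 0"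
      using eventually_at_right_less[of 0] by eventually_elim (use lpos in force)
  qed
  have sq: "filterlim (\<lambda>r::real. r\<^sup>2) at_top at_top"
    by (intro filterlim_pow_at_top filterlim_ident) auto
  have to0: "filterlim (\<lambda>r. v / r\<^sup>2) (at_right 0) at_top" if "v > 0" for v :: real
  proof -
    have "((\<lambda>r. v / r\<^sup>2) \<longlongrightarrow> 0) at_top"
      by (intro real_tendsto_divide_at_top[OF tendsto_const sq])
    moreover have "\<forall>\<^sub>F r::real in at_top. v / r\<^sup>2 > 0"
      using eventually_gt_at_top[of 0] by eventually_elim (use that in simp)
    ultimately show ?thesis
      by (auto simp: filterlim_at elim: eventually_mono)
  qed
  have Fu: "((\<lambda>r. F (v / r\<^sup>2)) \<longlongrightarrow> 1) at_top" if "v > 0" for v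
    by (rule filterlim_compose[OF F to0[OF that]])
  have "((\<lambda>t. l (1 / (1 / u * t)) / l (1 / t)) \<longlongrightarrow> 1) at_top"
    using l u unfolding slowly_varying_at_zero_def by (meson zero_less_divide_1_iff)
  from filterlim_compose[OF this sq]
  have L: "((\<lambda>r. l (u / r\<^sup>2) / l (1 / r\<^sup>2)) \<longlongrightarrow> 1) at_top" by simp
  have "((\<lambda>r. F (u / r\<^sup>2) / F (1 / r\<^sup>2) * u powr a * (l (u / r\<^sup>2) / l (1 / r\<^sup>2))) \<longlongrightarrow> 1 / 1 * u powr a * 1) at_top"
    by (intro tendsto_intros Fu L u) auto
  then have lim: "((\<lambda>r. F (u / r\<^sup>2) / F (1 / r\<^sup>2) * u powr a * (l (u / r\<^sup>2) / l (1 / r\<^sup>2))) \<longlongrightarrow> u powr a) at_top"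
    by simp
  have "\<forall>\<^sub>F r in at_top. F (1 / r\<^sup>2) > 0"
    using order_tendstoD(1)[OF Fu[of 1], of 0] by simp
  then show pos: "\<forall>\<^sub>F r in at_top. \<Phi> (1 / r\<^sup>2) > 0"
    using eventually_gt_at_top[of 0]
  proof eventually_elim
    case (elim r)
    then have "(1 / r\<^sup>2) powr a * l (1 / r\<^sup>2) > 0" using lpos[of "1 / r\<^sup>2"] by simp
    then show ?case using elim(1) unfolding F_def by (simp only: zero_less_divide_iff) auto
  qed
  show "((\<lambda>r. \<Phi> (u / r\<^sup>2) / \<Phi> (1 / r\<^sup>2)) \<longlongrightarrow> u powr a) at_top"
  proof (rule Lim_transform_eventually[OF lim])
    show "\<forall>\<^sub>F r in at_top. F (u / r\<^sup>2) / F (1 / r\<^sup>2) * u powr a * (l (u / r\<^sup>2) / l (1 / r\<^sup>2)) =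
        \<Phi> (u / r\<^sup>2) / \<Phi> (1 / r\<^sup>2)"
      using pos eventually_gt_at_top[of 0]
    proof eventually_elim
      case (elim r)
      define v where "v = 1 / r\<^sup>2"
      have v: "v > 0" "u / r\<^sup>2 = u * v" using elim by (auto simp: v_def)
      have "l v > 0" "l (u * v) > 0" using lpos v u by auto
      then show ?case using v u elim unfolding F_def v(2) v_def[symmetric]
        by (simp add: powr_mult field_simps)
    qed
  qed
qed

section \<open>An upper bound for the integral of the second difference\<close>

text \<open>
  The pointwise form of Hoelder's inequality with exponents $1/\theta$ and $1/(1-\theta)$. When \<open>X\<close>
  and \<open>Y\<close> are the integrals of the two powers, integrating the bracket gives $1$, and Hoelder's inequality
  results. Keeping \<open>X\<close> and \<open>Y\<close> as free constants allows them to be the limits of these integrals.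
\<close>

lemma weighted_Young:
  fixes x y X Y \<theta> :: real
  assumes "x \<ge> 0" "y \<ge> 0" "X > 0" "Y > 0" "0 < \<theta>" "\<theta> < 1"
  shows "x * y \<le> X powr \<theta> * Y powr (1 - \<theta>) *
    (\<theta> / X * x powr (1 / \<theta>) + (1 - \<theta>) / Y * y powr (1 / (1 - \<theta>)))"
proof (cases "x = 0 \<or> y = 0")
  case True
  have "0 \<le> X powr \<theta> * Y powr (1 - \<theta>) *
    (\<theta> / X * x powr (1 / \<theta>) + (1 - \<theta>) / Y * y powr (1 / (1 - \<theta>)))"
    using assms by (intro mult_nonneg_nonneg add_nonneg_nonneg divide_nonneg_pos) auto
  then show ?thesis using True by auto
next
  case False
  then have pos: "x > 0" "y > 0" using assms by auto
  have "(x powr (1 / \<theta>) / X) powr \<theta> * (y powr (1 / (1 - \<theta>)) / Y) powr (1 - \<theta>) \<le>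
      \<theta> * (x powr (1 / \<theta>) / X) + (1 - \<theta>) * (y powr (1 / (1 - \<theta>)) / Y)"
    using assms pos by (intro Youngs_inequality_0) auto
  moreover have "(x powr (1 / \<theta>) / X) powr \<theta> = x / X powr \<theta>"
    "(y powr (1 / (1 - \<theta>)) / Y) powr (1 - \<theta>) = y / Y powr (1 - \<theta>)"
    using assms pos by (simp_all add: powr_divide powr_powr)
  ultimately have "x / X powr \<theta> * (y / Y powr (1 - \<theta>)) \<le>
      \<theta> / X * x powr (1 / \<theta>) + (1 - \<theta>) / Y * y powr (1 / (1 - \<theta>))"
    by simp
  then have "X powr \<theta> * Y powr (1 - \<theta>) * (x / X powr \<theta> * (y / Y powr (1 - \<theta>))) \<le>
    X powr \<theta> * Y powr (1 - \<theta>) *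
    (\<theta> / X * x powr (1 / \<theta>) + (1 - \<theta>) / Y * y powr (1 / (1 - \<theta>)))"
    by (intro mult_left_mono) auto
  then show ?thesis using assms by simp
qed

locale levy_decay = levy_density_family nu a + power_decay_profile \<rho> \<kappa> c
  for nu :: "real \<Rightarrow> real \<Rightarrow> real" and a :: real and \<rho> :: "real \<Rightarrow> real" and \<kappa> c :: real
begin

definition outer_weight :: "'b::euclidean_space itself \<Rightarrow> real \<Rightarrow> real \<Rightarrow> real \<Rightarrow> real" where
  "outer_weight _ t p r =
     (\<integral>y. indicator {t..} (norm (y::'b)) * subordinate DIM('b) (nu r) (norm y) powr p \<partial>lborel)"

definition profile_mass :: "'b::euclidean_space itself \<Rightarrow> real set \<Rightarrow> real \<Rightarrow> real \<Rightarrow> real" where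
  "profile_mass _ S p r =
     (\<integral>z. indicator S (norm (z::'b)) * (\<rho> (r * norm z) / \<rho> r) powr p \<partial>lborel)"

text \<open>
  The bound for the integral over $|y|\ge t$ of a translate by a vector \<open>e\<close> of the rescaled profile
  against the kernel; it does not depend on \<open>e\<close>. The first summand covers $|y-e|<1$, the second comes from
  Young's inequality on $|y-e|\ge1$.
\<close>

definition shifted_bound ::
    "'b::euclidean_space itself \<Rightarrow> real \<Rightarrow> real \<Rightarrow> real \<Rightarrow> real \<Rightarrow> real \<Rightarrow> real" where
  "shifted_bound T t \<theta> X Y r =
     subordinate DIM('b) (nu r) t * profile_mass T {..<1} 1 r +
     X powr \<theta> * Y powr (1 - \<theta>) *
       (\<theta> / X * profile_mass T {1..} (1 / \<theta>) r + (1 - \<theta>) / Y * outer_weight T t (1 / (1 - \<theta>)) r)"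

text \<open>
  On $|y-e|<1$ the kernel is estimated by its value at $t$; on $|y-e|\ge1$ Young's inequality
  separates the profile from the kernel. After that the translation by \<open>e\<close> disappears from the integrals.
\<close>

lemma shifted_bound_le:
  fixes e :: "'b::euclidean_space"
  assumes t: "0 < t" "t < 1" and \<theta>: "0 < \<theta>" "\<theta> < 1" and XY: "X > 0" "Y > 0"
    and near: "integrable lborel (\<lambda>z::'b. indicator {..<1} (norm z) * (\<rho> (r * norm z) / \<rho> r) powr 1)"
    and far: "integrable lborel (\<lambda>z::'b. indicator {1..} (norm z) * (\<rho> (r * norm z) / \<rho> r) powr (1 / \<theta>))"
  shows "integrable lborel (\<lambda>y::'b. indicator {t..} (norm y) *
      (\<rho> (r * norm (y - e)) / \<rho> r * subordinate DIM('b) (nu r) (norm y)))"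
    and "(\<integral>y. indicator {t..} (norm y) *
      (\<rho> (r * norm (y - e)) / \<rho> r * subordinate DIM('b) (nu r) (norm y)) \<partial>lborel)
      \<le> shifted_bound TYPE('b) t \<theta> X Y r"
proof -
  let ?J = "\<lambda>s. subordinate DIM('b) (nu r) s" and ?R = "\<lambda>s. \<rho> (r * s) / \<rho> r"
  let ?near = "\<lambda>z::'b. indicator {..<1} (norm z) * ?R (norm z) powr 1"
  let ?far = "\<lambda>z::'b. indicator {1..} (norm z) * ?R (norm z) powr (1 / \<theta>)"
  let ?out = "\<lambda>y::'b. indicator {t..} (norm y) * ?J (norm y) powr (1 / (1 - \<theta>))"
  let ?f = "\<lambda>y::'b. indicator {t..} (norm y) * (?R (norm (y - e)) * ?J (norm y))"
  let ?C = "X powr \<theta> * Y powr (1 - \<theta>)"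
  let ?g = "\<lambda>y. ?J t * ?near (y - e) + ?C * (\<theta> / X * ?far (y - e) + (1 - \<theta>) / Y * ?out y)"
  have J: "?J s \<ge> 0" for s by (simp add: subordinate_nonneg levy_density_nu)
  have R: "?R s > 0" for s using rho_pos by simp
  have out: "integrable lborel ?out"
    using \<theta> by (intro outer_powr_integrable t) simp
  have near': "integrable lborel (\<lambda>y. ?near (y - e))"
    and near'': "(\<integral>y. ?near (y - e) \<partial>lborel) = integral\<^sup>L lborel ?near"
    by (rule lborel_integral_translate[OF near])+
  have far': "integrable lborel (\<lambda>y. ?far (y - e))"
    and far'': "(\<integral>y. ?far (y - e) \<partial>lborel) = integral\<^sup>L lborel ?far"
    by (rule lborel_integral_translate[OF far])+
  have g: "integrable lborel ?g"
    by (intro Bochner_Integration.integrable_add integrable_mult_right near' far' out)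
  have fg: "?f y \<le> ?g y" "0 \<le> ?f y" for y
  proof -
    show "0 \<le> ?f y" by (intro mult_nonneg_nonneg J less_imp_le[OF R]) simp
    have nn: "0 \<le> ?J t * ?near (y - e)"
      "0 \<le> ?C * (\<theta> / X * ?far (y - e) + (1 - \<theta>) / Y * ?out y)"
      using J \<theta> XY by (auto intro!: mult_nonneg_nonneg add_nonneg_nonneg)
    show "?f y \<le> ?g y"
    proof (cases "norm y \<ge> t")
      case True
      show ?thesis
      proof (cases "norm (y - e) < 1")
        case True
        have "?R (norm (y - e)) * ?J (norm y) \<le> ?R (norm (y - e)) * ?J t"
          using R[of "norm (y - e)"] t \<open>norm y \<ge> t\<close>
          by (intro mult_left_mono subordinate_antimono levy_density_nu) auto
        then have "?f y \<le> ?J t * ?near (y - e)"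
          using True \<open>norm y \<ge> t\<close> rho_pos[of r] rho_pos[of "r * norm (y - e)"]
          by (simp add: mult.commute)
        then show ?thesis using nn by linarith
      next
        case False
        have "?R (norm (y - e)) * ?J (norm y) \<le> ?C *
          (\<theta> / X * ?R (norm (y - e)) powr (1 / \<theta>) + (1 - \<theta>) / Y * ?J (norm y) powr (1 / (1 - \<theta>)))"
          using weighted_Young[OF less_imp_le[OF R] J XY \<theta>] .
        then have "?f y \<le> ?C * (\<theta> / X * ?far (y - e) + (1 - \<theta>) / Y * ?out y)"
          using False \<open>norm y \<ge> t\<close> by simp
        then show ?thesis using nn by linarith
      qed
    qed (use nn in simp)
  qed
  show f: "integrable lborel ?f"
  proof (rule Bochner_Integration.integrable_bound[OF g])
    show "AE y in lborel. norm (?f y) \<le> norm (?g y)"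
      using fg by (intro AE_I2) (smt (verit) real_norm_def)
    show "?f \<in> borel_measurable lborel" by measurable
  qed
  have "integral\<^sup>L lborel ?f \<le> integral\<^sup>L lborel ?g"
    by (intro integral_mono f g fg)
  also have "\<dots> = shifted_bound TYPE('b) t \<theta> X Y r"
    unfolding shifted_bound_def profile_mass_def outer_weight_def near''[symmetric] far''[symmetric]
    by (simp only: Bochner_Integration.integral_add integral_mult_right_zero
        Bochner_Integration.integrable_add integrable_mult_right near' far' out)
  finally show "integral\<^sup>L lborel ?f \<le> shifted_bound TYPE('b) t \<theta> X Y r" .
qed

text \<open>
  The exponent $1/\theta=(d+\eta)/(2\kappa)$ turns the limit profile $s^{-2\kappa}$ into $s^{-d-\eta}$, which is
  integrable at infinity. \<open>X\<close> and \<open>Y\<close> are chosen as the limits of the two integrals in Young's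
  inequality, so the bracket that multiplies $X^\theta Y^{1-\theta}$ tends to $1$.
\<close>

lemma shifted_bound_tendsto:
  fixes t \<eta> \<theta> X Y :: real
  defines "d \<equiv> real DIM('b::euclidean_space)" and "\<omega> \<equiv> sphere_area TYPE('b)"
    and "K \<equiv> subordinate DIM('b) (stable_density a) 1"
  assumes t: "0 < t" "t < 1" and \<kappa>d: "2 * \<kappa> < d" and \<eta>: "\<eta> > 0"
    and \<theta>_def: "\<theta> = 2 * \<kappa> / (d + \<eta>)" and X_def: "X = \<omega> / \<eta>"
    and Y_def: "Y = K powr (1 / (1 - \<theta>)) *
      (\<omega> * (t powr (d - (d + 2 * a) * (1 / (1 - \<theta>))) / ((d + 2 * a) * (1 / (1 - \<theta>)) - d)))"
  shows "(shifted_bound TYPE('b) t \<theta> X Y \<longlongrightarrow>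
      K * t powr (- (d + 2 * a)) * (\<omega> / (d - 2 * \<kappa>)) + X powr \<theta> * Y powr (1 - \<theta>)) at_top"
    and "\<forall>\<^sub>F r in at_top. integrable lborel (\<lambda>z::'b. indicator {..<1} (norm z) * (\<rho> (r * norm z) / \<rho> r) powr 1)"
    and "\<forall>\<^sub>F r in at_top. integrable lborel (\<lambda>z::'b. indicator {1..} (norm z) * (\<rho> (r * norm z) / \<rho> r) powr (1 / \<theta>))"
    and "0 < \<theta>" "\<theta> < 1" "X > 0" "Y > 0"
proof -
  have d: "d > 0" by (simp add: d_def)
  have \<omega>: "\<omega> > 0" unfolding \<omega>_def by (rule sphere_area_pos)
  have K: "K > 0" unfolding K_def by (rule subordinate_stable_pos) simp
  show \<theta>: "0 < \<theta>" "\<theta> < 1" unfolding \<theta>_def using kappa d \<eta> \<kappa>d by auto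
  show X: "X > 0" unfolding X_def using \<omega> \<eta> by simp
  have p: "1 / (1 - \<theta>) \<ge> 1" using \<theta> by simp
  have "d * 1 < (d + 2 * a) * (1 / (1 - \<theta>))"
    using a d p by (intro mult_less_le_imp_less) auto
  then have bp: "(d + 2 * a) * (1 / (1 - \<theta>)) - d > 0" by simp
  show Y: "Y > 0" unfolding Y_def using K \<omega> t bp by (intro mult_pos_pos divide_pos_pos) auto
  have near: "has_bochner_integral lborel
      (\<lambda>z::'b. indicator {..<1} (norm z) * norm z powr (- (2 * \<kappa> * 1))) (\<omega> / (d - 2 * \<kappa>))"
    using has_bochner_integral_norm_powr_inside[of "2 * \<kappa>" 1, where 'a='b] \<kappa>d
    by (simp add: d_def \<omega>_def)
  have "2 * \<kappa> * (1 / \<theta>) = d + \<eta>" using kappa d \<eta> by (simp add: \<theta>_def)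
  then have far: "has_bochner_integral lborel
      (\<lambda>z::'b. indicator {1..} (norm z) * norm z powr (- (2 * \<kappa> * (1 / \<theta>)))) X"
    using has_bochner_integral_norm_powr_outside[of "d + \<eta>" 1, where 'a='b] \<eta>
    by (simp add: d_def \<omega>_def X_def)
  show "\<forall>\<^sub>F r in at_top. integrable lborel (\<lambda>z::'b. indicator {..<1} (norm z) * (\<rho> (r * norm z) / \<rho> r) powr 1)"
    by (rule ratio_integral_tendsto(2)[OF _ _ near]) auto
  show "\<forall>\<^sub>F r in at_top. integrable lborel (\<lambda>z::'b. indicator {1..} (norm z) * (\<rho> (r * norm z) / \<rho> r) powr (1 / \<theta>))"
    by (rule ratio_integral_tendsto(2)[OF _ _ far]) (use \<theta> in auto)
  have lims: "(profile_mass TYPE('b) {..<1} 1 \<longlongrightarrow> \<omega> / (d - 2 * \<kappa>)) at_top"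
    "(profile_mass TYPE('b) {1..} (1 / \<theta>) \<longlongrightarrow> X) at_top"
    "(outer_weight TYPE('b) t (1 / (1 - \<theta>)) \<longlongrightarrow> Y) at_top"
    unfolding profile_mass_def[abs_def] outer_weight_def[abs_def]
    using ratio_integral_tendsto(1)[OF _ _ near] ratio_integral_tendsto(1)[OF _ _ far]
      outer_powr_tendsto[OF t p, where 'b='b] \<theta>
    by (simp_all add: Y_def K_def \<omega>_def d_def)
  have J: "((\<lambda>r. subordinate DIM('b) (nu r) t) \<longlongrightarrow> K * t powr (- (d + 2 * a))) at_top"
    using subordinate_tendsto[of "DIM('b)" t] subordinate_stable[of t "DIM('b)"] t by (simp add: K_def d_def)
  have "((\<lambda>r. shifted_bound TYPE('b) t \<theta> X Y r) \<longlongrightarrow>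
      K * t powr (- (d + 2 * a)) * (\<omega> / (d - 2 * \<kappa>)) +
      X powr \<theta> * Y powr (1 - \<theta>) * (\<theta> / X * X + (1 - \<theta>) / Y * Y)) at_top"
    unfolding shifted_bound_def by (intro tendsto_add tendsto_mult tendsto_const lims J)
  moreover have "\<theta> / X * X + (1 - \<theta>) / Y * Y = 1" using X Y by simp
  ultimately show "(shifted_bound TYPE('b) t \<theta> X Y \<longlongrightarrow>
      K * t powr (- (d + 2 * a)) * (\<omega> / (d - 2 * \<kappa>)) + X powr \<theta> * Y powr (1 - \<theta>)) at_top"
    by simp
qed

text \<open>
  With $e = x/r$ one has $|x\pm ry| = r|y\pm e|$, so for $|y|\ge t$ the second difference consists of
  translates of the profile by $e$ and $-e$ and the constant $-2\rho(r)$. For $|y|<t$ the quadratic bound applies.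
\<close>

lemma second_diff_integral_le:
  fixes x :: "'b::euclidean_space"
  defines "r \<equiv> norm x"
  assumes r: "r > 0" and \<phi>: "\<And>x. \<phi> x = \<rho> (norm x)"
    and t: "0 < t" "t < 1" and \<theta>: "0 < \<theta>" "\<theta> < 1" and XY: "X > 0" "Y > 0"
    and L: "\<And>h. norm h < t * r \<Longrightarrow> \<bar>second_diff h \<phi> x\<bar> \<le> L * (norm h)\<^sup>2"
    and near: "integrable lborel (\<lambda>z::'b. indicator {..<1} (norm z) * (\<rho> (r * norm z) / \<rho> r) powr 1)"
    and far: "integrable lborel (\<lambda>z::'b. indicator {1..} (norm z) * (\<rho> (r * norm z) / \<rho> r) powr (1 / \<theta>))"
  shows "integrable lborel (\<lambda>y. second_diff (r *\<^sub>R y) \<phi> x * subordinate DIM('b) (nu r) (norm y))"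
    and "(\<integral>y. second_diff (r *\<^sub>R y) \<phi> x * subordinate DIM('b) (nu r) (norm y) \<partial>lborel) / \<rho> r \<le>
      L * r\<^sup>2 / \<rho> r * (\<integral>y. indicator {..<t} (norm (y::'b)) *
          ((norm y)\<^sup>2 * subordinate DIM('b) (nu r) (norm y)) \<partial>lborel)
      + 2 * shifted_bound TYPE('b) t \<theta> X Y r - 2 * outer_weight TYPE('b) t 1 r"
proof -
  let ?J = "\<lambda>s. subordinate DIM('b) (nu r) s" and ?R = "\<lambda>s. \<rho> (r * s) / \<rho> r"
  let ?D = "\<lambda>y. second_diff (r *\<^sub>R y) \<phi> x"
  define e where "e = x /\<^sub>R r"
  let ?in = "\<lambda>y::'b. indicator {..<t} (norm y) * ((norm y)\<^sup>2 * ?J (norm y))"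
  let ?out = "\<lambda>y::'b. indicator {t..} (norm y) * ?J (norm y) powr 1"
  let ?s = "\<lambda>e y::'b. indicator {t..} (norm y) * (?R (norm (y - e)) * ?J (norm y))"
  have J: "?J s \<ge> 0" for s by (simp add: subordinate_nonneg levy_density_nu)
  have x: "x = r *\<^sub>R e" using r by (simp add: e_def)
  have D: "?D y = \<rho> (r * norm (y + e)) - 2 * \<rho> r + \<rho> (r * norm (y - e))" for y
  proof -
    have "x + r *\<^sub>R y = r *\<^sub>R (y + e)" "x - r *\<^sub>R y = - (r *\<^sub>R (y - e))"
      unfolding x by (simp_all add: algebra_simps)
    then have "norm (x + r *\<^sub>R y) = r * norm (y + e)" "norm (x - r *\<^sub>R y) = r * norm (y - e)"
      using r by simp_all
    then show ?thesis by (simp add: second_diff_def \<phi> r_def)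
  qed
  have [measurable]: "?D \<in> borel_measurable borel" unfolding D[abs_def] by measurable
  have inner: "\<bar>?D y\<bar> \<le> L * r\<^sup>2 * (norm y)\<^sup>2" if "norm y < t" for y
    using L[of "r *\<^sub>R y"] that r by (simp add: power_mult_distrib mult.assoc)
  have outer: "\<bar>?D y\<bar> \<le> 4 * \<rho> 0" for y
  proof -
    have "\<rho> s \<le> \<rho> 0" if "s \<ge> 0" for s using that rho_antimono by (auto simp: antimono_def)
    from this[of "r * norm (y + e)"] this[of "r * norm (y - e)"] this[of r]
    show ?thesis unfolding D using r rho_pos[of "r * norm (y + e)"] rho_pos[of "r * norm (y - e)"] rho_pos[of r]
      by (auto simp: abs_le_iff)
  qed
  show int: "integrable lborel (\<lambda>y. ?D y * ?J (norm y))"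
  proof (rule Bochner_Integration.integrable_bound)
    let ?M = "max \<bar>L * r\<^sup>2\<bar> (4 * \<rho> 0 / t\<^sup>2)"
    show "integrable lborel (\<lambda>y::'b. ?M * (min 1 ((norm y)\<^sup>2) * ?J (norm y)))"
      using subordinate_moment[OF levy_density_nu, where 'a='b] by (simp add: has_bochner_integral_iff)
    have "\<bar>?D y\<bar> \<le> ?M * min 1 ((norm y)\<^sup>2)" for y
    proof (cases "norm y < t")
      case True
      then have "(norm y)\<^sup>2 \<le> 1" using t by (intro power_le_one) auto
      then have m: "min 1 ((norm y)\<^sup>2) = (norm y)\<^sup>2" by simp
      have "\<bar>?D y\<bar> \<le> L * r\<^sup>2 * (norm y)\<^sup>2" by (rule inner[OF True])
      also have "\<dots> \<le> ?M * (norm y)\<^sup>2" by (intro mult_right_mono) auto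
      finally show ?thesis unfolding m .
    next
      case False
      then have "t\<^sup>2 \<le> min 1 ((norm y)\<^sup>2)" using t by (auto simp: power_le_one power_mono)
      have "\<bar>?D y\<bar> \<le> 4 * \<rho> 0 / t\<^sup>2 * t\<^sup>2" using outer[of y] t by simp
      also have "\<dots> \<le> ?M * min 1 ((norm y)\<^sup>2)"
        using \<open>t\<^sup>2 \<le> _\<close> by (intro mult_mono) auto
      finally show ?thesis .
    qed
    then have "\<bar>?D y * ?J (norm y)\<bar> \<le> ?M * (min 1 ((norm y)\<^sup>2) * ?J (norm y))" for y
      using J[of "norm y"] mult_right_mono[of "\<bar>?D y\<bar>" "?M * min 1 ((norm y)\<^sup>2)" "?J (norm y)"]
      by (simp add: abs_mult mult.assoc)
    then have "norm (?D y * ?J (norm y)) \<le> norm (?M * (min 1 ((norm y)\<^sup>2) * ?J (norm y)))" for y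
      using abs_ge_self order_trans unfolding real_norm_def by blast
    then show "AE y in lborel. norm (?D y * ?J (norm y)) \<le> norm (?M * (min 1 ((norm y)\<^sup>2) * ?J (norm y)))"
      by simp
  qed measurable
  have i1: "integrable lborel ?in" by (rule inner_second_moment_integrable[OF t])
  have i2: "integrable lborel ?out" by (rule outer_powr_integrable[OF t]) simp
  note i3 = shifted_bound_le(1)[OF t \<theta> XY near far]
  have le: "?D y * ?J (norm y) / \<rho> r \<le>
      L * r\<^sup>2 / \<rho> r * ?in y + (?s e y + ?s (- e) y) - 2 * ?out y" for y
  proof (cases "norm y < t")
    case True
    have "?D y \<le> L * r\<^sup>2 * (norm y)\<^sup>2" using inner[OF True] by linarith
    then have "?D y * (?J (norm y) / \<rho> r) \<le> L * r\<^sup>2 * (norm y)\<^sup>2 * (?J (norm y) / \<rho> r)"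
      using J[of "norm y"] rho_pos[of r] by (intro mult_right_mono) auto
    then show ?thesis using True by (simp add: mult_ac)
  next
    case False
    have "?D y * ?J (norm y) / \<rho> r = ?R (norm (y - e)) * ?J (norm y) + ?R (norm (y - - e)) * ?J (norm y)
        - 2 * ?J (norm y)"
      unfolding D using rho_pos[of r] by (simp add: field_simps)
    then show ?thesis using False J[of "norm y"] by simp
  qed
  have "(\<integral>y. ?D y * ?J (norm y) \<partial>lborel) / \<rho> r = (\<integral>y. ?D y * ?J (norm y) / \<rho> r \<partial>lborel)"
    by simp
  also have "\<dots> \<le> (\<integral>y. L * r\<^sup>2 / \<rho> r * ?in y + (?s e y + ?s (- e) y) - 2 * ?out y \<partial>lborel)"
    by (intro integral_mono le Bochner_Integration.integrable_add Bochner_Integration.integrable_diff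
        integrable_mult_right integrable_divide int i1 i2 i3)
  also have "\<dots> = L * r\<^sup>2 / \<rho> r * integral\<^sup>L lborel ?in
      + (integral\<^sup>L lborel (?s e) + integral\<^sup>L lborel (?s (- e))) - 2 * outer_weight TYPE('b) t 1 r"
    unfolding outer_weight_def
    by (simp only: Bochner_Integration.integral_add Bochner_Integration.integral_diff integral_mult_right_zero
        Bochner_Integration.integrable_add Bochner_Integration.integrable_diff integrable_mult_right i1 i2 i3)
  finally show "(\<integral>y. ?D y * ?J (norm y) \<partial>lborel) / \<rho> r \<le>
      L * r\<^sup>2 / \<rho> r * integral\<^sup>L lborel ?in + 2 * shifted_bound TYPE('b) t \<theta> X Y r
      - 2 * outer_weight TYPE('b) t 1 r"
    using shifted_bound_le(2)[OF t \<theta> XY near far, of e] shifted_bound_le(2)[OF t \<theta> XY near far, of "- e"]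
    by linarith
qed

end

section \<open>The limiting bound in terms of $H_-$\<close>

text \<open>
  The right-hand side is the mass of $s^{-\alpha-1}ds$ on $(t,\infty)$, and the first summand on the left is
  its mass on $(1+t,\infty)$. The density is decreasing, so the mass on $(t,1+t)$ is at
  least $(1-t)(2-t)^{-\alpha-1}$, and this dominates the second summand for every \<open>d\<close>.
\<close>

lemma tail_mass_ge:
  fixes t \<alpha> :: real and d :: nat
  assumes t: "0 < t" "t < 1" and \<alpha>: "\<alpha> > 0" and d: "d > 0"
  shows "1 / (\<alpha> * (1 + t) powr \<alpha>) + (1 - t) ^ d / (d * (2 - t) powr (d + \<alpha>)) \<le> t powr (- \<alpha>) / \<alpha>"
proof -
  have decr: "(y - x) * y powr (- \<alpha> - 1) \<le> x powr (- \<alpha>) / \<alpha> - y powr (- \<alpha>) / \<alpha>"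
    if xy: "0 < x" "x < y" for x y :: real
  proof -
    have "\<exists>z>x. z < y \<and> y powr (- \<alpha>) - x powr (- \<alpha>) = (y - x) * (- \<alpha> * z powr (- \<alpha> - 1))"
      using xy by (intro MVT2) (auto intro!: derivative_eq_intros)
    then obtain z where z: "x < z" "z < y"
      "y powr (- \<alpha>) - x powr (- \<alpha>) = (y - x) * (- \<alpha> * z powr (- \<alpha> - 1))" by blast
    have "(y - x) * y powr (- \<alpha> - 1) \<le> (y - x) * z powr (- \<alpha> - 1)"
      using xy z \<alpha> by (intro mult_left_mono powr_mono2') auto
    also have "\<dots> = x powr (- \<alpha>) / \<alpha> - y powr (- \<alpha>) / \<alpha>"
      using z(3) \<alpha> by (simp add: field_simps)
    finally show ?thesis .
  qed
  have main: "(1 - t) * (2 - t) powr (- \<alpha> - 1) \<le> t powr (- \<alpha>) / \<alpha> - (1 + t) powr (- \<alpha>) / \<alpha>"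
  \<comment> \<open>For $t\le\frac12$ the whole interval $(t,1+t)$ lies below $2-t$ and has length $1$; otherwise the
      shorter interval $(t,2-t)$ is contained in it.\<close>
  proof (cases "t \<le> 1 / 2")
    case True
    have "(1 - t) * (2 - t) powr (- \<alpha> - 1) \<le> 1 * (1 + t) powr (- \<alpha> - 1)"
      using t True \<alpha> by (intro mult_mono powr_mono2') auto
    also have "\<dots> \<le> t powr (- \<alpha>) / \<alpha> - (1 + t) powr (- \<alpha>) / \<alpha>"
      using decr[of t "1 + t"] t by simp
    finally show ?thesis .
  next
    case False
    have "(1 - t) * (2 - t) powr (- \<alpha> - 1) \<le> (2 - t - t) * (2 - t) powr (- \<alpha> - 1)"
      using t by (intro mult_right_mono) auto
    also have "\<dots> \<le> t powr (- \<alpha>) / \<alpha> - (2 - t) powr (- \<alpha>) / \<alpha>"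
      using decr[of t "2 - t"] t by simp
    finally have "(1 - t) * (2 - t) powr (- \<alpha> - 1) \<le> t powr (- \<alpha>) / \<alpha> - (2 - t) powr (- \<alpha>) / \<alpha>" .
    moreover have "(1 + t) powr (- \<alpha>) / \<alpha> \<le> (2 - t) powr (- \<alpha>) / \<alpha>"
      using False t \<alpha> by (intro divide_right_mono powr_mono2') auto
    ultimately show ?thesis by linarith
  qed
  have "(1 - t) ^ d / (d * (2 - t) powr (d + \<alpha>)) \<le> (1 - t) ^ d / (1 * (2 - t) powr (d + \<alpha>))"
    using t d by (intro divide_left_mono mult_right_mono mult_pos_pos) auto
  also have "\<dots> = ((1 - t) / (2 - t)) ^ d * (2 - t) powr (- \<alpha>)"
    using t by (simp add: powr_add powr_realpow power_mult_distrib power_inverse powr_minus divide_inverse)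
  also have "\<dots> \<le> ((1 - t) / (2 - t)) ^ 1 * (2 - t) powr (- \<alpha>)"
    using t d by (intro mult_right_mono power_decreasing) auto
  also have "\<dots> = (1 - t) * (2 - t) powr (- \<alpha> - 1)"
    using t by (simp add: powr_diff)
  finally show ?thesis
    using main t by (simp add: powr_minus field_simps)
qed

text \<open>
  The product of the two limiting norms in Hoelder's inequality is, up to the factor $K\omega$, the third
  term of $H_-$. The powers of $\omega$ combine to $\omega^\theta\omega^{1-\theta}=\omega$, and with
  $m = (d+\alpha)/(1-\theta)-d$ one has $m^{-(1-\theta)} = m^\theta/m$.
\<close>

lemma Hoelder_constant_eq:
  fixes d \<alpha> \<kappa> \<eta> K \<omega> t :: real
  assumes "d > 0" "\<alpha> > 0" "\<kappa> > 0" "2 * \<kappa> < d" "\<eta> > 0" "K > 0" "\<omega> > 0" "t > 0"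
  defines "\<theta> \<equiv> 2 * \<kappa> / (d + \<eta>)"
  defines "X \<equiv> \<omega> / \<eta>"
    and "Y \<equiv> K powr (1 / (1 - \<theta>)) *
      (\<omega> * (t powr (d - (d + \<alpha>) * (1 / (1 - \<theta>))) / ((d + \<alpha>) * (1 / (1 - \<theta>)) - d)))"
  shows "X powr \<theta> * Y powr (1 - \<theta>) = K * \<omega> *
    (((2 * \<kappa> * d + (d + \<eta>) * \<alpha>) / ((d + \<eta> - 2 * \<kappa>) * \<eta>)) powr (2 * \<kappa> / (d + \<eta>))
       * ((d + \<eta> - 2 * \<kappa>) / (2 * d * \<kappa> + (d + \<eta>) * \<alpha>))
       * (1 / t powr ((2 * d * \<kappa> + (d + \<eta>) * \<alpha>) / (d + \<eta>))))"
proof -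
  define q where "q = d + \<eta>"
  define m where "m = (d + \<alpha>) * (1 / (1 - \<theta>)) - d"
  have q: "q > 0" "q - 2 * \<kappa> > 0" using assms by (auto simp: q_def)
  have \<theta>: "0 < \<theta>" "\<theta> < 1" "1 - \<theta> = (q - 2 * \<kappa>) / q"
    using q assms by (auto simp: \<theta>_def q_def field_simps)
  have m: "m = (2 * \<kappa> * d + q * \<alpha>) / (q - 2 * \<kappa>)"
    unfolding m_def \<theta>(3) using q by (simp add: field_simps)
  have m0: "m > 0" unfolding m using q assms by (intro divide_pos_pos add_pos_pos mult_pos_pos) auto
  have m1: "m * (1 - \<theta>) = (2 * d * \<kappa> + q * \<alpha>) / q"
    unfolding m \<theta>(3) using q by (simp add: field_simps)
  have Y: "Y = K powr (1 / (1 - \<theta>)) * (\<omega> * (t powr (- m) / m))"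
    unfolding Y_def m_def by simp
  have "Y powr (1 - \<theta>) = K * (\<omega> powr (1 - \<theta>) * (t powr (- (m * (1 - \<theta>))) / m powr (1 - \<theta>)))"
    unfolding Y using \<open>K > 0\<close> \<theta>(2) by (simp add: powr_mult powr_divide powr_powr)
  then have "X powr \<theta> * Y powr (1 - \<theta>) = K * (\<omega> powr \<theta> * \<omega> powr (1 - \<theta>)) *
      ((1 / \<eta> powr \<theta>) * (1 / m powr (1 - \<theta>)) * t powr (- (m * (1 - \<theta>))))"
    unfolding X_def by (simp add: powr_divide)
  also have "\<omega> powr \<theta> * \<omega> powr (1 - \<theta>) = \<omega>"
    using assms by (simp add: powr_add[symmetric])
  also have "1 / m powr (1 - \<theta>) = m powr \<theta> * (1 / m)"
    using m0 by (simp add: powr_diff)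
  also have "(1 / \<eta> powr \<theta>) * (m powr \<theta> * (1 / m)) = (m / \<eta>) powr \<theta> * (1 / m)"
    by (simp add: powr_divide)
  also have "t powr (- (m * (1 - \<theta>))) = 1 / t powr ((2 * d * \<kappa> + q * \<alpha>) / q)"
    unfolding m1 by (simp add: powr_minus divide_inverse)
  also have "m / \<eta> = (2 * \<kappa> * d + q * \<alpha>) / ((q - 2 * \<kappa>) * \<eta>)"
    unfolding m by simp
  also have "1 / m = (q - 2 * \<kappa>) / (2 * d * \<kappa> + q * \<alpha>)"
    unfolding m by (simp add: mult_ac)
  finally show ?thesis unfolding q_def \<theta>_def by (simp only: mult.assoc)
qed

text \<open>
  The bound for the second difference integral converges to
  $2K\omega$ times the expression obtained from $H_-(t)$ by replacing its negative part by $-t^{-\alpha}/\alpha$.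
  Here \<open>l\<close> stands for $L_\varphi(x)|x|^2/\varphi(x)$, and \<open>\<Lambda>\<close> is its limit.
\<close>

lemma (in levy_decay) upper_bound_tendsto:
  fixes t \<eta> \<theta> X Y \<Lambda> :: real
  defines "d \<equiv> real DIM('b::euclidean_space)" and "\<omega> \<equiv> sphere_area TYPE('b)"
    and "K \<equiv> subordinate DIM('b) (stable_density a) 1"
  assumes t: "0 < t" "t < 1" and \<kappa>d: "2 * \<kappa> < d" and \<eta>: "\<eta> > 0"
    and \<theta>_def: "\<theta> = 2 * \<kappa> / (d + \<eta>)" and X_def: "X = \<omega> / \<eta>"
    and Y_def: "Y = K powr (1 / (1 - \<theta>)) *
      (\<omega> * (t powr (d - (d + 2 * a) * (1 / (1 - \<theta>))) / ((d + 2 * a) * (1 / (1 - \<theta>)) - d)))"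
    and \<Lambda>: "\<Lambda> = 4 * \<kappa> * (2 * \<kappa> + 1) * d\<^sup>2 / (1 - t) powr (2 * \<kappa> + 2)"
    and l: "(l \<longlongrightarrow> \<Lambda>) at_infinity"
    and neg: "H_minus t DIM('b) (2 * a) \<kappa> \<eta> < 0"
  shows "\<forall>\<^sub>F x in at_infinity. l x * (\<integral>y. indicator {..<t} (norm (y::'b)) *
          ((norm y)\<^sup>2 * subordinate DIM('b) (nu (norm x)) (norm y)) \<partial>lborel)
      + 2 * shifted_bound TYPE('b) t \<theta> X Y (norm x) - 2 * outer_weight TYPE('b) t 1 (norm (x::'b)) < 0"
proof -
  have d: "d > 0" "DIM('b) > 0" by (simp_all add: d_def)
  have \<omega>: "\<omega> > 0" unfolding \<omega>_def by (rule sphere_area_pos)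
  have K: "K > 0" unfolding K_def by (rule subordinate_stable_pos) simp
  define third where "third = ((2 * \<kappa> * d + (d + \<eta>) * (2 * a)) / ((d + \<eta> - 2 * \<kappa>) * \<eta>)) powr (2 * \<kappa> / (d + \<eta>))
       * ((d + \<eta> - 2 * \<kappa>) / (2 * d * \<kappa> + (d + \<eta>) * (2 * a)))
       * (1 / t powr ((2 * d * \<kappa> + (d + \<eta>) * (2 * a)) / (d + \<eta>)))"
  have Hoelder: "X powr \<theta> * Y powr (1 - \<theta>) = K * \<omega> * third"
    unfolding X_def Y_def \<theta>_def third_def
    by (rule Hoelder_constant_eq) (use d a kappa \<kappa>d \<eta> K \<omega> t in auto)
  have inner: "((\<lambda>r. \<integral>y. indicator {..<t} (norm (y::'b)) *
      ((norm y)\<^sup>2 * subordinate DIM('b) (nu r) (norm y)) \<partial>lborel) \<longlongrightarrow>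
      K * (\<omega> * (t powr (2 - 2 * a) / (2 - 2 * a)))) at_top"
    unfolding K_def \<omega>_def by (rule inner_second_moment_tendsto[OF t])
  have shifted: "(shifted_bound TYPE('b) t \<theta> X Y \<longlongrightarrow>
      K * t powr (- (d + 2 * a)) * (\<omega> / (d - 2 * \<kappa>)) + X powr \<theta> * Y powr (1 - \<theta>)) at_top"
    using shifted_bound_tendsto(1)[OF t \<kappa>d[unfolded d_def] \<eta> \<theta>_def[unfolded d_def]
        X_def[unfolded \<omega>_def] Y_def[unfolded K_def \<omega>_def d_def]]
    by (simp add: K_def \<omega>_def d_def)
  have outer: "(outer_weight TYPE('b) t 1 \<longlongrightarrow> K * (\<omega> * (t powr (- (2 * a)) / (2 * a)))) at_top"
    using outer_powr_tendsto[OF t, of 1, where 'b='b] K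
    by (simp add: outer_weight_def[abs_def] K_def \<omega>_def)
  have nrm: "filterlim (norm :: 'b \<Rightarrow> real) at_top at_infinity"
    by (rule filterlim_norm_at_top)
  let ?T = "\<Lambda> * (K * (\<omega> * (t powr (2 - 2 * a) / (2 - 2 * a)))) +
      2 * (K * t powr (- (d + 2 * a)) * (\<omega> / (d - 2 * \<kappa>)) + X powr \<theta> * Y powr (1 - \<theta>))
      - 2 * (K * (\<omega> * (t powr (- (2 * a)) / (2 * a))))"
  have lim: "((\<lambda>x. l x * (\<integral>y. indicator {..<t} (norm (y::'b)) *
          ((norm y)\<^sup>2 * subordinate DIM('b) (nu (norm x)) (norm y)) \<partial>lborel)
      + 2 * shifted_bound TYPE('b) t \<theta> X Y (norm x) - 2 * outer_weight TYPE('b) t 1 (norm (x::'b)))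
      \<longlongrightarrow> ?T) at_infinity"
    by (intro tendsto_intros l filterlim_compose[OF inner nrm] filterlim_compose[OF shifted nrm]
        filterlim_compose[OF outer nrm])
  have tail: "1 / ((2 * a) * (1 + t) powr (2 * a)) + (1 - t) ^ DIM('b) / (d * (2 - t) powr (d + 2 * a))
      \<le> t powr (- (2 * a)) / (2 * a)"
    unfolding d_def by (rule tail_mass_ge) (use t a in auto)
  have "?T = 2 * K * \<omega> * (1 / ((d - 2 * \<kappa>) * t powr (d + 2 * a))
      + 2 * \<kappa> * (2 * \<kappa> + 1) * d\<^sup>2 * t powr (2 - 2 * a) / ((2 - 2 * a) * (1 - t) powr (2 * \<kappa> + 2))
      + third - t powr (- (2 * a)) / (2 * a))"
  proof -
    have 1: "\<Lambda> * (K * (\<omega> * (t powr (2 - 2 * a) / (2 - 2 * a)))) = 2 * K * \<omega> *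
        (2 * \<kappa> * (2 * \<kappa> + 1) * d\<^sup>2 * t powr (2 - 2 * a) / ((2 - 2 * a) * (1 - t) powr (2 * \<kappa> + 2)))"
      unfolding \<Lambda> by (simp add: mult_ac)
    have 2: "K * t powr (- (d + 2 * a)) * (\<omega> / (d - 2 * \<kappa>)) =
        K * \<omega> * (1 / ((d - 2 * \<kappa>) * t powr (d + 2 * a)))"
      by (simp add: powr_minus divide_inverse del: minus_add_distrib)
    show ?thesis unfolding 1 2 Hoelder by (simp only: algebra_simps)
  qed
  also have "\<dots> \<le> 2 * K * \<omega> * H_minus t DIM('b) (2 * a) \<kappa> \<eta>"
  proof (intro mult_left_mono)
    have "H_minus t DIM('b) (2 * a) \<kappa> \<eta> = 1 / ((d - 2 * \<kappa>) * t powr (d + 2 * a))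
      + 2 * \<kappa> * (2 * \<kappa> + 1) * d\<^sup>2 * t powr (2 - 2 * a) / ((2 - 2 * a) * (1 - t) powr (2 * \<kappa> + 2))
      + third - (1 / ((2 * a) * (1 + t) powr (2 * a)) + (1 - t) ^ DIM('b) / (d * (2 - t) powr (d + 2 * a)))"
      unfolding H_minus_def third_def d_def ..
    then show "1 / ((d - 2 * \<kappa>) * t powr (d + 2 * a))
      + 2 * \<kappa> * (2 * \<kappa> + 1) * d\<^sup>2 * t powr (2 - 2 * a) / ((2 - 2 * a) * (1 - t) powr (2 * \<kappa> + 2))
      + third - t powr (- (2 * a)) / (2 * a) \<le> H_minus t DIM('b) (2 * a) \<kappa> \<eta>"
      using tail by linarith
  qed (use K \<omega> in auto)
  also have "\<dots> < 0" using K \<omega> neg by (intro mult_pos_neg) auto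
  finally show ?thesis by (rule order_tendstoD(2)[OF lim])
qed

section \<open>Negativity of the potential\<close>

theorem theorem6p3:
  fixes \<Phi> \<mu> l \<rho> :: "real \<Rightarrow> real"
    and \<phi> V :: "'a::euclidean_space \<Rightarrow> real"
    and \<alpha> \<kappa> \<eta> C\<^sub>\<phi> :: real
  assumes "complete_bernstein_pair \<Phi> \<mu>"
    and "square_integrable \<phi>" and "ess_bounded_on UNIV \<phi>" and "\<And>x. \<phi> x > 0"
    and "zero_energy_solution \<Phi> V \<phi>" and "pointwise_potential \<mu> V \<phi>"
    and "\<And>C\<^sub>1. C\<^sub>1 \<in> {0<..<1} \<Longrightarrow> \<phi> \<in> space_Z C\<^sub>1"
    and "0 < \<alpha>" and "\<alpha> < 2" and "slowly_varying_at_zero l"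
    and "\<Phi> \<sim>[at_right 0] (\<lambda>u. u powr (\<alpha> / 2) * l u)"
    and "C\<^sub>\<phi> > 0" and "0 < \<kappa>" and "\<kappa> < DIM('a) / 2"
    and "\<And>r. r \<ge> 0 \<Longrightarrow> \<rho> r \<ge> 0" and "monotone_on {0..} (\<le>) (\<ge>) \<rho>"
    and "\<And>x. \<phi> x = \<rho> (norm x)"
    and "\<rho> \<sim>[at_top] (\<lambda>r. C\<^sub>\<phi> * r powr (- 2 * \<kappa>))"
    and "\<And>C\<^sub>1. C\<^sub>1 \<in> {0<..<1} \<Longrightarrow>
           \<exists>M L. Z_bound C\<^sub>1 \<phi> M L \<and>
             L \<sim>[at_infinity]
               (\<lambda>x. C\<^sub>\<phi> * 4 * \<kappa> * (2 * \<kappa> + 1) * (real DIM('a))\<^sup>2 /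
                 ((1 - C\<^sub>1) powr (2 * \<kappa> + 2) * norm x powr (2 * \<kappa> + 2)))"
    and "\<eta> > 0"
    and "K_minus DIM('a) \<alpha> \<kappa> \<eta> < 0"
  shows "\<exists>R>0. \<forall>x \<in> - ball 0 R. V x < 0"
proof -
  note bern = assms(1) and pos = assms(4) and pot = assms(6) and \<alpha> = assms(8,9)
    and slow = assms(10) and asym\<Phi> = assms(11) and C = assms(12) and \<kappa> = assms(13,14)
    and mono = assms(16) and radial = assms(17) and asym\<rho> = assms(18) and Z = assms(19)
    and \<eta> = assms(20) and Kneg = assms(21)
  define a where "a = \<alpha> / 2"
  have half: "0 < a" "a < 1" "2 * a = \<alpha>" using \<alpha> by (auto simp: a_def)
  define nu where "nu = rescaled_density \<Phi> \<mu>"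
  \<comment> \<open>Extending the profile by a constant to the negative axis makes it decreasing, hence Borel
      measurable, on the whole line.\<close>
  define \<rho>' where "\<rho>' s = \<rho> (max 0 s)" for s
  have \<Phi>pos: "\<forall>\<^sub>F r in at_top. \<Phi> (1 / r\<^sup>2) > 0"
    and \<Phi>lim: "\<And>u. u > 0 \<Longrightarrow> ((\<lambda>r. \<Phi> (u / r\<^sup>2) / \<Phi> (1 / r\<^sup>2)) \<longlongrightarrow> u powr a) at_top"
    using exponent_ratio_tendsto[OF slow asym\<Phi>[folded a_def]] zero_less_one by blast+
  have fam: "levy_density_family nu a"
    unfolding nu_def by (rule levy_density_family_rescaled[OF bern half(1,2) \<Phi>lim])
  have \<phi>: "\<phi> x = \<rho>' (norm x)" for x by (simp add: \<rho>'_def radial)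
  have \<rho>'pos: "\<rho>' s > 0" for s
  proof -
    obtain x :: 'a where "norm x = max 0 s" using vector_choose_size[of "max 0 s"] by auto
    then show ?thesis using pos[of x] radial[of x] by (simp add: \<rho>'_def)
  qed
  have \<rho>'lim: "((\<lambda>s. \<rho>' s / (C\<^sub>\<phi> * s powr (- 2 * \<kappa>))) \<longlongrightarrow> 1) at_top"
  proof (rule Lim_transform_eventually)
    show "((\<lambda>s. \<rho> s / (C\<^sub>\<phi> * s powr (- 2 * \<kappa>))) \<longlongrightarrow> 1) at_top"
    proof (rule asymp_equivD_strong[OF asym\<rho>])
      show "\<forall>\<^sub>F s in at_top. \<rho> s \<noteq> 0 \<or> C\<^sub>\<phi> * s powr (- 2 * \<kappa>) \<noteq> 0"
        using eventually_gt_at_top[of 0] by eventually_elim (use C in auto)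
    qed
    show "\<forall>\<^sub>F s in at_top. \<rho> s / (C\<^sub>\<phi> * s powr (- 2 * \<kappa>)) = \<rho>' s / (C\<^sub>\<phi> * s powr (- 2 * \<kappa>))"
      using eventually_gt_at_top[of 0] by eventually_elim (simp add: \<rho>'_def)
  qed
  have prof: "power_decay_profile \<rho>' \<kappa> C\<^sub>\<phi>"
  proof
    show "antimono \<rho>'"
      using mono by (auto simp: antimono_def monotone_on_def \<rho>'_def)
  qed (use \<rho>'pos \<rho>'lim \<kappa> C in auto)
  interpret levy_decay nu a \<rho>' \<kappa> C\<^sub>\<phi>
    using fam prof by (simp add: levy_decay_def)
  define d where "d = real DIM('a)"
  define \<omega> where "\<omega> = sphere_area TYPE('a)"
  define K where "K = subordinate DIM('a) (stable_density a) 1"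
  have d\<kappa>: "2 * \<kappa> < d" using \<kappa> by (simp add: d_def)
  have "\<exists>t\<in>{0<..<1}. K_minus DIM('a) \<alpha> \<kappa> \<eta> = H_minus t DIM('a) \<alpha> \<kappa> \<eta>"
    using H_minus_attains_min[OF _ \<alpha> \<kappa> \<eta>] by auto
  then obtain t where t: "0 < t" "t < 1" and H: "H_minus t DIM('a) (2 * a) \<kappa> \<eta> < 0"
    using Kneg half(3) by auto
  define \<theta> where "\<theta> = 2 * \<kappa> / (d + \<eta>)"
  define X where "X = \<omega> / \<eta>"
  define Y where "Y = K powr (1 / (1 - \<theta>)) *
      (\<omega> * (t powr (d - (d + 2 * a) * (1 / (1 - \<theta>))) / ((d + 2 * a) * (1 / (1 - \<theta>)) - d)))"
  note sb = shifted_bound_tendsto[OF t d\<kappa>[unfolded d_def] \<eta> \<theta>_def[unfolded d_def] X_def[unfolded \<omega>_def]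
      Y_def[unfolded K_def \<omega>_def d_def]]
  note \<theta> = sb(4,5) and XY = sb(6,7)
  define \<Lambda> where "\<Lambda> = 4 * \<kappa> * (2 * \<kappa> + 1) * d\<^sup>2 / (1 - t) powr (2 * \<kappa> + 2)"
  obtain M L where ZL: "Z_bound t \<phi> M L"
    and L: "L \<sim>[at_infinity] (\<lambda>x. C\<^sub>\<phi> * 4 * \<kappa> * (2 * \<kappa> + 1) * (real DIM('a))\<^sup>2 /
                 ((1 - t) powr (2 * \<kappa> + 2) * norm x powr (2 * \<kappa> + 2)))"
    using Z[of t] t by auto
  define l' where "l' x = L x * (norm x)\<^sup>2 / \<rho>' (norm x)" for x
  have nz: "\<forall>\<^sub>F x::'a in at_infinity. x \<noteq> 0"
    unfolding eventually_at_infinity by (intro exI[of _ 1]) auto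
  have nrm: "filterlim (norm :: 'a \<Rightarrow> real) at_top at_infinity"
    by (rule filterlim_norm_at_top)
  have l': "(l' \<longlongrightarrow> \<Lambda>) at_infinity"
  proof -
    define G where "G x = C\<^sub>\<phi> * 4 * \<kappa> * (2 * \<kappa> + 1) * (real DIM('a))\<^sup>2 /
                 ((1 - t) powr (2 * \<kappa> + 2) * norm x powr (2 * \<kappa> + 2))" for x :: 'a
    have G: "G x > 0" if "x \<noteq> 0" for x using that C \<kappa> t by (simp add: G_def)
    have "((\<lambda>x. L x / G x) \<longlongrightarrow> 1) at_infinity"
      by (rule asymp_equivD_strong[OF L[folded G_def]])
         (use nz in \<open>eventually_elim, use G in force\<close>)
    then have "((\<lambda>x. L x / G x * \<Lambda> / (\<rho>' (norm x) / (C\<^sub>\<phi> * norm x powr (- 2 * \<kappa>)))) \<longlongrightarrow> 1 * \<Lambda> / 1) at_infinity"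
      by (intro tendsto_intros filterlim_compose[OF \<rho>'lim nrm]) auto
    then have "((\<lambda>x. L x / G x * \<Lambda> / (\<rho>' (norm x) / (C\<^sub>\<phi> * norm x powr (- 2 * \<kappa>)))) \<longlongrightarrow> \<Lambda>) at_infinity"
      by simp
    then show ?thesis
    proof (rule Lim_transform_eventually)
      show "\<forall>\<^sub>F x in at_infinity. L x / G x * \<Lambda> / (\<rho>' (norm x) / (C\<^sub>\<phi> * norm x powr (- 2 * \<kappa>))) = l' x"
        using nz
      proof eventually_elim
        case (elim x)
        have "norm x powr (2 * \<kappa> + 2) * norm x powr (- 2 * \<kappa>) = (norm x)\<^sup>2"
          using elim by (simp add: powr_add[symmetric])
        moreover have "G x = C\<^sub>\<phi> * \<Lambda> / norm x powr (2 * \<kappa> + 2)" by (simp add: G_def \<Lambda>_def d_def)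
        moreover have "\<Lambda> > 0" using \<kappa> t by (simp add: \<Lambda>_def d_def)
        ultimately show ?case using C elim by (simp add: l'_def mult.assoc mult.left_commute)
      qed
    qed
  qed
  have bound: "\<forall>\<^sub>F x in at_infinity. l' x * (\<integral>y. indicator {..<t} (norm (y::'a)) *
          ((norm y)\<^sup>2 * subordinate DIM('a) (nu (norm x)) (norm y)) \<partial>lborel)
      + 2 * shifted_bound TYPE('a) t \<theta> X Y (norm x) - 2 * outer_weight TYPE('a) t 1 (norm x) < 0"
    by (rule upper_bound_tendsto[OF t d\<kappa>[unfolded d_def] \<eta> \<theta>_def[unfolded d_def] X_def[unfolded \<omega>_def]
      Y_def[unfolded K_def \<omega>_def d_def] \<Lambda>_def[unfolded d_def] l' H])
  have far: "\<forall>\<^sub>F x::'a in at_infinity. norm x \<ge> M"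
    unfolding eventually_at_infinity by auto
  have "\<forall>\<^sub>F x in at_infinity. V x < 0"
    using bound far nz eventually_compose_filterlim[OF \<Phi>pos nrm]
      eventually_compose_filterlim[OF sb(2) nrm] eventually_compose_filterlim[OF sb(3) nrm]
  proof eventually_elim
    case (elim x)
    define r where "r = norm x"
    have r: "r > 0" using elim by (simp add: r_def)
    have \<Phi>r: "\<Phi> (1 / r\<^sup>2) > 0" using elim by (simp add: r_def)
    have Lx: "\<bar>second_diff h \<phi> x\<bar> \<le> L x * (norm h)\<^sup>2" if "norm h < t * norm x" for h
      using ZL elim that by (auto simp: Z_bound_def)
    note I = second_diff_integral_le[OF r[unfolded r_def] \<phi> t \<theta> XY Lx elim(5,6), folded r_def]
    let ?I = "\<integral>y. second_diff (r *\<^sub>R y) \<phi> x * subordinate DIM('a) (nu r) (norm y) \<partial>lborel"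
    have "?I / \<rho>' r < 0"
      using I(2) elim(1) unfolding l'_def r_def[symmetric] by linarith
    then have neg: "?I < 0" using \<rho>'pos[of r] by (simp add: divide_less_0_iff)
    define k where "k = (4 * pi) powr (- d / 2) * \<Phi> (1 / r\<^sup>2) * r powr (- d)"
    have k: "k > 0" using \<Phi>r r by (simp add: k_def)
    let ?F = "\<lambda>h. second_diff h \<phi> x * jump_kernel DIM('a) \<mu> (norm h)"
    have F: "?F (r *\<^sub>R y) = k * (second_diff (r *\<^sub>R y) \<phi> x * subordinate DIM('a) (nu r) (norm y))" for y
      using r jump_kernel_scaled[OF bern r \<Phi>r, of "DIM('a)" "norm y"] by (simp add: k_def nu_def d_def)
    have [measurable]: "jump_kernel DIM('a) \<mu> \<in> borel_measurable borel"
    proof -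
      have "jump_kernel DIM('a) \<mu> = (\<lambda>s. k * subordinate DIM('a) (nu r) (s / r))"
        using jump_kernel_scaled[OF bern r \<Phi>r, of "DIM('a)" "s / r" for s] r
        by (auto simp: k_def nu_def d_def fun_eq_iff)
      then show ?thesis by simp
    qed
    have "(\<lambda>h. second_diff h \<phi> x) \<in> borel_measurable borel"
      unfolding second_diff_def \<phi> by measurable
    then have [measurable]: "?F \<in> borel_measurable borel" by measurable
    have "integrable lborel (\<lambda>y. ?F (r *\<^sub>R y))"
      unfolding F by (rule integrable_mult_right[OF I(1)])
    then have intF: "integrable lebesgue ?F"
      using lborel_integral_scale(1)[OF r, of ?F] by (simp add: integrable_completion)
    have "integral\<^sup>L lebesgue ?F = integral\<^sup>L lborel ?F"
      by (rule integral_completion) simp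
    also have "\<dots> = r ^ DIM('a) * (\<integral>y. ?F (r *\<^sub>R y) \<partial>lborel)"
      by (rule lborel_integral_scale(2)[OF r]) simp
    also have "\<dots> = r ^ DIM('a) * k * ?I" unfolding F by simp
    also have "\<dots> < 0" using neg k r by (intro mult_pos_neg) auto
    finally have "integral\<^sup>L lebesgue ?F < 0" .
    moreover have "V x = 1 / (2 * \<phi> x) * integral\<^sup>L lebesgue ?F"
      using pot intF by (auto simp: pointwise_potential_def)
    ultimately show ?case using pos[of x] by (simp add: divide_neg_pos)
  qed
  then obtain R where R: "\<And>x. norm x \<ge> R \<Longrightarrow> V x < 0"
    by (auto simp: eventually_at_infinity)
  show ?thesis by (intro exI[of _ "max R 1"]) (auto intro: R)
qed

end
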